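(* For any finite field $\mathrm{GF}(q)$ and any integer $t$, there exists an integer $f(t,q)$ such that every cosimple $\mathrm{GF}(q)$-representable matroid with girth at least $f(t,q)$ contains either $M(K_t)$ or $M(K_t)^*$ as a minor.
   Context: Matroids are finite, as usual. $\mathrm{GF}(q)$ denotes the finite field with $q$ elements ($q$ a prime power). A matroid is $\mathrm{GF}(q)$-representable if it is isomorphic to the column matroid of a matrix over $\mathrm{GF}(q)$. A matroid is simple if it has no loops and no parallel pairs (equivalently, no circuits of size at most $2$), and cosimple if its dual matroid is simple (equivalently, it has no cocircuits of size at most $2$). The girth of a matroid $M$ is the minimum number of elements in a circuit of $M$, or $\infty$ if $M$ has no circuits. $K_t$ is the $t$-vertex clique (complete graph), $M(K_t)$ is its graphic (cycle) matroid, and $M(K_t)^*$ is the dual of $M(K_t)$. A matroid contains $N$ as a minor if some matroid obtained from it by deleting and contracting elements is isomorphic to $N$.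
   Formalization: The matroid is assumed nonempty: the empty matroid is cosimple, representable and of infinite girth but has neither minor for t ≥ 2. Also f(t,q) is given for matroids on one arbitrary element type; the natural numbers cover all finite matroids up to isomorphism. *)

theory Defs
  imports Main "HOL-Library.Extended_Nat" "Jordan_Normal_Form.VS_Connect"
begin

text \<open>Matroids, by independent sets.\<close>

record 'a indep_system =
  ground :: "'a set"
  indeps :: "'a set set"

locale matroid =
  fixes M :: "'a indep_system"
  assumes finite_ground: "finite (ground M)"
    and indep_subset_ground: "X \<in> indeps M \<Longrightarrow> X \<subseteq> ground M"
    and indep_empty: "{} \<in> indeps M"
    and indep_subset: "X \<in> indeps M \<Longrightarrow> Y \<subseteq> X \<Longrightarrow> Y \<in> indeps M"
    and indep_augment: "X \<in> indeps M \<Longrightarrow> Y \<in> indeps M \<Longrightarrow> card X < card Y \<Longrightarrow>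
      \<exists>y \<in> Y - X. insert y X \<in> indeps M"

definition matroid_iso :: "'a indep_system \<Rightarrow> 'b indep_system \<Rightarrow> bool" where
  "matroid_iso M N \<longleftrightarrow> (\<exists>h. bij_betw h (ground M) (ground N) \<and>
     (\<forall>X \<subseteq> ground M. X \<in> indeps M \<longleftrightarrow> h ` X \<in> indeps N))"

definition basis :: "'a indep_system \<Rightarrow> 'a set \<Rightarrow> bool" where
  "basis M B \<longleftrightarrow> B \<in> indeps M \<and> (\<forall>X \<in> indeps M. B \<subseteq> X \<longrightarrow> X = B)"

definition circuit :: "'a indep_system \<Rightarrow> 'a set \<Rightarrow> bool" where
  "circuit M C \<longleftrightarrow> C \<subseteq> ground M \<and> C \<notin> indeps M \<and> (\<forall>X. X \<subset> C \<longrightarrow> X \<in> indeps M)"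

text \<open>\<open>Inf {} = \<infinity>\<close> in \<open>enat\<close>, so the girth is infinite if there is no circuit.\<close>

definition girth :: "'a indep_system \<Rightarrow> enat" where
  "girth M = Inf {enat (card C) | C. circuit M C}"

text \<open>The bases of the dual are the complements of the bases.\<close>

definition dual :: "'a indep_system \<Rightarrow> 'a indep_system" where
  "dual M = \<lparr> ground = ground M,
     indeps = {X. X \<subseteq> ground M \<and> (\<exists>B. basis M B \<and> X \<subseteq> ground M - B)} \<rparr>"

definition loop :: "'a indep_system \<Rightarrow> 'a \<Rightarrow> bool" where
  "loop M e \<longleftrightarrow> circuit M {e}"

definition parallel_pair :: "'a indep_system \<Rightarrow> 'a \<Rightarrow> 'a \<Rightarrow> bool" where
  "parallel_pair M e f \<longleftrightarrow> e \<noteq> f \<and> circuit M {e, f}"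

definition simple_matroid :: "'a indep_system \<Rightarrow> bool" where
  "simple_matroid M \<longleftrightarrow> (\<nexists>e. loop M e) \<and> (\<nexists>e f. parallel_pair M e f)"

definition cosimple_matroid :: "'a indep_system \<Rightarrow> bool" where
  "cosimple_matroid M \<longleftrightarrow> simple_matroid (dual M)"

definition deletion :: "'a indep_system \<Rightarrow> 'a set \<Rightarrow> 'a indep_system" where
  "deletion M D = \<lparr> ground = ground M - D, indeps = {X \<in> indeps M. X \<subseteq> ground M - D} \<rparr>"

definition contraction :: "'a indep_system \<Rightarrow> 'a set \<Rightarrow> 'a indep_system" where
  "contraction M C = dual (deletion (dual M) C)"

inductive minor_of :: "'a indep_system \<Rightarrow> 'a indep_system \<Rightarrow> bool" where
  minor_refl: "minor_of M M"
| minor_delete: "minor_of N M \<Longrightarrow> D \<subseteq> ground N \<Longrightarrow> minor_of (deletion N D) M"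
| minor_contract: "minor_of N M \<Longrightarrow> C \<subseteq> ground N \<Longrightarrow> minor_of (contraction N C) M"

definition has_minor :: "'a indep_system \<Rightarrow> 'b indep_system \<Rightarrow> bool" where
  "has_minor M N \<longleftrightarrow> (\<exists>M'. minor_of M' M \<and> matroid_iso M' N)"

text \<open>Equal columns at different indices are parallel elements, so independence is that of
  the family of columns. The library's linear independence is a property of sets of vectors;
  for a family one also has to require injectivity.\<close>

definition column_matroid :: "'k::field mat \<Rightarrow> nat indep_system" where
  "column_matroid A = \<lparr> ground = {..<dim_col A},
     indeps = {X. X \<subseteq> {..<dim_col A} \<and> inj_on (col A) X \<and>
       \<not> module.lin_dep class_ring (module_vec TYPE('k) (dim_row A)) (col A ` X)} \<rparr>"

definition representable :: "'k::field itself \<Rightarrow> 'a indep_system \<Rightarrow> bool" where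
  "representable _ M \<longleftrightarrow> (\<exists>A :: 'k mat. matroid_iso M (column_matroid A))"

text \<open>A simple graph is given by its set of edges, which are two-element sets of vertices.
  A cycle is given by its sequence of vertices.\<close>

definition cycle_edges :: "'v list \<Rightarrow> 'v set set" where
  "cycle_edges vs = {{vs ! i, vs ! (Suc i mod length vs)} | i. i < length vs}"

definition is_cycle :: "'v set set \<Rightarrow> 'v list \<Rightarrow> bool" where
  "is_cycle E vs \<longleftrightarrow> 3 \<le> length vs \<and> distinct vs \<and> cycle_edges vs \<subseteq> E"

definition cycle_matroid :: "'v set set \<Rightarrow> 'v set indep_system" where
  "cycle_matroid E = \<lparr> ground = E, indeps = {X. X \<subseteq> E \<and> (\<nexists>vs. is_cycle X vs)} \<rparr>"

definition clique :: "nat \<Rightarrow> nat set set" where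
  "clique t = {e. e \<subseteq> {..<t} \<and> card e = 2}"

end

theory Submission
  imports Defs Complex_Main "HOL-Library.Cardinality" "HOL-Library.FuncSet"
begin

text \<open>
  A representable matroid is given by a code: the finite space of all linear
  functionals, evaluated at the elements. Independence of \<open>X\<close> means that all value patterns on
  \<open>X\<close> occur, contraction keeps the words that vanish on the contracted set, and the dual matroid
  belongs to the orthogonal code.

  (1) A code with \<open>q\<^sup>r\<close> words and more than \<open>\<Lambda> r\<close> distinct columns, \<open>\<Lambda>\<close> large, has an
  \<open>M(K\<^sub>t)\<close>-minor. Contract elements as long as the density persists. Afterwards each element \<open>e\<close>
  lies in many triangles \<open>x, x + c e, e\<close>. For a random word \<open>f\<close>, many triangles have \<open>f e = 0\<close> and
  \<open>f x \<noteq> 0\<close>. A connected piece \<open>K\<close> of the graph of these pairs, with minimum degree bounded below,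
  together with its set \<open>D\<close> of labels \<open>e\<close>, consists of a dense set \<open>D\<close> in a hyperplane of the span
  of \<open>K \<union> D\<close> and a set \<open>K\<close> off this hyperplane that spans \<open>D\<close>. Iteration inside \<open>D\<close> gives many
  such \<open>apexes\<close> over one independent set, and two applications of the pigeonhole principle give
  columns \<open>v\<^sub>i + y\<^sub>j\<close>, that is \<open>M(K\<^sub>t\<^sub>,\<^sub>t)\<close>; contract a perfect matching.

  (2) Suppose that neither \<open>M\<close> nor its dual has an \<open>M(K\<^sub>t)\<close>-minor, and let \<open>B\<close> be a basis and \<open>Y\<close>
  its complement. By (1) for the simple dual, \<open>card B \<le> \<Lambda> card Y\<close>. By (1) for the contractions of
  \<open>M\<close>, the columns in \<open>Y\<close>, written in the basis \<open>B\<close>, have at most \<open>\<Lambda> card A + 1\<close> different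
  restrictions to any set \<open>A\<close> of rows. Haussler's packing argument then provides two columns that
  differ in a bounded number of rows, hence a circuit of bounded size.
\<close>

section \<open>Codes\<close>

text \<open>Words instead of vectors keep all objects finite and comparable: contraction passes to a
  subset of the words, a rank bound \<open>r\<close> is stated as a bound \<open>q ^ r\<close> on
  the number of words, and a random hyperplane is an average over the code.

  Both halves meet the same difficulty from opposite sides. In (1), passing from a dense piece to
  its labels must not lose density, so the labels have to span little. In (2), Haussler's argument
  rests on an upper bound for the edges of a one-inclusion graph, usually drawn from the
  Vapnik-Chervonenkis dimension. Here the labels of the edges are rows, hence independent, and too
  many edges would force them to span little. One estimate, \<open>rank_bound\<close>, applied to
  the pieces found by \<open>labelled_core\<close>, therefore serves both. It trades off two ways of
  spanning a piece: contract labels, or pick representatives of what is left.\<close>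

definition linear_code :: "'a set \<Rightarrow> ('a \<Rightarrow> 'k::field) set \<Rightarrow> bool" where
  "linear_code E C \<longleftrightarrow> finite E \<and> (\<lambda>_. 0) \<in> C \<and> (\<forall>f\<in>C. \<forall>x. x \<notin> E \<longrightarrow> f x = 0) \<and>
     (\<forall>f\<in>C. \<forall>g\<in>C. \<forall>c. (\<lambda>x. f x + c * g x) \<in> C)"

definition shorten :: "'a set \<Rightarrow> ('a \<Rightarrow> 'k::field) set \<Rightarrow> ('a \<Rightarrow> 'k) set" where
  "shorten Z C = {f \<in> C. \<forall>z\<in>Z. f z = 0}"

definition puncture :: "'a set \<Rightarrow> ('a \<Rightarrow> 'k::field) set \<Rightarrow> ('a \<Rightarrow> 'k) set" where
  "puncture D C = (\<lambda>f x. if x \<in> D then f x else 0) ` C"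

text \<open>Extended by zero off \<open>C\<close>, so that agreement on all words of
  \<open>C\<close> is equality of functions.\<close>

definition column :: "('a \<Rightarrow> 'k::field) set \<Rightarrow> 'a \<Rightarrow> ('a \<Rightarrow> 'k) \<Rightarrow> 'k" where
  "column C x = (\<lambda>f. if f \<in> C then f x else 0)"

text \<open>Proportional columns count separately, so this exceeds the number of parallel classes of
  non-loops by a factor of at most \<open>q - 1\<close>, which the constants absorb.\<close>

definition points :: "'a set \<Rightarrow> ('a \<Rightarrow> 'k::field) set \<Rightarrow> nat" where
  "points E C = card (column C ` E - {\<lambda>_. 0})"

definition shattered :: "('a \<Rightarrow> 'k::field) set \<Rightarrow> 'a set \<Rightarrow> bool" where
  "shattered C X \<longleftrightarrow> (\<forall>h. \<exists>g\<in>C. \<forall>x\<in>X. g x = h x)"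

lemma column_eq_iff: "column C x = column C y \<longleftrightarrow> (\<forall>f\<in>C. f x = f y)"
  by (auto simp: column_def fun_eq_iff)

lemma column_eqD: "column C x = column C y \<Longrightarrow> f \<in> C \<Longrightarrow> f x = f y"
  by (simp add: column_def fun_eq_iff) metis

lemma column_zero_iff: "column C x = (\<lambda>_. 0) \<longleftrightarrow> (\<forall>f\<in>C. f x = 0)"
  by (auto simp: column_def fun_eq_iff)

lemma linear_code_finite_ground: "linear_code E C \<Longrightarrow> finite E"
  by (simp add: linear_code_def)

lemma linear_code_zero: "linear_code E C \<Longrightarrow> (\<lambda>_. 0) \<in> C"
  by (simp add: linear_code_def)

lemma linear_code_support: "linear_code E C \<Longrightarrow> f \<in> C \<Longrightarrow> x \<notin> E \<Longrightarrow> f x = 0"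
  by (simp add: linear_code_def)

lemma linear_code_add_scale:
  "linear_code E C \<Longrightarrow> f \<in> C \<Longrightarrow> g \<in> C \<Longrightarrow> (\<lambda>x. f x + c * g x) \<in> C"
  by (simp add: linear_code_def)

lemma linear_code_scale: "linear_code E C \<Longrightarrow> g \<in> C \<Longrightarrow> (\<lambda>x. c * g x) \<in> C"
  using linear_code_add_scale[of E C "\<lambda>_. 0" g c] by (simp add: linear_code_zero)

lemma linear_code_diff: "linear_code E C \<Longrightarrow> f \<in> C \<Longrightarrow> g \<in> C \<Longrightarrow> (\<lambda>x. f x - g x) \<in> C"
  using linear_code_add_scale[of E C f g "-1"] by simp

lemma linear_code_sum:
  assumes C: "linear_code E C" and "finite I" "\<And>i. i \<in> I \<Longrightarrow> g i \<in> C"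
  shows "(\<lambda>x. \<Sum>i\<in>I. c i * g i x) \<in> C"
  using assms(2,3)
proof (induction I rule: finite_induct)
  case empty
  then show ?case by (simp add: linear_code_zero[OF C])
next
  case (insert i I)
  then have "(\<lambda>x. \<Sum>i\<in>I. c i * g i x) \<in> C" "g i \<in> C" by auto
  from linear_code_add_scale[OF C this, of "c i"] insert.hyps show ?case
    by (simp add: add.commute)
qed

lemma linear_code_finite:
  fixes C :: "('a \<Rightarrow> 'k::{field,finite}) set"
  assumes "linear_code E C" shows "finite C"
proof (rule finite_subset)
  show "C \<subseteq> {f. \<forall>x. (x \<in> E \<longrightarrow> f x \<in> (UNIV::'k set)) \<and> (x \<notin> E \<longrightarrow> f x = 0)}"
    using assms by (auto simp: linear_code_def)
  show "finite {f. \<forall>x. (x \<in> E \<longrightarrow> f x \<in> (UNIV::'k set)) \<and> (x \<notin> E \<longrightarrow> f x = 0)}"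
    using assms by (intro finite_set_of_finite_funs) (auto simp: linear_code_def)
qed

section \<open>Contraction and deletion of codes\<close>

lemma shorten_shorten: "shorten Z (shorten Y C) = shorten (Y \<union> Z) C"
  by (auto simp: shorten_def)

lemma shorten_empty [simp]: "shorten {} C = C"
  by (auto simp: shorten_def)

lemma linear_code_shorten: "linear_code E C \<Longrightarrow> linear_code E (shorten Z C)"
  by (auto simp: linear_code_def shorten_def)

lemma linear_code_puncture:
  assumes C: "linear_code E C" and D: "finite D"
  shows "linear_code D (puncture D C)"
proof -
  have "(\<lambda>x. f x + c * g x) \<in> puncture D C" if f: "f \<in> puncture D C" and g: "g \<in> puncture D C" for f g c
  proof -
    obtain f' g' where f': "f' \<in> C" "f = (\<lambda>x. if x \<in> D then f' x else 0)"
      and g': "g' \<in> C" "g = (\<lambda>x. if x \<in> D then g' x else 0)"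
      using f g by (auto simp: puncture_def)
    have "(\<lambda>x. f' x + c * g' x) \<in> C" by (rule linear_code_add_scale[OF C f'(1) g'(1)])
    then show ?thesis unfolding puncture_def f'(2) g'(2)
      by (rule rev_image_eqI) auto
  qed
  moreover have "(\<lambda>_. 0) \<in> puncture D C"
    unfolding puncture_def by (rule rev_image_eqI[OF linear_code_zero[OF C]]) auto
  ultimately show ?thesis using D by (auto simp: linear_code_def puncture_def)
qed

text \<open>A word with value 1 at \<open>e\<close> splits the code into its scalar multiples and
  the words vanishing at \<open>e\<close>. This is the form in which contracting a non-loop lowers
  the rank by one.\<close>

lemma card_shorten_one:
  fixes C :: "('a \<Rightarrow> 'k::{field,finite}) set"
  assumes C: "linear_code E C" and f: "f \<in> C" "f e \<noteq> 0"
  shows "card C = CARD('k) * card (shorten {e} C)"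
proof -
  define u where "u = (\<lambda>x. inverse (f e) * f x)"
  have u: "u \<in> C" "u e = 1" using f linear_code_scale[OF C f(1)] by (auto simp: u_def)
  have "bij_betw (\<lambda>(c, g) x. g x + c * u x) (UNIV \<times> shorten {e} C) C"
  proof (rule bij_betw_byWitness[where f' = "\<lambda>f. (f e, \<lambda>x. f x - f e * u x)"])
    show "(\<lambda>(c, g) x. g x + c * u x) ` (UNIV \<times> shorten {e} C) \<subseteq> C"
    proof clarify
      fix c g assume "g \<in> shorten {e} C"
      then have "g \<in> C" by (simp add: shorten_def)
      then show "(\<lambda>x. g x + c * u x) \<in> C" by (rule linear_code_add_scale[OF C _ u(1)])
    qed
    show "(\<lambda>f. (f e, \<lambda>x. f x - f e * u x)) ` C \<subseteq> UNIV \<times> shorten {e} C"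
    proof (rule image_subsetI, rule SigmaI)
      fix g assume "g \<in> C"
      then have "(\<lambda>x. g x + (- g e) * u x) \<in> C" by (rule linear_code_add_scale[OF C _ u(1)])
      then show "(\<lambda>x. g x - g e * u x) \<in> shorten {e} C" using u by (simp add: shorten_def)
    qed simp
  qed (use u in \<open>auto simp: shorten_def\<close>)
  from bij_betw_same_card[OF this] show ?thesis by (simp add: card_cartesian_product)
qed

text \<open>Subtracting from \<open>g\<close> the multiple of \<open>f\<close> that agrees with it
  at \<open>e\<close> leaves a word of the shortened code, which cannot distinguish \<open>x\<close>
  from \<open>y\<close>. The scalar is read off from \<open>f\<close> alone, so columns that merge
  differ by a multiple of the column of \<open>e\<close>.\<close>

lemma column_shorten_one_eq:
  assumes C: "linear_code E C" and f: "f \<in> C" "f e \<noteq> 0"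
    and eq: "column (shorten {e} C) x = column (shorten {e} C) y"
  shows "\<exists>c. \<forall>g\<in>C. g y = g x + c * g e"
proof (intro exI ballI)
  fix g assume g: "g \<in> C"
  define h where "h = (\<lambda>x. g x + (- (g e / f e)) * f x)"
  have "h \<in> C" unfolding h_def by (rule linear_code_add_scale[OF C g f(1)])
  then have "h \<in> shorten {e} C" using f(2) by (simp add: h_def shorten_def)
  then have "h x = h y" using eq by (auto simp: column_eq_iff)
  then show "g y = g x + ((f y - f x) / f e) * g e"
    using f(2) by (simp add: h_def field_simps)
qed

section \<open>Independent and spanning sets of a code\<close>

lemma shattered_subset: "shattered C X \<Longrightarrow> Y \<subseteq> X \<Longrightarrow> shattered C Y"
  unfolding shattered_def by blast

lemma shattered_insert:
  assumes C: "linear_code E C" and X: "shattered C X"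
    and g: "g \<in> C" "\<And>x. x \<in> X \<Longrightarrow> g x = 0" "g e \<noteq> 0"
  shows "shattered C (insert e X)"
  unfolding shattered_def
proof
  fix h
  obtain f where f: "f \<in> C" "\<And>x. x \<in> X \<Longrightarrow> f x = h x" using X unfolding shattered_def by blast
  define k where "k = (\<lambda>x. f x + ((h e - f e) / g e) * g x)"
  have "k \<in> C" unfolding k_def by (rule linear_code_add_scale[OF C f(1) g(1)])
  moreover have "k x = h x" if "x \<in> insert e X" for x
  proof (cases "x = e")
    case True then show ?thesis using g by (simp add: k_def)
  next
    case False then show ?thesis using that f g by (simp add: k_def)
  qed
  ultimately show "\<exists>k\<in>C. \<forall>x\<in>insert e X. k x = h x" by blast
qed

lemma shattered_dual:
  assumes "shattered C X"
  shows "\<exists>g\<in>C. \<forall>x\<in>X. g x = (if x = e then 1 else 0)"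
  using assms[unfolded shattered_def, rule_format, of "\<lambda>x. if x = e then 1 else 0"] .

text \<open>An inclusion-maximal shattered set spans: a word vanishing on it but not at some
  \<open>y\<close> would allow \<open>y\<close> to be added.\<close>

lemma shattered_maximal_extension:
  assumes C: "linear_code E C" and Y: "finite Y" and X: "X \<subseteq> Y" "shattered C X"
  shows "\<exists>B. X \<subseteq> B \<and> B \<subseteq> Y \<and> shattered C B \<and>
    (\<forall>g\<in>C. (\<forall>x\<in>B. g x = 0) \<longrightarrow> (\<forall>y\<in>Y. g y = 0))"
proof -
  define P where "P = {B. X \<subseteq> B \<and> B \<subseteq> Y \<and> shattered C B}"
  have "finite P" using Y by (rule_tac finite_subset[of _ "Pow Y"]) (auto simp: P_def)
  moreover have "P \<noteq> {}" using X by (auto simp: P_def)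
  ultimately obtain B where B: "B \<in> P" and mx: "\<forall>B'\<in>P. B \<subseteq> B' \<longrightarrow> B = B'"
    by (blast dest: finite_has_maximal)
  have "g y = 0" if g: "g \<in> C" "\<forall>x\<in>B. g x = 0" and y: "y \<in> Y" for g y
  proof (rule ccontr)
    assume "g y \<noteq> 0"
    then have "shattered C (insert y B)"
      using B g by (intro shattered_insert[OF C, of _ g]) (auto simp: P_def)
    then have "insert y B \<in> P" using B y by (auto simp: P_def)
    then have "y \<in> B" using mx by blast
    then show False using g \<open>g y \<noteq> 0\<close> by simp
  qed
  then have "\<forall>g\<in>C. (\<forall>x\<in>B. g x = 0) \<longrightarrow> (\<forall>y\<in>Y. g y = 0)" by simp
  moreover have "X \<subseteq> B" "B \<subseteq> Y" "shattered C B" using B by (auto simp: P_def)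
  ultimately show ?thesis by (intro exI[of _ B]) simp
qed

lemma shattered_basis:
  assumes C: "linear_code E C" and Y: "finite Y"
  shows "\<exists>B\<subseteq>Y. shattered C B \<and> (\<forall>g\<in>C. (\<forall>x\<in>B. g x = 0) \<longrightarrow> (\<forall>y\<in>Y. g y = 0))"
proof -
  have "shattered C {}" using linear_code_zero[OF C] by (auto simp: shattered_def)
  from shattered_maximal_extension[OF C Y _ this] show ?thesis by auto
qed

section \<open>Ranks read off from the number of words\<close>

lemma card_le_power_determining:
  fixes C :: "('a \<Rightarrow> 'k::{field,finite}) set"
  assumes C: "linear_code E C" and X: "finite X"
    and det: "\<forall>g\<in>C. (\<forall>x\<in>X. g x = 0) \<longrightarrow> g = (\<lambda>_. 0)"
  shows "card C \<le> CARD('k) ^ card X"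
proof -
  have "inj_on (\<lambda>f. restrict f X) C"
  proof (rule inj_onI)
    fix f g assume f: "f \<in> C" and g: "g \<in> C" and eq: "restrict f X = restrict g X"
    have "f x = g x" if "x \<in> X" for x using fun_cong[OF eq, of x] that by simp
    then have "(\<lambda>x. f x - g x) = (\<lambda>_. 0)"
      using linear_code_diff[OF C f g] det by simp
    then show "f = g" by (auto simp: fun_eq_iff)
  qed
  then have "card C = card ((\<lambda>f. restrict f X) ` C)" by (simp add: card_image)
  also have "\<dots> \<le> card (X \<rightarrow>\<^sub>E (UNIV :: 'k set))"
    by (rule card_mono) (auto intro: finite_PiE X)
  also have "\<dots> = CARD('k) ^ card X" by (simp add: card_PiE X)
  finally show ?thesis .
qed

lemma power_le_card_shattered:
  fixes C :: "('a \<Rightarrow> 'k::{field,finite}) set"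
  assumes C: "linear_code E C" and X: "finite X" and sh: "shattered C X"
  shows "CARD('k) ^ card X \<le> card C"
  using X sh C
proof (induction X arbitrary: C rule: finite_induct)
  case empty
  then have "C \<noteq> {}" "finite C" using linear_code_zero linear_code_finite by blast+
  then show ?case by (simp add: Suc_le_eq card_gt_0_iff)
next
  case (insert e X)
  obtain f where f: "f \<in> C" "f e = 1"
    using shattered_dual[OF insert.prems(1), of e] by auto
  have "shattered (shorten {e} C) X"
    unfolding shattered_def
  proof
    fix h
    obtain g where "g \<in> C" "\<forall>x\<in>insert e X. g x = (h(e := 0)) x"
      using insert.prems(1) unfolding shattered_def by blast
    moreover have "\<And>x. x \<in> X \<Longrightarrow> x \<noteq> e" using insert.hyps by blast
    ultimately show "\<exists>g\<in>shorten {e} C. \<forall>x\<in>X. g x = h x"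
      by (intro bexI[of _ g]) (auto simp: shorten_def)
  qed
  then have "CARD('k) ^ card X \<le> card (shorten {e} C)"
    using insert.IH insert.prems linear_code_shorten by blast
  then show ?case
    using card_shorten_one[OF insert.prems(2) f(1), of e] f(2) insert.hyps by simp
qed

lemma two_le_card_field: "2 \<le> CARD('k::{field,finite})"
  using card_mono[of "UNIV :: 'k set" "{0, 1}"] by simp

lemma exists_shattered_card:
  fixes C :: "('a \<Rightarrow> 'k::{field,finite}) set"
  assumes C: "linear_code E C" and card: "CARD('k) ^ R \<le> card C"
    and X: "finite X" "\<forall>g\<in>C. (\<forall>x\<in>X. g x = 0) \<longrightarrow> g = (\<lambda>_. 0)"
  shows "\<exists>P\<subseteq>X. card P = R \<and> shattered C P"
proof -
  obtain B where B: "B \<subseteq> X" "shattered C B"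
    "\<forall>g\<in>C. (\<forall>x\<in>B. g x = 0) \<longrightarrow> (\<forall>y\<in>X. g y = 0)"
    using shattered_basis[OF C X(1)] by blast
  have fB: "finite B" using B X finite_subset by blast
  have "card C \<le> CARD('k) ^ card B"
    by (rule card_le_power_determining[OF C fB]) (use B(3) X(2) in blast)
  with card have "CARD('k) ^ R \<le> CARD('k) ^ card B" by linarith
  then have "R \<le> card B" using two_le_card_field[where 'k='k] by (simp add: power_le_imp_le_exp)
  then obtain P where P: "P \<subseteq> B" "card P = R" using obtain_subset_with_card_n by blast
  then show ?thesis using B(1) shattered_subset[OF B(2)] by blast
qed

text \<open>\<open>Z\<close> is a basis of the contraction by \<open>Y\<close>. Every word can be
  corrected on \<open>Z\<close> by a word vanishing on \<open>Y\<close>, so restrictions to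
  \<open>Y\<close> survive, while no nonzero word invisible on \<open>Y\<close> is left. This cuts a
  code down to the span of \<open>Y\<close>.\<close>

lemma faithful_contraction:
  assumes C: "linear_code E C"
  shows "\<exists>Z\<subseteq>E. (\<forall>f\<in>C. \<exists>g\<in>shorten Z C. \<forall>y\<in>Y. g y = f y) \<and>
    (\<forall>g\<in>shorten Z C. (\<forall>y\<in>Y. g y = 0) \<longrightarrow> g = (\<lambda>_. 0))"
proof -
  have U: "linear_code E (shorten Y C)" by (rule linear_code_shorten[OF C])
  obtain Z where Z: "Z \<subseteq> E" "shattered (shorten Y C) Z"
    "\<forall>g\<in>shorten Y C. (\<forall>x\<in>Z. g x = 0) \<longrightarrow> (\<forall>y\<in>E. g y = 0)"
    using shattered_basis[OF U linear_code_finite_ground[OF C]] by blast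
  have "\<exists>g\<in>shorten Z C. \<forall>y\<in>Y. g y = f y" if f: "f \<in> C" for f
  proof -
    obtain u where u: "u \<in> shorten Y C" "\<forall>z\<in>Z. u z = f z" using Z(2) unfolding shattered_def by blast
    then have "u \<in> C" by (simp add: shorten_def)
    from linear_code_diff[OF C f this] have "(\<lambda>x. f x - u x) \<in> shorten Z C"
      using u by (simp add: shorten_def)
    then show ?thesis
      by (rule rev_bexI) (use u in \<open>auto simp: shorten_def\<close>)
  qed
  moreover have "g = (\<lambda>_. 0)" if g: "g \<in> shorten Z C" "\<forall>y\<in>Y. g y = 0" for g
  proof -
    have "g \<in> shorten Y C" "\<forall>z\<in>Z. g z = 0" using g by (auto simp: shorten_def)
    then have "\<forall>y\<in>E. g y = 0" using Z(3) by blast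
    moreover have "\<forall>y. y \<notin> E \<longrightarrow> g y = 0" using g linear_code_support[OF C] by (auto simp: shorten_def)
    ultimately show ?thesis by blast
  qed
  ultimately show ?thesis using Z(1) by blast
qed

section \<open>Ranks of sets with many labelled differences\<close>

text \<open>A fibre with \<open>n \<ge> 2\<close> elements loses \<open>n - 1\<close> of them under
  \<open>g\<close>, which is at least half, and every fibre meeting \<open>M\<close> is of this
  kind.\<close>

lemma card_nontrivial_fibres:
  assumes A: "finite A" and M: "M \<subseteq> A"
    and nt: "\<And>a. a \<in> M \<Longrightarrow> \<exists>a'\<in>A. a' \<noteq> a \<and> g a' = g a"
  shows "2 * card (g ` A) + card M \<le> 2 * card A"
proof -
  let ?F = "\<lambda>b. {a \<in> A. g a = b}" and ?N = "\<lambda>b. {a \<in> M. g a = b}"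
  have fM: "finite M" using A M finite_subset by blast
  have "2 + card (?N b) \<le> 2 * card (?F b)" if b: "b \<in> g ` A" for b
  proof (cases "?N b = {}")
    case True
    have "?F b \<noteq> {}" using b by auto
    then have "0 < card (?F b)" using A by (simp add: card_gt_0_iff)
    then show ?thesis unfolding True by simp
  next
    case False
    then obtain a where a: "a \<in> M" "g a = b" by auto
    then obtain a' where a': "a' \<in> A" "a' \<noteq> a" "g a' = b" using nt by blast
    then have "card {a, a'} \<le> card (?F b)" using a M A by (intro card_mono) auto
    moreover have "card (?N b) \<le> card (?F b)" using M A by (intro card_mono) auto
    ultimately show ?thesis using a' by simp
  qed
  then have "(\<Sum>b\<in>g ` A. 2 + card (?N b)) \<le> (\<Sum>b\<in>g ` A. 2 * card (?F b))"
    by (rule sum_mono)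
  moreover have "(\<Sum>b\<in>g ` A. card (?F b)) = card A"
    using sum.image_gen[OF A, of "\<lambda>_. 1::nat" g] by simp
  moreover have "(\<Sum>b\<in>g ` A. card (?N b)) = card M"
  proof -
    have "card M = (\<Sum>b\<in>g ` M. card (?N b))"
      using sum.image_gen[OF fM, of "\<lambda>_. 1::nat" g] by simp
    also have "\<dots> = (\<Sum>b\<in>g ` A. card (?N b))"
    proof (rule sum.mono_neutral_left)
      have "?N b = {}" if "b \<in> g ` A - g ` M" for b using that by blast
      then show "\<forall>b\<in>g ` A - g ` M. card (?N b) = 0" by (metis card.empty)
    qed (use A M in auto)
    finally show ?thesis by simp
  qed
  moreover have "(\<Sum>b\<in>g ` A. 2 + card (?N b)) = card (g ` A) * 2 + (\<Sum>b\<in>g ` A. card (?N b))"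
    by (simp only: sum.distrib sum_constant of_nat_id)
  moreover have "(\<Sum>b\<in>g ` A. 2 * card (?F b)) = 2 * (\<Sum>b\<in>g ` A. card (?F b))"
    by (simp only: sum_distrib_left)
  ultimately show ?thesis by linarith
qed

text \<open>\<open>K\<close> is viewed as a graph in which \<open>x\<close> and \<open>y\<close> are
  joined by an edge labelled \<open>e\<close> when their columns differ by a nonzero multiple of
  that of \<open>e\<close>; these are the labels seen from \<open>x\<close>.\<close>

definition labels :: "('a \<Rightarrow> 'k::field) set \<Rightarrow> 'a set \<Rightarrow> 'a set \<Rightarrow> 'a \<Rightarrow> 'a set" where
  "labels C D K x = {e \<in> D. \<exists>y\<in>K. \<exists>c. c \<noteq> 0 \<and> (\<forall>f\<in>C. f y = f x + c * f e)}"

text \<open>If every vertex sees many labels, few elements span \<open>K\<close>: contracting a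
  well-chosen small \<open>L\<close> merges \<open>K\<close> into few classes, and \<open>L\<close>
  together with one representative per class spans. A label outside the span of \<open>L\<close> is
  seen from at most \<open>2 * s\<close> representatives, and a label in the span of
  \<open>L\<close> only leads around inside a class, so many labels per representative leave room
  for few representatives.\<close>

lemma rank_bound:
  fixes C :: "('a \<Rightarrow> 'k::{field,finite}) set"
  assumes K: "finite K" and D: "finite D" and inj: "inj_on (column C) D"
    and deg: "\<And>x. x \<in> K \<Longrightarrow> \<alpha> \<le> card (labels C D K x)"
  shows "\<exists>L R. L \<subseteq> D \<and> R \<subseteq> K \<and> (\<forall>g\<in>C. (\<forall>z\<in>L \<union> R. g z = 0) \<longrightarrow> (\<forall>x\<in>K. g x = 0)) \<and>
     s * card L \<le> card (column C ` K) \<and>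
     \<alpha> * card R \<le> 4 * s * card D + 2 * CARD('k) * card (column C ` K)"
proof -
  let ?q = "CARD('k)"
  define \<kappa> where "\<kappa> L = card (column (shorten L C) ` K)" for L
  \<comment> \<open>Each contracted label costs \<open>s\<close>. At a minimum, one further label
    thus merges away at most \<open>s\<close> classes, and comparison with the empty set bounds
    \<open>card L\<close>.\<close>
  define w where "w L = \<kappa> L + s * card L" for L
  obtain L where L: "L \<subseteq> D" and Lmin: "\<And>L'. L' \<subseteq> D \<Longrightarrow> w L \<le> w L'"
    using ex_min_if_finite[of "w ` Pow D"] D
    by (metis (no_types, lifting) Pow_iff arg_min_if_finite(1) arg_min_least empty_iff finite_Pow_iff Pow_bottom)
  have fL: "finite L" using L D finite_subset by blast
  let ?C = "shorten L C"
  have "w L \<le> w {}" by (rule Lmin) simp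
  then have sL: "s * card L \<le> card (column C ` K)" by (simp add: w_def \<kappa>_def)
  obtain R where R: "R \<subseteq> K" "inj_on (column ?C) R" "column ?C ` K = column ?C ` R"
    using subset_image_inj[of "column ?C ` K" "column ?C" K] by auto
  have fR: "finite R" using R(1) K finite_subset by blast
  have cR: "card R = \<kappa> L" unfolding \<kappa>_def R(3) by (simp add: card_image R(2))
  have det: "\<forall>x\<in>K. g x = 0" if g: "g \<in> C" "\<forall>z\<in>L \<union> R. g z = 0" for g
  proof
    fix x assume "x \<in> K"
    then have "column ?C x \<in> column ?C ` R" using R(3) by blast
    then obtain r where r: "r \<in> R" "column ?C x = column ?C r" by blast
    have "g \<in> ?C" using g by (simp add: shorten_def)
    then have "g x = g r" by (rule column_eqD[OF r(2)])
    then show "g x = 0" using g r by simp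
  qed
  define cls where "cls r = {x \<in> K. column ?C x = column ?C r}" for r
  define cl where "cl r = column C ` cls r" for r
  have fcls: "finite (cls r)" for r using K by (simp add: cls_def)
  have cl_disj: "cl r \<inter> cl r' = {}" if "r \<in> R" "r' \<in> R" "r \<noteq> r'" for r r'
  proof -
    have mono: "column ?C x = column ?C y" if "column C x = column C y" for x y
      using that by (auto simp: column_eq_iff shorten_def)
    have False if v: "v \<in> cl r" "v \<in> cl r'" for v
    proof -
      obtain x where x: "v = column C x" "column ?C x = column ?C r" using v(1) by (auto simp: cl_def cls_def)
      obtain y where y: "v = column C y" "column ?C y = column ?C r'" using v(2) by (auto simp: cl_def cls_def)
      have "column ?C r = column ?C r'" using mono[of x y] x y by simp
      then show False using \<open>r \<in> R\<close> \<open>r' \<in> R\<close> \<open>r \<noteq> r'\<close> R(2) by (simp add: inj_on_eq_iff)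
    qed
    then show ?thesis by blast
  qed
  have sum_cl: "(\<Sum>r\<in>B. card (cl r)) \<le> card (column C ` K)" if "B \<subseteq> R" for B
  proof -
    have "(\<Sum>r\<in>B. card (cl r)) = card (\<Union>r\<in>B. cl r)"
    proof (rule card_UN_disjoint[symmetric])
      show "finite B" using that fR finite_subset by blast
      show "\<forall>r\<in>B. finite (cl r)" using fcls by (simp add: cl_def)
      show "\<forall>r\<in>B. \<forall>r'\<in>B. r \<noteq> r' \<longrightarrow> cl r \<inter> cl r' = {}" using that cl_disj by blast
    qed
    also have "\<dots> \<le> card (column C ` K)"
      using K by (intro card_mono) (auto simp: cl_def cls_def)
    finally show ?thesis .
  qed
  \<comment> \<open>\<open>T r\<close> collects the labels that survive the contraction of
    \<open>L\<close>, \<open>S r\<close> those that become loops.\<close>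
  define T where "T r = {e \<in> labels C D K r. \<exists>f\<in>?C. f e \<noteq> 0}" for r
  define S where "S r = {e \<in> labels C D K r. \<forall>f\<in>?C. f e = 0}" for r
  have fin_lab: "finite (labels C D K r)" for r using D by (simp add: labels_def)
  have lab_split: "card (labels C D K r) \<le> card (T r) + card (S r)" for r
    by (rule order_trans[OF card_mono card_Un_le]) (use fin_lab in \<open>auto simp: T_def S_def\<close>)
  \<comment> \<open>A label that becomes a loop leads from \<open>r\<close> to a column of the same
    class, and it is recovered from that column and the nonzero scalar.\<close>
  have card_S: "card (S r) \<le> ?q * card (cl r)" if r: "r \<in> R" for r
  proof -
    have "\<forall>e\<in>S r. \<exists>p. fst p \<in> K \<and> snd p \<noteq> 0 \<and> (\<forall>f\<in>C. f (fst p) = f r + snd p * f e)"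
      by (auto simp: S_def labels_def)
    then obtain p where p: "\<And>e. e \<in> S r \<Longrightarrow> fst (p e) \<in> K \<and> snd (p e) \<noteq> 0 \<and>
        (\<forall>f\<in>C. f (fst (p e)) = f r + snd (p e) * f e)" by metis
    have pcls: "fst (p e) \<in> cls r" if e: "e \<in> S r" for e
    proof -
      have "f (fst (p e)) = f r" if "f \<in> ?C" for f
      proof -
        have f: "f \<in> C" "f e = 0" using that e by (auto simp: shorten_def S_def)
        then have "f (fst (p e)) = f r + snd (p e) * f e" using p[OF e] by blast
        then show ?thesis using f by simp
      qed
      then show ?thesis using p[OF e] by (simp add: cls_def column_eq_iff)
    qed
    have "inj_on (\<lambda>e. (snd (p e), column C (fst (p e)))) (S r)"
    proof (rule inj_onI)
      fix e e' assume e: "e \<in> S r" and e': "e' \<in> S r"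
        and "(snd (p e), column C (fst (p e))) = (snd (p e'), column C (fst (p e')))"
      then have eq: "snd (p e) = snd (p e')" "\<forall>f\<in>C. f (fst (p e)) = f (fst (p e'))"
        by (auto simp: column_eq_iff)
      have "f e = f e'" if "f \<in> C" for f
        using p[OF e] p[OF e'] eq that by (metis add_left_cancel mult_left_cancel)
      then have "column C e = column C e'" by (simp add: column_eq_iff)
      then show "e = e'" using inj e e' by (auto simp: inj_on_def S_def labels_def)
    qed
    then have "card (S r) \<le> card ((UNIV :: 'k set) \<times> cl r)"
      using pcls fcls by (intro card_inj_on_le[of "\<lambda>e. (snd (p e), column C (fst (p e)))"]) (auto simp: cl_def)
    then show ?thesis by (simp add: card_cartesian_product)
  qed
  \<comment> \<open>For the remaining representatives, loops make up less than half of
    \<open>\<alpha>\<close>, so \<open>T r\<close> has at least half of it. The big ones are few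
    because their classes are disjoint.\<close>
  define Big where "Big = {r \<in> R. \<alpha> \<le> 2 * ?q * card (cl r)}"
  define Small where "Small = R - Big"
  have "\<alpha> * card Big = (\<Sum>r\<in>Big. \<alpha>)" by simp
  also have "\<dots> \<le> (\<Sum>r\<in>Big. 2 * ?q * card (cl r))" by (rule sum_mono) (simp add: Big_def)
  also have "\<dots> = 2 * ?q * (\<Sum>r\<in>Big. card (cl r))" by (simp add: sum_distrib_left)
  also have "\<dots> \<le> 2 * ?q * card (column C ` K)"
    by (intro mult_left_mono sum_cl) (auto simp: Big_def)
  finally have big: "\<alpha> * card Big \<le> 2 * ?q * card (column C ` K)" .
  have small_T: "\<alpha> \<le> 2 * card (T r)" if r: "r \<in> Small" for r
  proof -
    have rR: "r \<in> R" and lt: "2 * (?q * card (cl r)) < \<alpha>" using r by (auto simp: Small_def Big_def)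
    have "\<alpha> \<le> card (labels C D K r)" by (rule deg) (use rR R(1) in blast)
    then have "\<alpha> \<le> card (T r) + card (S r)" using lab_split[of r] by linarith
    then show ?thesis using card_S[OF rR] lt by linarith
  qed
  \<comment> \<open>Contracting \<open>e\<close> merges the class of each \<open>r\<close> with
    \<open>e \<in> T r\<close> with another one, so the number of classes drops by at least half the
    number of such \<open>r\<close>; minimality allows a drop of at most \<open>s\<close>.\<close>
  have touched: "card {r \<in> R. e \<in> T r} \<le> 2 * s" if e: "e \<in> D" for e
  proof (cases "e \<in> L")
    case True
    then have "{r \<in> R. e \<in> T r} = {}" by (auto simp: T_def shorten_def)
    then show ?thesis by (metis card.empty le0)
  next
    case False
    let ?C' = "shorten (insert e L) C"
    have "w L \<le> w (insert e L)" by (rule Lmin) (use L e in auto)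
    then have le: "\<kappa> L \<le> \<kappa> (insert e L) + s" using False fL by (simp add: w_def)
    have "column ?C' ` K = column ?C' ` R"
    proof
      show "column ?C' ` K \<subseteq> column ?C' ` R"
      proof
        fix v assume "v \<in> column ?C' ` K"
        then obtain x where x: "x \<in> K" "v = column ?C' x" by blast
        then have "column ?C x \<in> column ?C ` R" using R(3) by blast
        then obtain r where r: "r \<in> R" "column ?C x = column ?C r" by blast
        then have "column ?C' x = column ?C' r" by (auto simp: column_eq_iff shorten_def)
        then show "v \<in> column ?C' ` R" using r x by blast
      qed
    qed (use R(1) in blast)
    then have k': "\<kappa> (insert e L) = card (column ?C' ` R)" by (simp add: \<kappa>_def)
    have "2 * card (column ?C' ` R) + card {r \<in> R. e \<in> T r} \<le> 2 * card R"
    proof (rule card_nontrivial_fibres[OF fR])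
      fix r assume "r \<in> {r \<in> R. e \<in> T r}"
      then have r: "r \<in> R" "e \<in> T r" by auto
      then obtain y c f0 where y: "y \<in> K" "c \<noteq> 0" "\<forall>f\<in>C. f y = f r + c * f e" and f0: "f0 \<in> ?C" "f0 e \<noteq> 0"
        by (auto simp: T_def labels_def)
      have "column ?C y \<in> column ?C ` R" using R(3) y(1) by blast
      then obtain r' where r': "r' \<in> R" "column ?C y = column ?C r'" by blast
      have "f0 \<in> C" using f0 by (simp add: shorten_def)
      then have "f0 y = f0 r + c * f0 e" using y(3) by blast
      then have "f0 y \<noteq> f0 r" using y(2) f0(2) by simp
      moreover have "f0 y = f0 r'" by (rule column_eqD[OF r'(2) f0(1)])
      ultimately have "r' \<noteq> r" by auto
      moreover have "column ?C' r' = column ?C' r"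
        unfolding column_eq_iff
      proof
        fix f assume "f \<in> ?C'"
        then have f: "f \<in> ?C" "f \<in> C" "f e = 0" by (auto simp: shorten_def)
        have "f r' = f y" by (rule column_eqD[OF r'(2) f(1), symmetric])
        also have "\<dots> = f r + c * f e" using y(3) f(2) by blast
        also have "\<dots> = f r" using f(3) by simp
        finally show "f r' = f r" .
      qed
      ultimately show "\<exists>a'\<in>R. a' \<noteq> r \<and> column ?C' a' = column ?C' r" using r'(1) by blast
    qed auto
    then show ?thesis using le k' cR by linarith
  qed
  have "\<alpha> * card Small = (\<Sum>r\<in>Small. \<alpha>)" by simp
  also have "\<dots> \<le> (\<Sum>r\<in>Small. 2 * card (T r))" by (rule sum_mono) (rule small_T)
  also have "\<dots> = 2 * (\<Sum>r\<in>Small. card (T r))" by (simp add: sum_distrib_left)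
  also have "(\<Sum>r\<in>Small. card (T r)) = (\<Sum>r\<in>Small. \<Sum>e\<in>D. if e \<in> T r then 1 else 0)"
    using D by (intro sum.cong refl) (simp add: sum.If_cases T_def labels_def Int_def conj_ac)
  also have "\<dots> = (\<Sum>e\<in>D. \<Sum>r\<in>Small. if e \<in> T r then 1 else 0)" by (rule sum.swap)
  also have "\<dots> = (\<Sum>e\<in>D. card {r \<in> Small. e \<in> T r})"
    using fR by (intro sum.cong refl) (simp add: sum.If_cases Small_def Int_def)
  also have "\<dots> \<le> (\<Sum>e\<in>D. 2 * s)"
  proof (rule sum_mono)
    fix e assume e: "e \<in> D"
    have "card {r \<in> Small. e \<in> T r} \<le> card {r \<in> R. e \<in> T r}"
      using fR by (intro card_mono) (auto simp: Small_def)
    then show "card {r \<in> Small. e \<in> T r} \<le> 2 * s" using touched[OF e] by linarith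
  qed
  finally have small: "\<alpha> * card Small \<le> 4 * s * card D" by (simp add: ac_simps)
  have "Big \<subseteq> R" by (auto simp: Big_def)
  then have "card R = card Big + card Small"
    unfolding Small_def using fR card_Diff_subset card_mono finite_subset by (metis le_add_diff_inverse)
  then have "\<alpha> * card R \<le> 4 * s * card D + 2 * ?q * card (column C ` K)"
    using big small by (simp add: algebra_simps)
  with L R(1) sL show ?thesis
    by (intro exI[of _ L] exI[of _ R] conjI ballI[OF impI[OF det]])
qed

section \<open>Contraction-critical dense codes\<close>

text \<open>Take a smallest nonempty vertex set with at least \<open>p / m\<close> edges per vertex.
  Deleting one vertex must destroy that many edges, which gives the minimum degree; if it fell into
  two parts without edges between them, one part would be dense enough by itself, which gives
  connectedness. Edges are indexed by \<open>W\<close>, so parallel edges are counted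
  separately.\<close>

lemma dense_core:
  fixes a b :: "'w \<Rightarrow> 'v"
  assumes V: "finite V" "V \<noteq> {}" and W: "finite W"
    and p: "0 < p" and dense: "p * card V \<le> m * card {w \<in> W. a w \<in> V \<and> b w \<in> V}"
  shows "\<exists>K\<subseteq>V. K \<noteq> {} \<and> p * card K \<le> m * card {w \<in> W. a w \<in> K \<and> b w \<in> K} \<and>
    (\<forall>x\<in>K. p \<le> m * card {w \<in> W. a w \<in> K \<and> b w \<in> K \<and> (a w = x \<or> b w = x)}) \<and>
    (\<forall>A\<subseteq>K. A \<noteq> {} \<longrightarrow> (\<forall>w\<in>W. a w \<in> K \<longrightarrow> b w \<in> K \<longrightarrow> (a w \<in> A \<longleftrightarrow> b w \<in> A)) \<longrightarrow> A = K)"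
proof -
  define I where "I K = {w \<in> W. a w \<in> K \<and> b w \<in> K}" for K
  have fI: "finite (I K)" for K using W by (simp add: I_def)
  define P where "P K \<longleftrightarrow> K \<subseteq> V \<and> K \<noteq> {} \<and> p * card K \<le> m * card (I K)" for K
  have "P V" using V dense by (simp add: P_def I_def)
  then obtain K where PK: "P K" and Kmin: "\<And>K'. P K' \<Longrightarrow> card K \<le> card K'"
    using ex_has_least_nat[of P V card] by blast
  have K: "K \<subseteq> V" "K \<noteq> {}" "p * card K \<le> m * card (I K)" using PK by (auto simp: P_def)
  have fK: "finite K" using K(1) V(1) finite_subset by blast
  have small: "m * card (I K') < p * card K'" if "K' \<subset> K" "K' \<noteq> {}" for K'
  proof (rule ccontr)
    assume "\<not> ?thesis"
    then have "P K'" using that K(1) by (auto simp: P_def)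
    then have "card K \<le> card K'" by (rule Kmin)
    then show False using psubset_card_mono[OF fK that(1)] by simp
  qed
  have deg: "p \<le> m * card {w \<in> W. a w \<in> K \<and> b w \<in> K \<and> (a w = x \<or> b w = x)}" if x: "x \<in> K" for x
  proof -
    let ?J = "{w \<in> W. a w \<in> K \<and> b w \<in> K \<and> (a w = x \<or> b w = x)}"
    have eq: "I K = I (K - {x}) \<union> ?J" by (auto simp: I_def)
    have "card (I K) \<le> card (I (K - {x})) + card ?J" by (subst eq) (rule card_Un_le)
    then have "m * card (I K) \<le> m * (card (I (K - {x})) + card ?J)" by (rule mult_le_mono2)
    then have 1: "m * card (I K) \<le> m * card (I (K - {x})) + m * card ?J"
      by (simp only: add_mult_distrib2)
    have "card K = Suc (card (K - {x}))" using x fK by (metis card_Suc_Diff1)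
    then have 2: "p * card K = p + p * card (K - {x})" by simp
    have "m * card (I (K - {x})) \<le> p * card (K - {x})"
    proof (cases "K - {x} = {}")
      case True
      then have "I (K - {x}) = {}" by (auto simp: I_def)
      then show ?thesis by (metis card.empty mult_0_right le0)
    next
      case False
      moreover have "K - {x} \<subset> K" using x by blast
      ultimately show ?thesis using small less_imp_le by blast
    qed
    then show ?thesis using 1 2 K(3) by linarith
  qed
  have conn: "A = K" if A: "A \<subseteq> K" "A \<noteq> {}"
    "\<forall>w\<in>W. a w \<in> K \<longrightarrow> b w \<in> K \<longrightarrow> (a w \<in> A \<longleftrightarrow> b w \<in> A)" for A
  proof (rule ccontr)
    assume "A \<noteq> K"
    then have A': "A \<subset> K" "K - A \<subset> K" "K - A \<noteq> {}" using A by auto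
    have eq: "I K = I A \<union> I (K - A)" using A(1,3) by (auto simp: I_def)
    have "card (I K) \<le> card (I A) + card (I (K - A))" by (subst eq) (rule card_Un_le)
    then have "m * card (I K) \<le> m * (card (I A) + card (I (K - A)))" by (rule mult_le_mono2)
    then have "m * card (I K) \<le> m * card (I A) + m * card (I (K - A))"
      by (simp only: add_mult_distrib2)
    moreover have "m * card (I A) < p * card A" by (rule small[OF A'(1) A(2)])
    moreover have "m * card (I (K - A)) < p * card (K - A)" by (rule small[OF A'(2,3)])
    moreover have "card K = card A + card (K - A)"
      using A(1) fK by (metis card_Diff_subset card_mono finite_subset le_add_diff_inverse)
    then have "p * card K = p * card A + p * card (K - A)" by (simp add: algebra_simps)
    ultimately show False using K(3) by linarith
  qed
  show ?thesis
  proof (intro exI[of _ K] conjI)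
    show "\<forall>x\<in>K. p \<le> m * card {w \<in> W. a w \<in> K \<and> b w \<in> K \<and> (a w = x \<or> b w = x)}"
      using deg by blast
    show "\<forall>A\<subseteq>K. A \<noteq> {} \<longrightarrow> (\<forall>w\<in>W. a w \<in> K \<longrightarrow> b w \<in> K \<longrightarrow> (a w \<in> A \<longleftrightarrow> b w \<in> A)) \<longrightarrow> A = K"
      using conn by blast
  qed (use K in \<open>simp_all add: I_def\<close>)
qed

text \<open>Edges with the same label are disjoint, so the minimum degree of a dense core counts
  distinct labels. Labels are multiples of differences of elements of \<open>K\<close>, hence
  spanned by it, and connectedness makes a word that vanishes on all labels constant on
  \<open>K\<close>.\<close>

lemma labelled_core:
  fixes C :: "('a \<Rightarrow> 'k::field) set" and al bl lab :: "'w \<Rightarrow> 'a"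
  assumes V: "finite V" "V \<noteq> {}" and W: "finite W" and p: "0 < p"
    and dense: "p * card V \<le> m * card {w \<in> W. al w \<in> V \<and> bl w \<in> V}"
    and step: "\<And>w. w \<in> W \<Longrightarrow> \<exists>c. c \<noteq> 0 \<and> (\<forall>g\<in>C. g (bl w) = g (al w) + c * g (lab w))"
    and matching: "\<And>w w'. w \<in> W \<Longrightarrow> w' \<in> W \<Longrightarrow> lab w = lab w' \<Longrightarrow>
      {al w, bl w} \<inter> {al w', bl w'} \<noteq> {} \<Longrightarrow> w = w'"
  shows "\<exists>K\<subseteq>V. \<exists>WK\<subseteq>W. K \<noteq> {} \<and> p * card K \<le> m * card WK \<and>
    (\<forall>x\<in>K. p \<le> m * card (labels C (lab ` WK) K x)) \<and>
    (\<forall>g\<in>C. (\<forall>x\<in>K. g x = 0) \<longrightarrow> (\<forall>e\<in>lab ` WK. g e = 0)) \<and>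
    (\<forall>g\<in>C. (\<forall>e\<in>lab ` WK. g e = 0) \<longrightarrow> (\<forall>x\<in>K. \<forall>y\<in>K. g x = g y))"
proof -
  obtain K where K: "K \<subseteq> V" "K \<noteq> {}"
    and Kd: "p * card K \<le> m * card {w \<in> W. al w \<in> K \<and> bl w \<in> K}"
    and Kdeg: "\<forall>x\<in>K. p \<le> m * card {w \<in> W. al w \<in> K \<and> bl w \<in> K \<and> (al w = x \<or> bl w = x)}"
    and Kconn: "\<forall>A\<subseteq>K. A \<noteq> {} \<longrightarrow> (\<forall>w\<in>W. al w \<in> K \<longrightarrow> bl w \<in> K \<longrightarrow> (al w \<in> A \<longleftrightarrow> bl w \<in> A)) \<longrightarrow> A = K"
    using dense_core[where a = al and b = bl, OF V W p dense] by (elim exE conjE) (rule that)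
  define WK where "WK = {w \<in> W. al w \<in> K \<and> bl w \<in> K}"
  let ?D = "lab ` WK"
  have fD: "finite ?D" using W by (simp add: WK_def)
  have WKD: "w \<in> W" "al w \<in> K" "bl w \<in> K" if "w \<in> WK" for w using that by (auto simp: WK_def)
  have diff: "\<exists>c. c \<noteq> 0 \<and> g (bl w) = g (al w) + c * g (lab w)" if "w \<in> WK" "g \<in> C" for g w
    using step[OF WKD(1)[OF that(1)]] that(2) by blast
  have span: "g e = 0" if g: "g \<in> C" "\<forall>x\<in>K. g x = 0" and e: "e \<in> ?D" for g e
  proof -
    obtain w where w: "w \<in> WK" "e = lab w" using e by blast
    then show ?thesis using diff[OF w(1) g(1)] g(2) WKD[OF w(1)] by auto
  qed
  have const: "g x = g y" if g: "g \<in> C" "\<forall>e\<in>?D. g e = 0" and x: "x \<in> K" and y: "y \<in> K" for g x y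
  proof -
    have "{z \<in> K. g z = g x} = K"
    proof (rule Kconn[THEN spec, THEN mp, THEN mp, THEN mp])
      show "\<forall>w\<in>W. al w \<in> K \<longrightarrow> bl w \<in> K \<longrightarrow> (al w \<in> {z \<in> K. g z = g x} \<longleftrightarrow> bl w \<in> {z \<in> K. g z = g x})"
      proof (intro ballI impI)
        fix w assume "w \<in> W" and K2: "al w \<in> K" "bl w \<in> K"
        then have w: "w \<in> WK" by (simp add: WK_def)
        then have "g (bl w) = g (al w)" using diff[OF w g(1)] g(2) by auto
        then show "al w \<in> {z \<in> K. g z = g x} \<longleftrightarrow> bl w \<in> {z \<in> K. g z = g x}" using K2 by simp
      qed
    qed (use x in auto)
    then have "y \<in> {z \<in> K. g z = g x}" using y by simp
    then show ?thesis by simp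
  qed
  have deg: "p \<le> m * card (labels C ?D K x)" if x: "x \<in> K" for x
  proof -
    let ?J = "{w \<in> W. al w \<in> K \<and> bl w \<in> K \<and> (al w = x \<or> bl w = x)}"
    have "inj_on lab ?J" by (rule inj_onI, rule matching) auto
    moreover have "lab ` ?J \<subseteq> labels C ?D K x"
    proof
      fix e assume "e \<in> lab ` ?J"
      then obtain w where w: "w \<in> ?J" "e = lab w" by blast
      then have wK: "w \<in> WK" by (simp add: WK_def)
      then obtain c where c: "c \<noteq> 0" "\<forall>g\<in>C. g (bl w) = g (al w) + c * g e"
        using step[OF WKD(1)] w(2) by blast
      have eD: "e \<in> ?D" using wK w(2) by simp
      show "e \<in> labels C ?D K x"
      proof (cases "al w = x")
        case True
        then show ?thesis using c eD w(1) unfolding labels_def by blast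
      next
        case False
        then have "bl w = x" using w(1) by blast
        have "\<forall>g\<in>C. g (al w) = g x + (- c) * g e"
        proof
          fix g assume "g \<in> C"
          then have "g (bl w) = g (al w) + c * g e" using c(2) by blast
          then show "g (al w) = g x + (- c) * g e" using \<open>bl w = x\<close> by simp
        qed
        moreover have "- c \<noteq> 0" "al w \<in> K" using c(1) w(1) by auto
        ultimately show ?thesis using eD unfolding labels_def by blast
      qed
    qed
    moreover have "finite (labels C ?D K x)" using fD by (simp add: labels_def)
    ultimately have "card ?J \<le> card (labels C ?D K x)" by (rule card_inj_on_le)
    then show ?thesis using bspec[OF Kdeg x] by (meson mult_le_mono2 order_trans)
  qed
  show ?thesis
  proof (intro exI[of _ K] exI[of _ WK] conjI ballI impI)
    show "p * card K \<le> m * card WK" using Kd by (simp add: WK_def)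
    show "WK \<subseteq> W" by (auto simp: WK_def)
  qed (fact K deg span const)+
qed

section \<open>Points lost by contracting one element\<close>

lemma column_classes_small:
  fixes C :: "('a \<Rightarrow> 'k::{field,finite}) set"
  assumes C: "linear_code E C" and S: "inj_on (column C) S" and e: "g \<in> C" "g e \<noteq> 0"
  shows "card {x \<in> S. column (shorten {e} C) x = v} \<le> CARD('k)"
proof (cases "{x \<in> S. column (shorten {e} C) x = v} = {}")
  case True
  then show ?thesis by (metis card.empty le0)
next
  case False
  then obtain x where x: "x \<in> S" "column (shorten {e} C) x = v" by blast
  have "\<exists>c. \<forall>f\<in>C. f y = f x + c * f e" if "y \<in> {x \<in> S. column (shorten {e} C) x = v}" for y
    by (rule column_shorten_one_eq[OF C e]) (use that x in auto)
  then obtain c where c: "\<And>y. y \<in> {x \<in> S. column (shorten {e} C) x = v} \<Longrightarrow> \<forall>f\<in>C. f y = f x + c y * f e"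
    by metis
  have "inj_on c {x \<in> S. column (shorten {e} C) x = v}"
  proof (rule inj_onI)
    fix y z assume y: "y \<in> {x \<in> S. column (shorten {e} C) x = v}"
      and z: "z \<in> {x \<in> S. column (shorten {e} C) x = v}" and "c y = c z"
    then have "column C y = column C z" using c[OF y] c[OF z] by (simp add: column_eq_iff)
    then show "y = z" using S y z by (simp add: inj_on_eq_iff)
  qed
  then show ?thesis by (rule card_inj_on_le) simp_all
qed

text \<open>Classes of columns that merge when \<open>e\<close> is contracted come in the form \<open>x, x + c e\<close>; one pair
  is taken from each nontrivial class outside the span of \<open>e\<close>.\<close>

lemma contraction_matching:
  fixes C :: "('a \<Rightarrow> 'k::{field,finite}) set"
  assumes C: "linear_code E C" and S: "S \<subseteq> E" "inj_on (column C) S"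
      "column C ` S = column C ` E - {\<lambda>_. 0}"
    and e: "e \<in> S"
    and crit: "points E (shorten {e} C) + CARD('k) * (\<mu> + 1) \<le> points E C"
  shows "\<exists>V a b. finite V \<and> card V = \<mu> \<and> (\<forall>v\<in>V. a v \<in> S \<and> b v \<in> S \<and> a v \<noteq> b v \<and>
    column (shorten {e} C) (a v) = v \<and> column (shorten {e} C) (b v) = v \<and> v \<noteq> (\<lambda>_. 0))"
proof -
  let ?q = "CARD('k)"
  let ?c = "column (shorten {e} C)"
  have fS: "finite S" using S(1) linear_code_finite_ground[OF C] finite_subset by blast
  have nS: "card S = points E C" unfolding points_def S(3)[symmetric] by (simp add: card_image S(2))
  have "column C e \<noteq> (\<lambda>_. 0)" using S(3) e by blast
  then obtain g where g: "g \<in> C" "g e \<noteq> 0" by (auto simp: column_zero_iff)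
  define V where "V = ?c ` S - {\<lambda>_. 0}"
  have fV: "finite V" using fS by (simp add: V_def)
  have "?c ` E - {\<lambda>_. 0} = V"
  proof
    show "?c ` E - {\<lambda>_. 0} \<subseteq> V"
    proof
      fix v assume "v \<in> ?c ` E - {\<lambda>_. 0}"
      then obtain x where x: "x \<in> E" "v = ?c x" "?c x \<noteq> (\<lambda>_. 0)" by blast
      then have "column C x \<noteq> (\<lambda>_. 0)" by (auto simp: column_zero_iff shorten_def)
      then have "column C x \<in> column C ` S" using x S(3) by blast
      then obtain y where "y \<in> S" "column C x = column C y" by blast
      then have "?c x = ?c y" "y \<in> S" by (auto simp: column_eq_iff shorten_def)
      then show "v \<in> V" using x by (auto simp: V_def)
    qed
  qed (use S(1) in \<open>auto simp: V_def\<close>)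
  then have pV: "points E (shorten {e} C) = card V" by (simp add: points_def)
  let ?Q = "\<lambda>v. {x \<in> S. ?c x = v}"
  have Qq: "card (?Q v) \<le> ?q" for v by (rule column_classes_small[OF C S(2) g])
  define V2 where "V2 = {v \<in> V. 2 \<le> card (?Q v)}"
  have "V \<inter> V2 = V2" by (auto simp: V2_def)
  \<comment> \<open>Count by classes: at most \<open>q\<close> columns lie in the span of
    \<open>e\<close>, and every other class contributes 1, or up to \<open>q\<close> if it is
    nontrivial. The summand 1 in \<open>\<mu> + 1\<close> pays for the columns in the span of
    \<open>e\<close>.\<close>
  have "card S = (\<Sum>v\<in>?c ` S. card (?Q v))"
    using sum.image_gen[OF fS, of "\<lambda>_. 1::nat" ?c] by simp
  also have "\<dots> \<le> (\<Sum>v\<in>insert (\<lambda>_. 0) V. card (?Q v))"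
    using fV by (intro sum_mono2) (auto simp: V_def)
  also have "\<dots> = card (?Q (\<lambda>_. 0)) + (\<Sum>v\<in>V. card (?Q v))"
    using fV by (subst sum.insert) (auto simp: V_def)
  finally have 1: "card S \<le> card (?Q (\<lambda>_. 0)) + (\<Sum>v\<in>V. card (?Q v))" .
  have "(\<Sum>v\<in>V. card (?Q v)) \<le> (\<Sum>v\<in>V. 1 + (if v \<in> V2 then ?q else 0))"
  proof (rule sum_mono)
    fix v assume "v \<in> V"
    then show "card (?Q v) \<le> 1 + (if v \<in> V2 then ?q else 0)"
      using Qq[of v] by (auto simp: V2_def)
  qed
  also have "\<dots> = card V + (\<Sum>v\<in>V. if v \<in> V2 then ?q else 0)"
    by (simp only: sum.distrib card_eq_sum)
  also have "(\<Sum>v\<in>V. if v \<in> V2 then ?q else 0) = (\<Sum>v\<in>V2. ?q)"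
    using sum.inter_restrict[OF fV, of "\<lambda>_. ?q" V2] \<open>V \<inter> V2 = V2\<close> by simp
  finally have "(\<Sum>v\<in>V. card (?Q v)) \<le> card V + ?q * card V2" by (simp add: mult.commute)
  then have "card S \<le> ?q + (card V + ?q * card V2)" using 1 Qq[of "\<lambda>_. 0"] by linarith
  then have "?q * \<mu> \<le> ?q * card V2" using crit pV nS unfolding add_mult_distrib2 by linarith
  then have "\<mu> \<le> card V2" using two_le_card_field[where 'k='k] by simp
  then obtain V3 where V3: "V3 \<subseteq> V2" "card V3 = \<mu>" "finite V3"
    using obtain_subset_with_card_n by blast
  have "\<exists>x y. x \<in> S \<and> y \<in> S \<and> x \<noteq> y \<and> ?c x = v \<and> ?c y = v" if "v \<in> V3" for v
  proof -
    have "2 \<le> card (?Q v)" using that V3(1) by (auto simp: V2_def)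
    then obtain T where "T \<subseteq> ?Q v" "card T = 2"
      by (elim obtain_subset_with_card_n) (rule that)
    then obtain x y where "T = {x, y}" "x \<noteq> y" using card_2_iff by metis
    moreover from this have "x \<in> ?Q v" "y \<in> ?Q v" using \<open>T \<subseteq> ?Q v\<close> by blast+
    ultimately show ?thesis by (intro exI[of _ x] exI[of _ y]) blast
  qed
  then obtain a b where "\<And>v. v \<in> V3 \<Longrightarrow> a v \<in> S \<and> b v \<in> S \<and> a v \<noteq> b v \<and> ?c (a v) = v \<and> ?c (b v) = v"
    by metis
  moreover have "v \<noteq> (\<lambda>_. 0)" if "v \<in> V3" for v using that V3(1) by (auto simp: V2_def V_def)
  ultimately show ?thesis using V3(2,3) by (intro exI[of _ V3] exI[of _ a] exI[of _ b]) simp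
qed

text \<open>Words vanishing at \<open>e\<close> are a fraction \<open>1 / q\<close> of the code. The
  word \<open>h\<close> shows that they do not all vanish at \<open>x\<close>, so at least half of
  them are nonzero there.\<close>

lemma card_zero_nonzero:
  fixes C :: "('a \<Rightarrow> 'k::{field,finite}) set"
  assumes C: "linear_code E C" and e: "g \<in> C" "g e \<noteq> 0"
    and x: "h \<in> C" "h e = 0" "h x \<noteq> 0"
  shows "card C \<le> 2 * CARD('k) * card {f \<in> C. f e = 0 \<and> f x \<noteq> 0}"
proof -
  let ?C = "shorten {e} C"
  have C': "linear_code E ?C" by (rule linear_code_shorten[OF C])
  have fin: "finite ?C" by (rule linear_code_finite[OF C'])
  have h: "h \<in> ?C" using x by (simp add: shorten_def)
  have 1: "card C = CARD('k) * card ?C" by (rule card_shorten_one[where f = g, OF C e])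
  have "card ?C = CARD('k) * card (shorten {x} ?C)" by (rule card_shorten_one[where f = h, OF C' h x(3)])
  moreover have "2 * card (shorten {x} ?C) \<le> CARD('k) * card (shorten {x} ?C)"
    by (rule mult_le_mono1[OF two_le_card_field])
  ultimately have 2: "2 * card (shorten {x} ?C) \<le> card ?C" by linarith
  have "?C = shorten {x} ?C \<union> {f \<in> C. f e = 0 \<and> f x \<noteq> 0}" by (auto simp: shorten_def)
  then have "card ?C \<le> card (shorten {x} ?C) + card {f \<in> C. f e = 0 \<and> f x \<noteq> 0}"
    using card_Un_le[of "shorten {x} ?C" "{f \<in> C. f e = 0 \<and> f x \<noteq> 0}"] by simp
  then have "card ?C \<le> 2 * card {f \<in> C. f e = 0 \<and> f x \<noteq> 0}" using 2 by linarith
  then have "CARD('k) * card ?C \<le> CARD('k) * (2 * card {f \<in> C. f e = 0 \<and> f x \<noteq> 0})"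
    by (rule mult_le_mono2)
  then show ?thesis using 1 by (simp add: mult.assoc mult.left_commute)
qed

lemma exists_ge_average:
  fixes I :: "'b \<Rightarrow> nat"
  assumes "finite A" "A \<noteq> {}" "card A * m \<le> (\<Sum>a\<in>A. I a)"
  shows "\<exists>a\<in>A. m \<le> I a"
proof (rule ccontr)
  assume "\<not> ?thesis"
  then have "\<And>a. a \<in> A \<Longrightarrow> I a < m" by (simp add: not_le)
  then have "(\<Sum>a\<in>A. I a) < (\<Sum>a\<in>A. m)" by (rule sum_strict_mono[OF assms(1,2)])
  then show False using assms by simp
qed

text \<open>The set \<open>X\<close> spans \<open>D\<close> and has at most
  \<open>10 * q\<^sup>2 / s\<close> times its size, where \<open>s\<close> is at the disposal of the
  caller: \<open>D\<close> can be made as dense as desired. The price is the number of points that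
  every contraction has to lose.\<close>

lemma dense_step:
  fixes C :: "('a \<Rightarrow> 'k::{field,finite}) set"
  assumes C: "linear_code E C" and s: "0 < s" and pos: "0 < points E C"
    and crit: "\<forall>e\<in>E. (\<exists>g\<in>C. g e \<noteq> 0) \<longrightarrow>
      points E (shorten {e} C) + CARD('k) * (2 * CARD('k) * s\<^sup>2 + 1) \<le> points E C"
  shows "\<exists>f K D X. f \<in> C \<and> K \<subseteq> E \<and> K \<noteq> {} \<and> (\<forall>x\<in>K. f x \<noteq> 0) \<and>
    D \<subseteq> E \<and> D \<noteq> {} \<and> inj_on (column C) D \<and> (\<forall>e\<in>D. \<exists>g\<in>C. g e \<noteq> 0) \<and> (\<forall>e\<in>D. f e = 0) \<and>
    (\<forall>g\<in>C. (\<forall>x\<in>K. g x = 0) \<longrightarrow> (\<forall>e\<in>D. g e = 0)) \<and>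
    (\<forall>g\<in>C. (\<forall>e\<in>D. g e = 0) \<longrightarrow> (\<forall>x\<in>K. \<forall>y\<in>K. g x = g y)) \<and>
    finite X \<and> (\<forall>g\<in>C. (\<forall>x\<in>X. g x = 0) \<longrightarrow> (\<forall>e\<in>D. g e = 0)) \<and>
    s * card X \<le> 10 * (CARD('k))\<^sup>2 * card D"
proof -
  let ?q = "CARD('k)"
  \<comment> \<open>Some word retains at least a fraction \<open>1 / (2 * q)\<close> of the edges,
    so about \<open>s\<^sup>2\<close> edges per vertex remain and each vertex of the core sees
    \<open>s\<^sup>2\<close> labels. The rank bound with weight \<open>s\<close> then makes both
    \<open>L\<close> and \<open>R\<close> of order \<open>card D / s\<close>.\<close>
  define \<mu> where "\<mu> = 2 * ?q * s\<^sup>2"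
  have q2: "2 \<le> ?q" by (rule two_le_card_field)
  have \<mu>0: "0 < \<mu>" using s q2 by (simp add: \<mu>_def)
  have fE: "finite E" by (rule linear_code_finite_ground[OF C])
  obtain S where S: "S \<subseteq> E" "inj_on (column C) S" "column C ` S = column C ` E - {\<lambda>_. 0}"
    using subset_image_inj[of "column C ` E - {\<lambda>_. 0}" "column C" E] by auto
  have fS: "finite S" using S(1) fE finite_subset by blast
  have nS: "card S = points E C" unfolding points_def S(3)[symmetric] by (simp add: card_image S(2))
  have nz: "\<exists>g\<in>C. g e \<noteq> 0" if "e \<in> S" for e
  proof -
    have "column C e \<noteq> (\<lambda>_. 0)" using S(3) that by blast
    then show ?thesis by (auto simp: column_zero_iff)
  qed
  have "\<exists>V a b. finite V \<and> card V = \<mu> \<and> (\<forall>v\<in>V. a v \<in> S \<and> b v \<in> S \<and> a v \<noteq> b v \<and>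
    column (shorten {e} C) (a v) = v \<and> column (shorten {e} C) (b v) = v \<and> v \<noteq> (\<lambda>_. 0))" if e: "e \<in> S" for e
    by (rule contraction_matching[OF C S e]) (use bspec[OF crit, of e] nz[OF e] e S(1) in \<open>auto simp: \<mu>_def\<close>)
  then obtain V a b where V: "\<And>e. e \<in> S \<Longrightarrow> finite (V e)" "\<And>e. e \<in> S \<Longrightarrow> card (V e) = \<mu>"
    and ab: "\<And>e v. e \<in> S \<Longrightarrow> v \<in> V e \<Longrightarrow> a e v \<in> S \<and> b e v \<in> S \<and> a e v \<noteq> b e v \<and>
      column (shorten {e} C) (a e v) = v \<and> column (shorten {e} C) (b e v) = v \<and> v \<noteq> (\<lambda>_. 0)"
    by metis
  define Ed where "Ed = (SIGMA e:S. V e)"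
  have fEd: "finite Ed" using fS V(1) by (auto simp: Ed_def)
  have cEd: "card Ed = card S * \<mu>" using fS V by (simp add: Ed_def card_SigmaI)
  define al where "al = (\<lambda>(e, v). a e v)"
  define bl where "bl = (\<lambda>(e, v). b e v)"
  have step: "\<exists>c. c \<noteq> 0 \<and> (\<forall>g\<in>C. g (bl w) = g (al w) + c * g (fst w))" if w: "w \<in> Ed" for w
  proof -
    obtain e v where ev: "w = (e, v)" "e \<in> S" "v \<in> V e" using w by (auto simp: Ed_def)
    obtain g where g: "g \<in> C" "g e \<noteq> 0" using nz[OF ev(2)] by blast
    note abv = ab[OF ev(2,3)]
    obtain c where c: "\<forall>g\<in>C. g (b e v) = g (a e v) + c * g e"
      using column_shorten_one_eq[OF C g, of "a e v" "b e v"] abv by auto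
    have "c \<noteq> 0"
    proof
      assume "c = 0"
      then have "column C (b e v) = column C (a e v)" using c by (simp add: column_eq_iff)
      then show False using S(2) abv by (auto simp: inj_on_def)
    qed
    then show ?thesis using c by (auto simp: ev(1) al_def bl_def)
  qed
  define I where "I f = {w \<in> Ed. f (fst w) = 0 \<and> f (al w) \<noteq> 0}" for f :: "'a \<Rightarrow> 'k"
  have fC: "finite C" by (rule linear_code_finite[OF C])
  have each: "card C \<le> 2 * ?q * card {f \<in> C. f (fst w) = 0 \<and> f (al w) \<noteq> 0}" if w: "w \<in> Ed" for w
  proof -
    obtain e v where ev: "w = (e, v)" "e \<in> S" "v \<in> V e" using w by (auto simp: Ed_def)
    obtain g where g: "g \<in> C" "g e \<noteq> 0" using nz[OF ev(2)] by blast
    have "column (shorten {e} C) (a e v) \<noteq> (\<lambda>_. 0)" using ab[OF ev(2,3)] by simp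
    then obtain h where "h \<in> C" "h e = 0" "h (a e v) \<noteq> 0" by (auto simp: column_zero_iff shorten_def)
    from card_zero_nonzero[OF C g this] show ?thesis by (simp add: ev(1) al_def)
  qed
  have "card C * (card S * \<mu>) = (\<Sum>w\<in>Ed. card C)" using cEd by simp
  also have "\<dots> \<le> (\<Sum>w\<in>Ed. 2 * ?q * card {f \<in> C. f (fst w) = 0 \<and> f (al w) \<noteq> 0})"
    by (rule sum_mono) (rule each)
  also have "\<dots> = 2 * ?q * (\<Sum>w\<in>Ed. card {f \<in> C. f (fst w) = 0 \<and> f (al w) \<noteq> 0})"
    by (simp only: sum_distrib_left)
  also have "(\<Sum>w\<in>Ed. card {f \<in> C. f (fst w) = 0 \<and> f (al w) \<noteq> 0}) = (\<Sum>f\<in>C. card (I f))"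
    unfolding I_def by (rule sum_multicount_gen[symmetric]) (use fC fEd in auto)
  also have "2 * ?q * (\<Sum>f\<in>C. card (I f)) = (\<Sum>f\<in>C. 2 * ?q * card (I f))"
    by (simp only: sum_distrib_left)
  finally have avg: "card C * (card S * \<mu>) \<le> (\<Sum>f\<in>C. 2 * ?q * card (I f))" .
  have "\<exists>f\<in>C. card S * \<mu> \<le> 2 * ?q * card (I f)"
    by (rule exists_ge_average[OF fC _ avg]) (use linear_code_zero[OF C] in blast)
  then obtain f where f: "f \<in> C" "card S * \<mu> \<le> 2 * ?q * card (I f)" by blast
  define U where "U = {x \<in> S. f x \<noteq> 0}"
  define W where "W = {w \<in> Ed. f (fst w) = 0}"
  \<comment> \<open>Where \<open>f\<close> vanishes on the label it agrees at both ends, so an edge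
    with one end off the hyperplane lies off it entirely.\<close>
  have IW: "I f = {w \<in> W. al w \<in> U \<and> bl w \<in> U}"
  proof
    show "I f \<subseteq> {w \<in> W. al w \<in> U \<and> bl w \<in> U}"
    proof
      fix w assume w: "w \<in> I f"
      then have wE: "w \<in> Ed" and fw: "f (fst w) = 0" "f (al w) \<noteq> 0" by (auto simp: I_def)
      obtain c where "\<forall>g\<in>C. g (bl w) = g (al w) + c * g (fst w)" using step[OF wE] by blast
      then have "f (bl w) = f (al w) + c * f (fst w)" using f(1) by blast
      then have "f (bl w) \<noteq> 0" using fw by simp
      moreover have "al w \<in> S" "bl w \<in> S" using wE ab by (auto simp: Ed_def al_def bl_def)
      ultimately show "w \<in> {w \<in> W. al w \<in> U \<and> bl w \<in> U}" using wE fw by (simp add: W_def U_def)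
    qed
  qed (auto simp: I_def W_def U_def)
  have fU: "finite U" "card U \<le> card S" using fS by (auto simp: U_def intro: card_mono)
  have "0 < card S * \<mu>" using pos nS \<mu>0 by simp
  then have "0 < 2 * ?q * card (I f)" using f(2) by linarith
  then have "0 < card (I f)" by (metis mult_0_right neq0_conv)
  then have "U \<noteq> {}" using IW by (auto simp: card_gt_0_iff)
  moreover have "\<mu> * card U \<le> 2 * ?q * card {w \<in> W. al w \<in> U \<and> bl w \<in> U}"
    using mult_le_mono2[OF fU(2), of \<mu>] f(2) unfolding IW[symmetric] by (simp only: mult.commute[of "card S"])
  moreover have fW: "finite W" using fEd by (simp add: W_def)
  \<comment> \<open>For a fixed label, both ends of an edge lie in the class that indexes it, so
    different edges are disjoint.\<close>
  moreover have "w = w'" if w: "w \<in> W" "w' \<in> W" "fst w = fst w'" and meet: "{al w, bl w} \<inter> {al w', bl w'} \<noteq> {}" for w w'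
  proof -
    have cls: "column (shorten {fst v} C) z = snd v" if "v \<in> W" "z \<in> {al v, bl v}" for v z
      using that ab by (auto simp: W_def Ed_def al_def bl_def)
    obtain z where z: "z \<in> {al w, bl w}" "z \<in> {al w', bl w'}" using meet by blast
    then show ?thesis using cls[OF w(1) z(1)] cls[OF w(2) z(2)] w(3) by (simp add: prod_eq_iff)
  qed
  moreover have "\<exists>c. c \<noteq> 0 \<and> (\<forall>g\<in>C. g (bl w) = g (al w) + c * g (fst w))" if "w \<in> W" for w
    by (rule step) (use that in \<open>simp add: W_def\<close>)
  ultimately have "\<exists>K\<subseteq>U. \<exists>WK\<subseteq>W. K \<noteq> {} \<and> \<mu> * card K \<le> 2 * ?q * card WK \<and>
    (\<forall>x\<in>K. \<mu> \<le> 2 * ?q * card (labels C (fst ` WK) K x)) \<and>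
    (\<forall>g\<in>C. (\<forall>x\<in>K. g x = 0) \<longrightarrow> (\<forall>e\<in>fst ` WK. g e = 0)) \<and>
    (\<forall>g\<in>C. (\<forall>e\<in>fst ` WK. g e = 0) \<longrightarrow> (\<forall>x\<in>K. \<forall>y\<in>K. g x = g y))"
    by (intro labelled_core[where al = al and bl = bl] fU(1) \<mu>0)
  then obtain K WK where K: "K \<subseteq> U" "K \<noteq> {}" and WKW: "WK \<subseteq> W"
    and Kd: "\<mu> * card K \<le> 2 * ?q * card WK"
    and Kdeg: "\<forall>x\<in>K. \<mu> \<le> 2 * ?q * card (labels C (fst ` WK) K x)"
    and span0: "\<forall>g\<in>C. (\<forall>x\<in>K. g x = 0) \<longrightarrow> (\<forall>e\<in>fst ` WK. g e = 0)"
    and const0: "\<forall>g\<in>C. (\<forall>e\<in>fst ` WK. g e = 0) \<longrightarrow> (\<forall>x\<in>K. \<forall>y\<in>K. g x = g y)"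
    by (elim exE conjE) (rule that)
  define D where "D = fst ` WK"
  note span = span0[folded D_def] and const = const0[folded D_def]
  have WKE: "WK \<subseteq> Ed" using WKW by (auto simp: W_def)
  have fWK: "finite WK" using WKW fW finite_subset by blast
  have fK: "finite K" using K(1) fU(1) finite_subset by blast
  have DS: "D \<subseteq> S" using WKE by (auto simp: D_def Ed_def)
  have fD: "finite D" using fWK by (simp add: D_def)
  have deg: "s\<^sup>2 \<le> card (labels C D K x)" if x: "x \<in> K" for x
  proof -
    have "?q * 2 * s\<^sup>2 \<le> ?q * 2 * card (labels C D K x)"
      using bspec[OF Kdeg x] by (simp only: \<mu>_def D_def mult.commute)
    then show ?thesis by (simp only: mult_le_cancel1) (use q2 in simp)
  qed
  have "inj_on (column C) D" using S(2) DS inj_on_subset by blast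
  from rank_bound[OF fK fD this deg, of s] obtain L R where LR: "L \<subseteq> D" "R \<subseteq> K"
    "\<forall>g\<in>C. (\<forall>z\<in>L \<union> R. g z = 0) \<longrightarrow> (\<forall>x\<in>K. g x = 0)"
    "s * card L \<le> card (column C ` K)"
    "s\<^sup>2 * card R \<le> 4 * s * card D + 2 * ?q * card (column C ` K)"
    by blast
  have cK: "card (column C ` K) \<le> card K" by (rule card_image_le[OF fK])
  \<comment> \<open>Each label carries at most \<open>\<mu>\<close> edges, so many edges mean many
    labels: \<open>K\<close> is at most \<open>2 * q\<close> times as large as
    \<open>D\<close>.\<close>
  have "WK \<subseteq> (SIGMA e:D. V e)" using WKE unfolding Ed_def D_def by force
  then have "card WK \<le> card (SIGMA e:D. V e)"
    using fD V(1) DS by (intro card_mono finite_SigmaI) auto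
  also have "\<dots> = card D * \<mu>"
    using fD V DS by (subst card_SigmaI) (auto simp: subset_iff)
  finally have "2 * ?q * card WK \<le> 2 * ?q * (card D * \<mu>)" by (rule mult_le_mono2)
  also have "\<dots> = \<mu> * (2 * ?q * card D)" by (simp only: ac_simps)
  finally have "\<mu> * card K \<le> \<mu> * (2 * ?q * card D)" using Kd by linarith
  then have KD: "card K \<le> 2 * ?q * card D" using \<mu>0 by simp
  have cKD: "card (column C ` K) \<le> 2 * ?q * card D" using cK KD by linarith
  have L: "s * card L \<le> 2 * ?q * card D" using LR(4) cKD by linarith
  have "2 * ?q * card (column C ` K) \<le> 2 * ?q * (2 * ?q * card D)" by (rule mult_le_mono2[OF cKD])
  also have "\<dots> = 4 * ?q\<^sup>2 * card D" by (simp add: power2_eq_square)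
  finally have "s\<^sup>2 * card R \<le> 4 * s * card D + 4 * ?q\<^sup>2 * card D" using LR(5) by linarith
  also have "\<dots> \<le> s * (4 * card D + 4 * ?q\<^sup>2 * card D)" using s by (cases s) (auto simp: algebra_simps)
  finally have "s * (s * card R) \<le> s * (4 * card D + 4 * ?q\<^sup>2 * card D)" by (simp add: power2_eq_square ac_simps)
  then have R: "s * card R \<le> 4 * card D + 4 * ?q\<^sup>2 * card D" using s by simp
  have "2 * ?q * card D \<le> ?q\<^sup>2 * card D" using q2 by (simp add: power2_eq_square)
  moreover have "2 * 2 * card D \<le> ?q\<^sup>2 * card D" using mult_le_mono[OF q2 q2] by (intro mult_le_mono1) (simp add: power2_eq_square)
  moreover have "s * card (L \<union> R) \<le> s * (card L + card R)" by (intro mult_le_mono2 card_Un_le)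
  ultimately have X: "s * card (L \<union> R) \<le> 10 * ?q\<^sup>2 * card D" using L R unfolding add_mult_distrib2 by linarith
  have "WK \<noteq> {}"
  proof
    assume "WK = {}"
    then have "\<mu> * card K = 0" using Kd by simp
    then show False using \<mu>0 K(2) fK by simp
  qed
  then have "D \<noteq> {}" by (simp add: D_def)
  moreover have "\<forall>e\<in>D. f e = 0" using WKW by (auto simp: D_def W_def)
  moreover have "\<forall>x\<in>K. f x \<noteq> 0" using K(1) by (auto simp: U_def)
  moreover have "K \<subseteq> E" "D \<subseteq> E" using K(1) S(1) DS by (auto simp: U_def)
  moreover have "finite (L \<union> R)" using LR(1,2) fD fK finite_subset by auto
  moreover have "\<forall>g\<in>C. (\<forall>x\<in>L \<union> R. g x = 0) \<longrightarrow> (\<forall>e\<in>D. g e = 0)" using LR(3) span by blast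
  moreover have "\<forall>e\<in>D. \<exists>g\<in>C. g e \<noteq> 0" using nz DS by blast
  ultimately show ?thesis using f(1) K(2) X span const \<open>inj_on (column C) D\<close>
    by (intro exI[of _ f] exI[of _ K] exI[of _ D] exI[of _ "L \<union> R"] conjI)
qed

section \<open>Apex structures\<close>

lemma card_image_le_card_image:
  assumes "finite A" and det: "\<And>x y. x \<in> A \<Longrightarrow> y \<in> A \<Longrightarrow> s x = s y \<Longrightarrow> f x = f y"
  shows "card (f ` A) \<le> card (s ` A)"
proof -
  have "f ` A \<subseteq> (\<lambda>w. f (SOME x. x \<in> A \<and> s x = w)) ` (s ` A)"
  proof
    fix v assume "v \<in> f ` A"
    then obtain x where x: "x \<in> A" "v = f x" by blast
    have "(SOME y. y \<in> A \<and> s y = s x) \<in> A \<and> s (SOME y. y \<in> A \<and> s y = s x) = s x"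
      by (rule someI[of _ x]) (use x in simp)
    then have "v = f (SOME y. y \<in> A \<and> s y = s x)" using det x by metis
    then show "v \<in> (\<lambda>w. f (SOME x. x \<in> A \<and> s x = w)) ` (s ` A)" using x(1) by blast
  qed
  then show ?thesis using assms(1) by (meson card_image_le card_mono finite_imageI order_trans)
qed

lemma card_puncture_le:
  fixes C :: "('a \<Rightarrow> 'k::{field,finite}) set"
  assumes C: "linear_code E C" and X: "finite X"
    and det: "\<forall>g\<in>C. (\<forall>x\<in>X. g x = 0) \<longrightarrow> (\<forall>e\<in>D. g e = 0)"
  shows "card (puncture D C) \<le> CARD('k) ^ card X"
proof -
  let ?p = "\<lambda>f x. if x \<in> D then f x else (0::'k)"
  have "puncture D C = ?p ` C" by (simp add: puncture_def)
  then have "card (puncture D C) = card (?p ` C)" by simp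
  also have "\<dots> \<le> card ((\<lambda>g. restrict g X) ` C)"
  proof (rule card_image_le_card_image[OF linear_code_finite[OF C]])
    fix f g assume f: "f \<in> C" and g: "g \<in> C" and eq: "restrict f X = restrict g X"
    have "f x = g x" if "x \<in> X" for x using fun_cong[OF eq, of x] that by simp
    then have "\<forall>x\<in>X. f x - g x = 0" by simp
    then have "\<forall>e\<in>D. f e - g e = 0" using bspec[OF det linear_code_diff[OF C f g]] by simp
    then show "?p f = ?p g" by (simp add: fun_eq_iff)
  qed
  also have "\<dots> \<le> card (X \<rightarrow>\<^sub>E (UNIV :: 'k set))"
    by (rule card_mono) (auto intro: finite_PiE X)
  also have "\<dots> = CARD('k) ^ card X" by (simp add: card_PiE X)
  finally show ?thesis .
qed

text \<open>A column is determined by its coordinates, the values of the words dual to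
  \<open>B\<close>.\<close>

lemma columns_le_power:
  fixes C :: "('a \<Rightarrow> 'k::{field,finite}) set"
  assumes C: "linear_code E C" and B: "finite B" "shattered C B"
    and det: "\<forall>g\<in>C. (\<forall>x\<in>B. g x = 0) \<longrightarrow> (\<forall>e\<in>E. g e = 0)"
  shows "points E C \<le> CARD('k) ^ card B"
proof -
  have "\<forall>b. \<exists>g\<in>C. \<forall>x\<in>B. g x = (if x = b then 1 else 0)" using shattered_dual[OF B(2)] by blast
  then obtain u where u: "\<And>b. u b \<in> C" "\<And>b x. x \<in> B \<Longrightarrow> u b x = (if x = b then 1 else 0)" by metis
  have expand: "f x = (\<Sum>b\<in>B. f b * u b x)" if f: "f \<in> C" and x: "x \<in> E" for f x
  proof -
    define g where "g = (\<lambda>x. f x - (\<Sum>b\<in>B. f b * u b x))"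
    have "g \<in> C" unfolding g_def by (intro linear_code_diff[OF C f] linear_code_sum[OF C B(1)] u(1))
    moreover have "g b = 0" if "b \<in> B" for b
      using that B(1) by (simp add: g_def u(2) if_distrib[of "(*) _"] cong: if_cong)
    ultimately have "g x = 0" using det x by blast
    then show ?thesis by (simp add: g_def)
  qed
  let ?s = "\<lambda>x. restrict (\<lambda>b. u b x) B"
  have "column C x = column C y" if "x \<in> E" "y \<in> E" "?s x = ?s y" for x y
  proof -
    have "u b x = u b y" if "b \<in> B" for b using fun_cong[OF \<open>?s x = ?s y\<close>, of b] that by simp
    note u_eq = this
    show ?thesis
      unfolding column_eq_iff
    proof
      fix f assume f: "f \<in> C"
      have "f x = (\<Sum>b\<in>B. f b * u b x)" by (rule expand[OF f that(1)])
      also have "\<dots> = (\<Sum>b\<in>B. f b * u b y)" by (rule sum.cong) (simp_all add: u_eq)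
      also have "\<dots> = f y" by (rule expand[OF f that(2), symmetric])
      finally show "f x = f y" .
    qed
  qed
  then have "card (column C ` E) \<le> card (?s ` E)"
    by (rule card_image_le_card_image[OF linear_code_finite_ground[OF C]])
  also have "\<dots> \<le> card (B \<rightarrow>\<^sub>E (UNIV :: 'k set))"
    by (rule card_mono) (auto intro: finite_PiE B)
  also have "\<dots> = CARD('k) ^ card B" by (simp add: card_PiE B)
  finally have "card (column C ` E) \<le> CARD('k) ^ card B" .
  moreover have "points E C \<le> card (column C ` E)"
    unfolding points_def using linear_code_finite_ground[OF C] by (intro card_mono) auto
  ultimately show ?thesis by linarith
qed

text \<open>The last clause makes \<open>P\<close> together with the apexes \<open>a i\<close> a
  basis, and the \<open>\<chi> i\<close> are the coordinate words of the apexes. An element of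
  \<open>K i\<close> is a vector in the span of \<open>P\<close> plus a combination of
  \<open>a 0, ..., a i\<close> in which \<open>a i\<close> occurs: coordinates at later apexes are
  zero, the one at its own apex is not. Each \<open>K i\<close> spans \<open>P\<close>.\<close>

definition apex_structure ::
    "('a \<Rightarrow> 'k::field) set \<Rightarrow> nat \<Rightarrow> nat \<Rightarrow> 'a set \<Rightarrow> (nat \<Rightarrow> 'a \<Rightarrow> 'k) \<Rightarrow> (nat \<Rightarrow> 'a) \<Rightarrow> (nat \<Rightarrow> 'a set) \<Rightarrow> bool" where
  "apex_structure C k R P \<chi> a K \<longleftrightarrow>
     finite P \<and> card P = R \<and> shattered C P \<and>
     (\<forall>i<k. \<chi> i \<in> C \<and> (\<forall>p\<in>P. \<chi> i p = 0) \<and> a i \<in> K i \<and>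
       (\<forall>j<k. \<chi> i (a j) = (if i = j then 1 else 0)) \<and>
       (\<forall>j<i. \<forall>x\<in>K j. \<chi> i x = 0) \<and> (\<forall>x\<in>K i. \<chi> i x \<noteq> 0) \<and>
       (\<forall>g\<in>C. (\<forall>x\<in>K i. g x = 0) \<longrightarrow> (\<forall>p\<in>P. g p = 0))) \<and>
     (\<forall>g\<in>C. (\<forall>p\<in>P. g p = 0) \<longrightarrow> (\<forall>i<k. g (a i) = 0) \<longrightarrow> g = (\<lambda>_. 0))"

text \<open>A code of rank at most \<open>R\<close> has at most \<open>q ^ R\<close> columns, so
  density forces an independent set of size \<open>R\<close>; a contraction makes it
  spanning.\<close>

lemma apex_structure_base:
  fixes C :: "('a \<Rightarrow> 'k::{field,finite}) set"
  assumes C: "linear_code E C" and r: "card C \<le> CARD('k) ^ r" and dense: "CARD('k) ^ R * r < points E C"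
  shows "\<exists>Z P \<chi> a K. apex_structure (shorten Z C) 0 R P \<chi> a K"
proof -
  obtain B where B: "B \<subseteq> E" "shattered C B" "\<forall>g\<in>C. (\<forall>x\<in>B. g x = 0) \<longrightarrow> (\<forall>y\<in>E. g y = 0)"
    using shattered_basis[OF C linear_code_finite_ground[OF C]] by blast
  have fB: "finite B" using B(1) linear_code_finite_ground[OF C] finite_subset by blast
  have le: "points E C \<le> CARD('k) ^ card B" by (rule columns_le_power[OF C fB B(2,3)])
  have "CARD('k) ^ card B \<le> CARD('k) ^ r" using power_le_card_shattered[OF C fB B(2)] r by linarith
  then have Br: "card B \<le> r" using two_le_card_field[where 'k='k] by (simp add: power_le_imp_le_exp)
  have "R \<le> card B"
  proof (cases "r = 0")
    case True
    then have "B = {}" using Br fB by simp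
    then have "\<forall>g\<in>C. \<forall>y\<in>E. g y = 0" using B(3) by simp
    then have "column C ` E - {\<lambda>_. 0} = {}" by (auto simp: column_zero_iff)
    then have "points E C = 0" by (simp only: points_def card.empty)
    then show ?thesis using dense by simp
  next
    case False
    then have "CARD('k) ^ R * 1 \<le> CARD('k) ^ R * r" by (intro mult_le_mono2) simp
    then have "CARD('k) ^ R < CARD('k) ^ card B" using dense le by linarith
    then have "R < card B" by (rule power_less_imp_less_exp[rotated]) (use two_le_card_field[where 'k='k] in simp)
    then show ?thesis by simp
  qed
  then obtain P where P: "P \<subseteq> B" "card P = R" "finite P"
    by (elim obtain_subset_with_card_n) (rule that)
  have shP: "shattered C P" by (rule shattered_subset[OF B(2) P(1)])
  obtain Z where Z: "\<forall>f\<in>C. \<exists>g\<in>shorten Z C. \<forall>y\<in>P. g y = f y"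
    "\<forall>g\<in>shorten Z C. (\<forall>y\<in>P. g y = 0) \<longrightarrow> g = (\<lambda>_. 0)"
    using faithful_contraction[OF C, of P] by blast
  have "shattered (shorten Z C) P"
    unfolding shattered_def
  proof
    fix h
    obtain f where f: "f \<in> C" "\<forall>x\<in>P. f x = h x" using shP unfolding shattered_def by blast
    then obtain g where "g \<in> shorten Z C" "\<forall>y\<in>P. g y = f y" using Z(1) by blast
    then show "\<exists>g\<in>shorten Z C. \<forall>x\<in>P. g x = h x" using f(2) by (intro bexI[of _ g]) simp_all
  qed
  \<comment> \<open>With no apexes, nothing is demanded of the last three arguments.\<close>
  then have "apex_structure (shorten Z C) 0 R P undefined undefined undefined"
    using P Z(2) by (simp add: apex_structure_def)
  then show ?thesis by blast
qed

text \<open>The new apex is an element of \<open>K\<close>. The word \<open>f\<close> vanishes on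
  \<open>D\<close>, which contains the whole old structure, so the new apex must receive the largest
  index to keep the coordinates triangular.\<close>

lemma apex_structure_extend:
  fixes C :: "('a \<Rightarrow> 'k::{field,finite}) set"
  assumes C: "linear_code E C"
    and f: "f \<in> C" "\<forall>x\<in>K. f x \<noteq> 0" "K \<noteq> {}" "\<forall>e\<in>D. f e = 0"
    and span: "\<forall>g\<in>C. (\<forall>x\<in>K. g x = 0) \<longrightarrow> (\<forall>e\<in>D. g e = 0)"
    and const: "\<forall>g\<in>C. (\<forall>e\<in>D. g e = 0) \<longrightarrow> (\<forall>x\<in>K. \<forall>y\<in>K. g x = g y)"
    and faithful: "\<forall>g\<in>C. (\<forall>y\<in>K \<union> D. g y = 0) \<longrightarrow> g = (\<lambda>_. 0)"
    and apex: "apex_structure (shorten Z (puncture D C)) k R P \<chi> a L"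
  shows "\<exists>Z P \<chi> a L. apex_structure (shorten Z C) (Suc k) R P \<chi> a L"
proof -
  \<comment> \<open>Only \<open>Z \<inter> D\<close>: words of the punctured code vanish off
    \<open>D\<close> in any case, whereas in \<open>C\<close> vanishing on the rest of
    \<open>Z\<close> is a genuine condition.\<close>
  let ?X = "shorten (Z \<inter> D) C" and ?Y = "shorten Z (puncture D C)"
  let ?p = "\<lambda>g x. if x \<in> D then g x else (0::'k)"
  have X: "linear_code E ?X" by (rule linear_code_shorten[OF C])
  have pY: "?p g \<in> ?Y" if "g \<in> ?X" for g
    using that by (auto simp: shorten_def puncture_def)
  have lift: "\<exists>g\<in>?X. \<forall>x\<in>D. g x = h x" if "h \<in> ?Y" for h
  proof -
    have "h \<in> puncture D C" "\<forall>z\<in>Z. h z = 0" using that by (auto simp: shorten_def)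
    moreover from this obtain g where "g \<in> C" "h = ?p g" unfolding puncture_def by blast
    ultimately show ?thesis by (intro bexI[of _ g]) (auto simp: shorten_def split: if_splits)
  qed
  have supp: "h x = 0" if "h \<in> ?Y" "x \<notin> D" for h x
    using that by (auto simp: shorten_def puncture_def)
  note ap = apex[unfolded apex_structure_def]
  have chi: "\<chi> i \<in> ?Y" "\<forall>p\<in>P. \<chi> i p = 0" "a i \<in> L i" "\<forall>j<k. \<chi> i (a j) = (if i = j then 1 else 0)"
    "\<forall>j<i. \<forall>x\<in>L j. \<chi> i x = 0" "\<forall>x\<in>L i. \<chi> i x \<noteq> 0"
    "\<forall>g\<in>?Y. (\<forall>x\<in>L i. g x = 0) \<longrightarrow> (\<forall>p\<in>P. g p = 0)" if "i < k" for i
    using ap[THEN conjunct2, THEN conjunct2, THEN conjunct2, THEN conjunct1, THEN spec[of _ i], THEN mp, OF that]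
    by blast+
  have PP: "finite P" "card P = R" "shattered ?Y P"
    and exact: "\<And>g. g \<in> ?Y \<Longrightarrow> \<forall>p\<in>P. g p = 0 \<Longrightarrow> \<forall>i<k. g (a i) = 0 \<Longrightarrow> g = (\<lambda>_. 0)"
    using ap by blast+
  have LD: "x \<in> D" if "i < k" "x \<in> L i" for i x
    using chi(1,6)[OF that(1)] that(2) supp by blast
  have aD: "a i \<in> D" if "i < k" for i using LD[OF that] chi(3)[OF that] by blast
  have PD: "p \<in> D" if "p \<in> P" for p
  proof -
    obtain g where "g \<in> ?Y" "\<forall>x\<in>P. g x = (if x = p then 1 else 0)" using shattered_dual[OF PP(3)] by blast
    then have "g \<in> ?Y" "g p \<noteq> 0" using that by auto
    then show ?thesis using supp by blast
  qed
  obtain a' where a': "a' \<in> K" using f(3) by blast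
  define \<phi> where "\<phi> = (\<lambda>x. inverse (f a') * f x)"
  have phi: "\<phi> \<in> ?X" "\<phi> a' = 1" "\<And>x. x \<in> K \<Longrightarrow> \<phi> x \<noteq> 0" "\<And>e. e \<in> D \<Longrightarrow> \<phi> e = 0"
    using linear_code_scale[OF C f(1), of "inverse (f a')"] f(2,4) a' by (auto simp: \<phi>_def shorten_def)
  have "\<forall>i\<in>{..<k}. \<exists>g\<in>?X. \<forall>x\<in>D. g x = \<chi> i x" using lift chi(1) by blast
  then obtain \<psi> where psi: "\<And>i. i < k \<Longrightarrow> \<psi> i \<in> ?X \<and> (\<forall>x\<in>D. \<psi> i x = \<chi> i x)"
    unfolding Ball_def Bex_def lessThan_iff by metis
  \<comment> \<open>A multiple of \<open>\<phi>\<close> makes the lifted coordinate word vanish at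
    the new apex without changing it on \<open>D\<close>.\<close>
  define \<chi>' where "\<chi>' i = (if i < k then (\<lambda>x. \<psi> i x + (- \<psi> i a') * \<phi> x) else \<phi>)" for i
  define a'' where "a'' = a(k := a')"
  define L' where "L' = L(k := K)"
  have chiD: "\<chi>' i x = \<chi> i x" if "i < k" "x \<in> D" for i x
    using that psi[OF that(1)] phi(4)[OF that(2)] by (simp add: \<chi>'_def)
  have "(\<lambda>x. \<psi> i x + (- \<psi> i a') * \<phi> x) \<in> ?X" if "i < k" for i
    by (rule linear_code_add_scale[OF X _ phi(1)]) (use psi[OF that] in blast)
  then have chiX: "\<chi>' i \<in> ?X" if "i < Suc k" for i
    using phi(1) by (simp add: \<chi>'_def)
  have restrict: "?p g x = g x" if "x \<in> D" for g x using that by simp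
  have "apex_structure ?X (Suc k) R P \<chi>' a'' L'"
    unfolding apex_structure_def
  proof (intro conjI allI impI ballI)
    show "shattered ?X P"
      unfolding shattered_def
    proof
      fix h
      obtain g where g: "g \<in> ?Y" "\<forall>x\<in>P. g x = h x" using PP(3) unfolding shattered_def by blast
      then obtain g' where "g' \<in> ?X" "\<forall>x\<in>D. g' x = g x" using lift by blast
      then show "\<exists>g\<in>?X. \<forall>x\<in>P. g x = h x" using g(2) PD by (intro bexI[of _ g']) simp_all
    qed
  next
    fix i p assume i: "i < Suc k" and p: "p \<in> P"
    then show "\<chi>' i p = 0"
      using chiD[of i p] chi(2)[of i] phi(4) PD[OF p] by (cases "i < k") (simp_all add: \<chi>'_def)
  next
    fix i assume "i < Suc k"
    then show "a'' i \<in> L' i" using chi(3) a' by (auto simp: a''_def L'_def less_Suc_eq)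
  next
    fix i j assume i: "i < Suc k" and j: "j < Suc k"
    show "\<chi>' i (a'' j) = (if i = j then 1 else 0)"
    proof (cases "j < k")
      case True
      then show ?thesis
        using i chiD[of i "a j"] aD[OF True] chi(4)[of i] phi(4) by (cases "i < k") (auto simp: a''_def \<chi>'_def)
    next
      case False
      then have "j = k" using j by simp
      then show ?thesis using i phi(2) by (cases "i < k") (simp_all add: a''_def \<chi>'_def)
    qed
  next
    fix i j x assume i: "i < Suc k" and j: "j < i" and x: "x \<in> L' j"
    have jk: "j < k" using i j by simp
    then have xL: "x \<in> L j" using x by (simp add: L'_def)
    then show "\<chi>' i x = 0"
      using chiD[of i x] LD[OF jk xL] chi(5)[of i] j phi(4) by (cases "i < k") (auto simp: \<chi>'_def)
  next
    fix i x assume i: "i < Suc k" and x: "x \<in> L' i"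
    show "\<chi>' i x \<noteq> 0"
    proof (cases "i < k")
      case True
      then have "x \<in> L i" using x by (simp add: L'_def)
      then show ?thesis using chiD[OF True] LD[OF True] chi(6)[OF True] by simp
    next
      case False
      then show ?thesis using i x phi(3) by (simp add: L'_def \<chi>'_def)
    qed
  next
    fix i g p assume i: "i < Suc k" and g: "g \<in> ?X" "\<forall>x\<in>L' i. g x = 0" and p: "p \<in> P"
    show "g p = 0"
    proof (cases "i < k")
      case True
      have "\<forall>x\<in>L i. ?p g x = 0" using g(2) True by (simp add: L'_def)
      with bspec[OF chi(7)[OF True] pY[OF g(1)]] have "\<forall>p\<in>P. ?p g p = 0" by (rule mp)
      then have "?p g p = 0" using p by (rule bspec)
      then show ?thesis using PD[OF p] by simp
    next
      case False
      then have "\<forall>x\<in>K. g x = 0" using i g(2) by (simp add: L'_def)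
      moreover have "g \<in> C" using g(1) by (simp add: shorten_def)
      ultimately show ?thesis using span PD[OF p] by blast
    qed
  next
    fix g assume g: "g \<in> ?X" "\<forall>p\<in>P. g p = 0" "\<forall>i<Suc k. g (a'' i) = 0"
    have gC: "g \<in> C" using g(1) by (simp add: shorten_def)
    have "\<forall>i<k. g (a i) = 0" using g(3) by (auto simp: a''_def less_Suc_eq)
    then have "?p g = (\<lambda>_. 0)" by (intro exact pY[OF g(1)]) (use g(2) in auto)
    then have gD: "\<forall>e\<in>D. g e = 0" by (auto simp: fun_eq_iff split: if_splits)
    have "g a' = 0" using g(3) by (auto simp: a''_def)
    then have "\<forall>x\<in>K. g x = 0" using const gC gD a' by metis
    then show "g = (\<lambda>_. 0)" using faithful gC gD by blast
  qed (use PP chiX in auto)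
  then show ?thesis by blast
qed

text \<open>Outer induction on the number of apexes, inner induction on the rank bound. An element
  whose contraction costs fewer than \<open>\<mu>\<close> points is contracted, which preserves
  \<open>\<mu> * r < points\<close>; if there is none, \<open>dense_step\<close> applies and the
  outer hypothesis is used inside \<open>D\<close>. Rank 0 leaves no points, so the contractions
  stop.\<close>

lemma apex_structure_exists:
  "\<exists>\<Lambda>. \<forall>E (C :: ('a \<Rightarrow> 'k::{field,finite}) set) r.
     linear_code E C \<longrightarrow> card C \<le> CARD('k) ^ r \<longrightarrow> \<Lambda> * r < points E C \<longrightarrow>
     (\<exists>Z P \<chi> a K. apex_structure (shorten Z C) k R P \<chi> a K)"
proof (induction k)
  case 0
  show ?case using apex_structure_base by blast
next
  case (Suc k)
  let ?q = "CARD('k)"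
  obtain \<Lambda> where IH: "\<And>E (C :: ('a \<Rightarrow> 'k) set) r. linear_code E C \<Longrightarrow> card C \<le> ?q ^ r \<Longrightarrow>
      \<Lambda> * r < points E C \<Longrightarrow> \<exists>Z P \<chi> a K. apex_structure (shorten Z C) k R P \<chi> a K"
    using Suc.IH by blast
  \<comment> \<open>Chosen so that the spanning set \<open>X\<close> of \<open>D\<close> satisfies
    \<open>(\<Lambda> + 1) * card X \<le> card D\<close>; the extra 1 makes the density strict when
    \<open>X\<close> is nonempty.\<close>
  define s where "s = 10 * ?q\<^sup>2 * (\<Lambda> + 1)"
  define \<mu> where "\<mu> = ?q * (2 * ?q * s\<^sup>2 + 1)"
  have s0: "0 < s" using two_le_card_field[where 'k='k] by (simp add: s_def)
  have main: "\<exists>Z P \<chi> a K. apex_structure (shorten Z C) (Suc k) R P \<chi> a K"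
    if "linear_code E C" "card C \<le> ?q ^ r" "\<mu> * r < points E C" for E :: "'a set" and C :: "('a \<Rightarrow> 'k) set" and r
    using that
  proof (induction r arbitrary: C)
    case 0
    note C = \<open>linear_code E C\<close>
    have "card C \<le> 1" using 0 by simp
    moreover have "finite C" by (rule linear_code_finite[OF C])
    ultimately have "{\<lambda>_. 0} = C" using linear_code_zero[OF C] by (intro card_seteq) simp_all
    then have "\<forall>g\<in>C. \<forall>x. g x = 0" by blast
    then have "column C ` E - {\<lambda>_. 0} = {}" by (auto simp: column_zero_iff)
    then have "points E C = 0" by (simp only: points_def card.empty)
    then show ?case using 0 by simp
  next
    case (Suc r)
    note C = \<open>linear_code E C\<close>
    show ?case
    proof (cases "\<exists>e\<in>E. (\<exists>g\<in>C. g e \<noteq> 0) \<and> points E C < points E (shorten {e} C) + \<mu>")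
      case True
      then obtain e g where e: "g \<in> C" "g e \<noteq> 0" "points E C < points E (shorten {e} C) + \<mu>" by blast
      have "?q * card (shorten {e} C) \<le> ?q * ?q ^ r"
        using card_shorten_one[OF C e(1,2)] Suc.prems(2) by simp
      then have "card (shorten {e} C) \<le> ?q ^ r" using two_le_card_field[where 'k='k] by simp
      moreover have "\<mu> * r < points E (shorten {e} C)" using e(3) Suc.prems(3) by simp
      ultimately have "\<exists>Z P \<chi> a K. apex_structure (shorten Z (shorten {e} C)) (Suc k) R P \<chi> a K"
        by (intro Suc.IH linear_code_shorten[OF C])
      then show ?thesis unfolding shorten_shorten by blast
    next
      case False
      then have crit: "\<forall>e\<in>E. (\<exists>g\<in>C. g e \<noteq> 0) \<longrightarrow> points E (shorten {e} C) + ?q * (2 * ?q * s\<^sup>2 + 1) \<le> points E C"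
        unfolding \<mu>_def[symmetric] by (meson not_less)
      have "0 < points E C" using Suc.prems(3) by simp
      from dense_step[OF C s0 this crit] obtain f K D X where
        f: "f \<in> C" "\<forall>x\<in>K. f x \<noteq> 0" "K \<noteq> {}" "\<forall>e\<in>D. f e = 0" and D: "D \<subseteq> E" "D \<noteq> {}" "inj_on (column C) D"
          "\<forall>e\<in>D. \<exists>g\<in>C. g e \<noteq> 0"
        and span: "\<forall>g\<in>C. (\<forall>x\<in>K. g x = 0) \<longrightarrow> (\<forall>e\<in>D. g e = 0)"
        and const: "\<forall>g\<in>C. (\<forall>e\<in>D. g e = 0) \<longrightarrow> (\<forall>x\<in>K. \<forall>y\<in>K. g x = g y)"
        and X: "finite X" "\<forall>g\<in>C. (\<forall>x\<in>X. g x = 0) \<longrightarrow> (\<forall>e\<in>D. g e = 0)" "s * card X \<le> 10 * ?q\<^sup>2 * card D"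
        by (elim exE conjE) (rule that)
      have fD: "finite D" using D(1) linear_code_finite_ground[OF C] finite_subset by blast
      \<comment> \<open>Afterwards \<open>K \<union> D\<close> spans, which will give the last
        clause of the apex structure, while restrictions to \<open>K \<union> D\<close> stay the
        same.\<close>
      obtain Z where Z: "\<forall>f\<in>C. \<exists>g\<in>shorten Z C. \<forall>y\<in>K \<union> D. g y = f y"
        "\<forall>g\<in>shorten Z C. (\<forall>y\<in>K \<union> D. g y = 0) \<longrightarrow> g = (\<lambda>_. 0)"
        using faithful_contraction[OF C, of "K \<union> D"] by blast
      let ?C = "shorten Z C"
      have C': "linear_code E ?C" by (rule linear_code_shorten[OF C])
      have sub: "g \<in> C" if "g \<in> ?C" for g using that by (simp add: shorten_def)
      obtain f' where f': "f' \<in> ?C" "\<forall>y\<in>K \<union> D. f' y = f y" using Z(1) f(1) by blast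
      have cardP: "card (puncture D ?C) \<le> ?q ^ card X"
        by (rule card_puncture_le[OF C' X(1)]) (use X(2) sub in blast)
      have eqC: "column C x = column C y" if "x \<in> D" "y \<in> D" "column (puncture D ?C) x = column (puncture D ?C) y" for x y
        unfolding column_eq_iff
      proof
        fix g assume "g \<in> C"
        then obtain g' where g': "g' \<in> ?C" "\<forall>y\<in>K \<union> D. g' y = g y" using Z(1) by blast
        have "(\<lambda>x. if x \<in> D then g' x else 0) \<in> puncture D ?C" using g'(1) by (auto simp: puncture_def)
        from column_eqD[OF that(3) this] show "g x = g y" using that(1,2) g'(2) by simp
      qed
      have inj: "inj_on (column (puncture D ?C)) D"
      proof (rule inj_onI)
        fix x y assume "x \<in> D" "y \<in> D" "column (puncture D ?C) x = column (puncture D ?C) y"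
        then show "x = y" using eqC inj_onD[OF D(3)] by blast
      qed
      have ne: "column (puncture D ?C) e \<noteq> (\<lambda>_. 0)" if e: "e \<in> D" for e
      proof
        assume z: "column (puncture D ?C) e = (\<lambda>_. 0)"
        obtain g where g: "g \<in> C" "g e \<noteq> 0" using D(4) e by blast
        then obtain g' where g': "g' \<in> ?C" "\<forall>y\<in>K \<union> D. g' y = g y" using Z(1) by blast
        then have "(\<lambda>x. if x \<in> D then g' x else 0) \<in> puncture D ?C" by (auto simp: puncture_def)
        then have "g' e = 0" using z e unfolding column_zero_iff by fastforce
        then show False using g(2) g'(2) e by simp
      qed
      have "(\<lambda>_. 0) \<notin> column (puncture D ?C) ` D"
      proof
        assume "(\<lambda>_. 0) \<in> column (puncture D ?C) ` D"
        then obtain e where "(\<lambda>_. 0) = column (puncture D ?C) e" "e \<in> D" by (rule imageE)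
        then show False using ne by metis
      qed
      then have pD: "points D (puncture D ?C) = card D"
        unfolding points_def by (simp add: card_image[OF inj])
      have "10 * ?q\<^sup>2 * ((\<Lambda> + 1) * card X) \<le> 10 * ?q\<^sup>2 * card D" using X(3) by (simp only: s_def mult.assoc)
      then have "(\<Lambda> + 1) * card X \<le> card D" using two_le_card_field[where 'k='k] by simp
      then have "\<Lambda> * card X < card D" using D(2) fD by (cases "card X") (auto simp: card_gt_0_iff)
      then have "\<Lambda> * card X < points D (puncture D ?C)" using pD by simp
      from IH[OF linear_code_puncture[OF C' fD] cardP this] obtain Z2 P \<chi> a L where
        ap: "apex_structure (shorten Z2 (puncture D ?C)) k R P \<chi> a L" by blast
      have "\<exists>Z P \<chi> a L. apex_structure (shorten Z ?C) (Suc k) R P \<chi> a L"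
      proof (rule apex_structure_extend[OF C' f'(1) _ f(3) _ _ _ Z(2) ap])
        show "\<forall>x\<in>K. f' x \<noteq> 0" using f'(2) f(2) by simp
        show "\<forall>e\<in>D. f' e = 0" using f'(2) f(4) by simp
        show "\<forall>g\<in>?C. (\<forall>x\<in>K. g x = 0) \<longrightarrow> (\<forall>e\<in>D. g e = 0)" using span sub by blast
        show "\<forall>g\<in>?C. (\<forall>e\<in>D. g e = 0) \<longrightarrow> (\<forall>x\<in>K. \<forall>y\<in>K. g x = g y)" using const sub by blast
      qed
      then show ?thesis unfolding shorten_shorten by blast
    qed
  qed
  then show ?case by blast
qed

section \<open>Cliques in dense codes\<close>

text \<open>The code of the oriented incidence matrix of the clique: on the elements
  \<open>x i j\<close>, the words of the contraction are exactly the differences of functions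
  \<open>b\<close> on the vertices.\<close>

definition clique_code :: "nat \<Rightarrow> ('a \<Rightarrow> 'k::field) set \<Rightarrow> bool" where
  "clique_code t C \<longleftrightarrow> (\<exists>Z x.
     (\<forall>g\<in>shorten Z C. \<exists>b. \<forall>j<t. \<forall>i<j. g (x i j) = b j - b i) \<and>
     (\<forall>b. \<exists>g\<in>shorten Z C. \<forall>j<t. \<forall>i<j. g (x i j) = b j - b i))"

lemma clique_code_shorten: "clique_code t (shorten Z C) \<Longrightarrow> clique_code t C"
  unfolding clique_code_def shorten_shorten by blast

text \<open>Forward substitution: adding the largest index leaves the earlier rows unchanged, and
  its own row is solved by the diagonal entry.\<close>

lemma triangular_solve:
  fixes c :: "nat \<Rightarrow> nat \<Rightarrow> 'k::field"
  assumes "finite I" "\<And>i l. i \<in> I \<Longrightarrow> l \<in> I \<Longrightarrow> i < l \<Longrightarrow> c i l = 0" "\<And>i. i \<in> I \<Longrightarrow> c i i \<noteq> 0"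
  shows "\<exists>\<beta>. \<forall>i\<in>I. (\<Sum>l\<in>I. c i l * \<beta> l) = v i"
  using assms
proof (induction I rule: finite_linorder_max_induct)
  case empty
  then show ?case by simp
next
  case (insert b A)
  then obtain \<beta> where \<beta>: "\<forall>i\<in>A. (\<Sum>l\<in>A. c i l * \<beta> l) = v i" by auto
  have bA: "b \<notin> A" using insert.hyps(2) by auto
  define \<beta>' where "\<beta>' = \<beta>(b := (v b - (\<Sum>l\<in>A. c b l * \<beta> l)) / c b b)"
  have A: "(\<Sum>l\<in>A. c i l * \<beta>' l) = (\<Sum>l\<in>A. c i l * \<beta> l)" for i
    using bA by (intro sum.cong) (auto simp: \<beta>'_def)
  have "(\<Sum>l\<in>insert b A. c i l * \<beta>' l) = v i" if i: "i \<in> insert b A" for i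
  proof (cases "i = b")
    case True
    then show ?thesis using insert.hyps(1) bA A insert.prems(2)[of b] by (simp add: \<beta>'_def)
  next
    case False
    then have "i \<in> A" "c i b = 0" using i insert.hyps(2) insert.prems(1)[of i b] by auto
    then show ?thesis using insert.hyps(1) bA A \<beta> by simp
  qed
  then show ?case by blast
qed

lemma exists_large_fibre:
  assumes "finite A" "finite B" "B \<noteq> {}" "f ` A \<subseteq> B" "card B * t \<le> card A"
  shows "\<exists>A'\<subseteq>A. card A' = t \<and> (\<exists>b\<in>B. \<forall>a\<in>A'. f a = b)"
proof -
  have "card A = (\<Sum>b\<in>B. card {a \<in> A. f a = b})"
    using sum.group[OF assms(1,2,4), of "\<lambda>_. 1::nat"] by simp
  then have "\<exists>b\<in>B. t \<le> card {a \<in> A. f a = b}"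
    using assms by (intro exists_ge_average) simp_all
  then obtain b where b: "b \<in> B" "t \<le> card {a \<in> A. f a = b}" by blast
  from b(2) obtain A' where "A' \<subseteq> {a \<in> A. f a = b}" "card A' = t" "finite A'"
    by (elim obtain_subset_with_card_n) (rule that)
  then show ?thesis using b(1) by (intro exI[of _ A'] conjI bexI[of _ b]) auto
qed

text \<open>Modulo the apexes, all \<open>K i\<close> span the same space, whose size depends on
  \<open>R\<close> and \<open>q\<close> only. After the first pigeonhole, \<open>t\<close> of them
  show the same columns there; after the second, the lifts of \<open>t\<close> columns
  \<open>y\<close> to \<open>K i\<close> all have the form \<open>y\<close> plus a vector depending
  on \<open>i\<close> only.\<close>

lemma apex_structure_clique_code:
  fixes C :: "('a \<Rightarrow> 'k::{field,finite}) set"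
  assumes C: "linear_code E C" and ap: "apex_structure C k R P \<chi> a K"
    and t: "0 < t" and R: "CARD('k) ^ (t * t) * t \<le> R"
    and k: "2 ^ (CARD('k) ^ (CARD('k) ^ R)) * t \<le> k"
  shows "clique_code t C"
proof -
  let ?q = "CARD('k)"
  have P: "finite P" "card P = R" "shattered C P"
    and exact: "\<forall>g\<in>C. (\<forall>p\<in>P. g p = 0) \<longrightarrow> (\<forall>i<k. g (a i) = 0) \<longrightarrow> g = (\<lambda>_. 0)"
    using ap unfolding apex_structure_def by blast+
  have chi: "\<chi> i \<in> C" "\<forall>p\<in>P. \<chi> i p = 0" "a i \<in> K i" "\<forall>j<k. \<chi> i (a j) = (if i = j then 1 else 0)"
    "\<forall>j<i. \<forall>x\<in>K j. \<chi> i x = 0" "\<forall>x\<in>K i. \<chi> i x \<noteq> 0"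
    "\<forall>g\<in>C. (\<forall>x\<in>K i. g x = 0) \<longrightarrow> (\<forall>p\<in>P. g p = 0)" if "i < k" for i
    using ap[unfolded apex_structure_def, THEN conjunct2, THEN conjunct2, THEN conjunct2, THEN conjunct1, THEN spec[of _ i], THEN mp, OF that]
    by blast+
  have fE: "finite E" by (rule linear_code_finite_ground[OF C])
  have KE: "K i \<subseteq> E" if "i < k" for i
    using chi(1,6)[OF that] linear_code_support[OF C] by blast
  have fK: "finite (K i)" if "i < k" for i using KE[OF that] fE finite_subset by blast
  define Y where "Y = shorten (a ` {..<k}) C"
  have YC: "linear_code E Y" unfolding Y_def by (rule linear_code_shorten[OF C])
  have Yin: "g \<in> C" "\<forall>i<k. g (a i) = 0" if "g \<in> Y" for g using that by (auto simp: Y_def shorten_def)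
  have proj: "(\<lambda>x. g x - (\<Sum>l<k. g (a l) * \<chi> l x)) \<in> Y" if g: "g \<in> C" for g
  proof -
    have "(\<lambda>x. g x - (\<Sum>l<k. g (a l) * \<chi> l x)) \<in> C"
      by (intro linear_code_diff[OF C g] linear_code_sum[OF C]) (auto simp: chi(1))
    moreover have "(\<Sum>l<k. g (a l) * \<chi> l (a j)) = g (a j)" if j: "j < k" for j
    proof -
      have "(\<Sum>l<k. g (a l) * \<chi> l (a j)) = (\<Sum>l<k. if l = j then g (a j) else 0)"
        using chi(4) j by (intro sum.cong) auto
      then show ?thesis using j by simp
    qed
    ultimately show ?thesis by (auto simp: Y_def shorten_def)
  qed
  have shY: "shattered Y P"
    unfolding shattered_def
  proof
    fix h
    obtain g where g: "g \<in> C" "\<forall>x\<in>P. g x = h x" using P(3) unfolding shattered_def by blast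
    have "(\<Sum>l<k. g (a l) * \<chi> l p) = 0" if "p \<in> P" for p
      using chi(2) that by (intro sum.neutral) auto
    then show "\<exists>g\<in>Y. \<forall>x\<in>P. g x = h x" using proj[OF g(1)] g(2) by (intro bexI[OF _ proj[OF g(1)]]) simp
  qed
  have cardY: "?q ^ R \<le> card Y" using power_le_card_shattered[OF YC P(1) shY] P(2) by simp
  have cardY': "card Y \<le> ?q ^ R"
    using card_le_power_determining[OF YC P(1)] exact Yin P(2) by simp
  \<comment> \<open>Evaluation patterns of \<open>K i\<close> on the words vanishing at all apexes.
    There are at most \<open>q ^ R\<close> such words, hence at most
    \<open>2 ^ (q ^ (q ^ R))\<close> sets of patterns, which is the origin of the bound on
    \<open>k\<close>.\<close>
  define T where "T i = (\<lambda>x. restrict (\<lambda>f. f x) Y) ` K i" for i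
  let ?F = "Y \<rightarrow>\<^sub>E (UNIV :: 'k set)"
  have fY: "finite Y" by (rule linear_code_finite[OF YC])
  have "card ?F = ?q ^ card Y" by (simp add: card_PiE[OF fY])
  also have "\<dots> \<le> ?q ^ (?q ^ R)" using cardY' two_le_card_field[where 'k='k] by (intro power_increasing) simp_all
  finally have "card (Pow ?F) \<le> 2 ^ (?q ^ (?q ^ R))" by (simp add: card_Pow finite_PiE fY power_increasing)
  then have cF: "card (Pow ?F) * t \<le> card {..<k}" using k by (metis card_lessThan mult_le_mono1 order_trans)
  have TF: "T ` {..<k} \<subseteq> Pow ?F" by (auto simp: T_def)
  have "finite (Pow ?F)" using fY by (simp add: finite_PiE)
  then have "\<exists>I\<subseteq>{..<k}. card I = t \<and> (\<exists>T0\<in>Pow ?F. \<forall>i\<in>I. T i = T0)"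
    by (rule exists_large_fibre[OF finite_lessThan _ Pow_not_empty TF cF])
  then obtain I T0 where I: "I \<subseteq> {..<k}" "card I = t" "\<forall>i\<in>I. T i = T0" by blast
  have fI: "finite I" using I(1) finite_subset by blast
  have Ik: "i < k" if "i \<in> I" for i using that I(1) by blast
  have "I \<noteq> {}" using I(2) t by auto
  then obtain i0 where i0: "i0 \<in> I" by blast
  have "\<exists>Q\<subseteq>K i0. card Q = R \<and> shattered Y Q"
  proof (rule exists_shattered_card[OF YC cardY fK[OF Ik[OF i0]]])
    show "\<forall>g\<in>Y. (\<forall>x\<in>K i0. g x = 0) \<longrightarrow> g = (\<lambda>_. 0)"
    proof (intro ballI impI)
      fix g assume g: "g \<in> Y" "\<forall>x\<in>K i0. g x = 0"
      have "\<forall>p\<in>P. g p = 0" by (rule bspec[OF chi(7)[OF Ik[OF i0]] Yin(1)[OF g(1)], THEN mp]) fact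
      then show "g = (\<lambda>_. 0)" using bspec[OF exact Yin(1)[OF g(1)]] Yin(2)[OF g(1)] by simp
    qed
  qed
  then obtain Q where Q: "Q \<subseteq> K i0" "card Q = R" "shattered Y Q" by blast
  have fQ: "finite Q" using Q(1) fK[OF Ik[OF i0]] finite_subset by blast
  have "\<exists>x\<in>K i. \<forall>f\<in>Y. f x = f y" if i: "i \<in> I" and y: "y \<in> Q" for i y
  proof -
    have "restrict (\<lambda>f. f y) Y \<in> T i0" using y Q(1) by (auto simp: T_def)
    then have "restrict (\<lambda>f. f y) Y \<in> T i" using I(3) i i0 by simp
    then obtain x where x: "x \<in> K i" "restrict (\<lambda>f. f y) Y = restrict (\<lambda>f. f x) Y" by (auto simp: T_def)
    have "f x = f y" if "f \<in> Y" for f using fun_cong[OF x(2), of f] that by simp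
    then show ?thesis using x(1) by blast
  qed
  then obtain x where x: "\<And>i y. i \<in> I \<Longrightarrow> y \<in> Q \<Longrightarrow> x i y \<in> K i" "\<And>i y f. i \<in> I \<Longrightarrow> y \<in> Q \<Longrightarrow> f \<in> Y \<Longrightarrow> f (x i y) = f y"
    by metis
  \<comment> \<open>The apex coordinates of all lifts of \<open>y\<close>. There are
    \<open>q ^ (t * t)\<close> such tables, which is the origin of the bound on
    \<open>R\<close>.\<close>
  define sig where "sig y = restrict (\<lambda>(i, l). \<chi> l (x i y)) (I \<times> I)" for y
  let ?G = "(I \<times> I) \<rightarrow>\<^sub>E (UNIV :: 'k set)"
  have fII: "finite (I \<times> I)" using fI by simp
  have "card ?G = ?q ^ (t * t)" using I(2) by (simp add: card_PiE[OF fII] card_cartesian_product)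
  then have cG: "card ?G * t \<le> card Q" using R Q(2) by simp
  have sigG: "sig ` Q \<subseteq> ?G" by (simp add: image_subset_iff sig_def restrict_PiE_iff)
  have fG: "finite ?G" using fII by (simp add: finite_PiE)
  have "?G \<noteq> {}" by (simp add: PiE_eq_empty_iff)
  then have "\<exists>Q'\<subseteq>Q. card Q' = t \<and> (\<exists>u\<in>?G. \<forall>y\<in>Q'. sig y = u)"
    by (rule exists_large_fibre[OF fQ fG _ sigG cG])
  then obtain Q' u where Q': "Q' \<subseteq> Q" "card Q' = t" "\<forall>y\<in>Q'. sig y = u" by blast
  define c where "c i l = u (i, l)" for i l
  have c: "\<chi> l (x i y) = c i l" if "i \<in> I" "l \<in> I" "y \<in> Q'" for i l y
  proof -
    have "sig y (i, l) = c i l" using Q'(3) that(3) by (simp add: c_def)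
    then show ?thesis using that(1,2) by (simp add: sig_def)
  qed
  have fQ': "finite Q'" using Q'(1) fQ finite_subset by blast
  obtain \<iota> where \<iota>: "bij_betw \<iota> {0..<t} I" using ex_bij_betw_nat_finite[OF fI] I(2) by blast
  obtain \<eta> where \<eta>: "bij_betw \<eta> {0..<t} Q'" using ex_bij_betw_nat_finite[OF fQ'] Q'(2) by blast
  have \<iota>I: "\<iota> i \<in> I" if "i < t" for i using bij_betwE[OF \<iota>] that by simp
  have \<eta>Q: "\<eta> i \<in> Q'" "\<eta> i \<in> Q" if "i < t" for i using bij_betwE[OF \<eta>] that Q'(1) by auto
  define xx where "xx i j = x (\<iota> i) (\<eta> j)" for i j
  \<comment> \<open>Besides the unselected apexes, the diagonal is contracted: it is a perfect
    matching that identifies the two sides of the bipartite graph.\<close>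
  define Z where "Z = a ` ({..<k} - I) \<union> (\<lambda>i. xx i i) ` {..<t}"
  have up: "\<exists>b. \<forall>j<t. \<forall>i<j. g (xx i j) = b j - b i" if g: "g \<in> shorten Z C" for g
  proof -
    define h where "h = (\<lambda>x. g x - (\<Sum>l<k. g (a l) * \<chi> l x))"
    have gC: "g \<in> C" and gZ: "\<forall>z\<in>Z. g z = 0" using g by (auto simp: shorten_def)
    have hY: "h \<in> Y" unfolding h_def by (rule proj[OF gC])
    \<comment> \<open>The value of \<open>g\<close> at the shift shared by all lifts of index
      \<open>i\<close>. Vanishing on the diagonal turns it into
      \<open>- h (\<eta> i)\<close>.\<close>
    define \<alpha> where "\<alpha> i = (\<Sum>l\<in>I. g (a l) * c (\<iota> i) l)" for i
    have val: "g (xx i j) = h (\<eta> j) + \<alpha> i" if i: "i < t" and j: "j < t" for i j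
    proof -
      have "(\<Sum>l<k. g (a l) * \<chi> l (xx i j)) = (\<Sum>l\<in>I. g (a l) * \<chi> l (xx i j))"
        using I(1) gZ by (intro sum.mono_neutral_right) (auto simp: Z_def)
      also have "\<dots> = \<alpha> i"
        unfolding \<alpha>_def xx_def using \<iota>I[OF i] \<eta>Q(1)[OF j] by (intro sum.cong refl) (simp add: c)
      finally have "g (xx i j) = h (xx i j) + \<alpha> i" by (simp add: h_def)
      also have "h (xx i j) = h (\<eta> j)" unfolding xx_def by (rule x(2)[OF \<iota>I[OF i] \<eta>Q(2)[OF j] hY])
      finally show ?thesis .
    qed
    have diag: "h (\<eta> i) + \<alpha> i = 0" if "i < t" for i
    proof -
      have "xx i i \<in> Z" using that by (simp add: Z_def)
      then show ?thesis using val[OF that that] gZ by simp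
    qed
    have "g (xx i j) = h (\<eta> j) - h (\<eta> i)" if "j < t" "i < j" for i j
    proof -
      have "i < t" using that by simp
      then have "\<alpha> i = - h (\<eta> i)" using diag[of i] by (simp add: eq_neg_iff_add_eq_0 add.commute)
      then show ?thesis using val[OF \<open>i < t\<close> that(1)] by simp
    qed
    then show ?thesis by (intro exI[of _ "\<lambda>i. h (\<eta> i)"]) simp
  qed
  have down: "\<exists>g\<in>shorten Z C. \<forall>j<t. \<forall>i<j. g (xx i j) = b j - b i" for b :: "nat \<Rightarrow> 'k"
  proof -
    define e where "e = inv_into {0..<t} \<eta>"
    have e: "e (\<eta> i) = i" if "i < t" for i
      using bij_betw_inv_into_left[OF \<eta>] that by (simp add: e_def)
    have "shattered Y Q'" by (rule shattered_subset[OF Q(3) Q'(1)])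
    then obtain h where h: "h \<in> Y" "\<forall>y\<in>Q'. h y = b (e y)"
      unfolding shattered_def by (drule_tac spec[of _ "\<lambda>y. b (e y)"]) blast
    define e' where "e' = inv_into {0..<t} \<iota>"
    have e': "e' (\<iota> i) = i" if "i < t" for i
      using bij_betw_inv_into_left[OF \<iota>] that by (simp add: e'_def)
    have czero: "c i l = 0" if "i \<in> I" "l \<in> I" "i < l" for i l
    proof -
      have y: "\<eta> 0 \<in> Q'" "\<eta> 0 \<in> Q" using \<eta>Q t by auto
      have "\<chi> l (x i (\<eta> 0)) = 0" using chi(5)[OF Ik[OF that(2)]] x(1)[OF that(1) y(2)] that(3) by blast
      then show ?thesis using c[OF that(1,2) y(1)] by simp
    qed
    have cnz: "c i i \<noteq> 0" if "i \<in> I" for i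
    proof -
      have y: "\<eta> 0 \<in> Q'" "\<eta> 0 \<in> Q" using \<eta>Q t by auto
      have "\<chi> i (x i (\<eta> 0)) \<noteq> 0" using chi(6)[OF Ik[OF that]] x(1)[OF that y(2)] by blast
      then show ?thesis using c[OF that that y(1)] by simp
    qed
    \<comment> \<open>The values at the selected apexes are free, and the triangular shape of
      \<open>c\<close> allows the shift of each index to be prescribed as minus its
      potential.\<close>
    have "\<exists>\<beta>. \<forall>i\<in>I. (\<Sum>l\<in>I. c i l * \<beta> l) = - b (e' i)"
      by (rule triangular_solve[OF fI]) (simp_all add: czero cnz)
    then obtain \<beta> where \<beta>: "\<forall>i\<in>I. (\<Sum>l\<in>I. c i l * \<beta> l) = - b (e' i)" by blast
    define g where "g = (\<lambda>x. h x + 1 * (\<Sum>l\<in>I. \<beta> l * \<chi> l x))"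
    have gC: "g \<in> C"
      unfolding g_def by (intro linear_code_add_scale[OF C] Yin(1)[OF h(1)] linear_code_sum[OF C fI] chi(1) Ik)
    have val: "g (xx i j) = b j - b i" if i: "i < t" and j: "j < t" for i j
    proof -
      have "(\<Sum>l\<in>I. \<beta> l * \<chi> l (xx i j)) = (\<Sum>l\<in>I. c (\<iota> i) l * \<beta> l)"
        unfolding xx_def using \<iota>I[OF i] \<eta>Q(1)[OF j] by (intro sum.cong refl) (simp add: c mult.commute)
      also have "\<dots> = - b i" using \<beta> \<iota>I[OF i] e'[OF i] by simp
      finally have "g (xx i j) = h (xx i j) - b i" by (simp add: g_def)
      also have "h (xx i j) = h (\<eta> j)" unfolding xx_def by (rule x(2)[OF \<iota>I[OF i] \<eta>Q(2)[OF j] h(1)])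
      also have "\<dots> = b j" using h(2) \<eta>Q(1)[OF j] e[OF j] by simp
      finally show ?thesis .
    qed
    have "g (a j) = 0" if j: "j < k" "j \<notin> I" for j
    proof -
      have "(\<Sum>l\<in>I. \<beta> l * \<chi> l (a j)) = 0"
        using chi(4) Ik j by (intro sum.neutral) auto
      then show ?thesis using Yin(2)[OF h(1)] j(1) by (simp add: g_def)
    qed
    then have "g \<in> shorten Z C" using gC val by (auto simp: shorten_def Z_def)
    then show ?thesis using val by (intro bexI[of _ g]) simp_all
  qed
  show ?thesis unfolding clique_code_def using up down by blast
qed

theorem dense_clique_code:
  "\<exists>\<Lambda>. \<forall>E (C :: ('a \<Rightarrow> 'k::{field,finite}) set) r.
     linear_code E C \<longrightarrow> card C \<le> CARD('k) ^ r \<longrightarrow> \<Lambda> * r < points E C \<longrightarrow> clique_code t C"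
proof -
  \<comment> \<open>The construction asks for at least one vertex; the larger clique contains the
    smaller one.\<close>
  define t' where "t' = Suc t"
  define R where "R = CARD('k) ^ (t' * t') * t'"
  define k where "k = 2 ^ (CARD('k) ^ (CARD('k) ^ R)) * t'"
  obtain \<Lambda> where \<Lambda>: "\<forall>E (C :: ('a \<Rightarrow> 'k) set) r.
     linear_code E C \<longrightarrow> card C \<le> CARD('k) ^ r \<longrightarrow> \<Lambda> * r < points E C \<longrightarrow>
     (\<exists>Z P \<chi> a K. apex_structure (shorten Z C) k R P \<chi> a K)"
    using apex_structure_exists[where 'a='a and 'k='k, of k R] by blast
  have mono: "clique_code t C" if cl: "clique_code t' C" for C :: "('a \<Rightarrow> 'k) set"
  proof -
    obtain Z x where Zx: "\<forall>g\<in>shorten Z C. \<exists>b. \<forall>j<t'. \<forall>i<j. g (x i j) = b j - b i"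
      "\<forall>b. \<exists>g\<in>shorten Z C. \<forall>j<t'. \<forall>i<j. g (x i j) = b j - b i"
      using cl unfolding clique_code_def by blast
    have lt: "j < t'" if "j < t" for j using that by (simp add: t'_def)
    have "\<forall>g\<in>shorten Z C. \<exists>b. \<forall>j<t. \<forall>i<j. g (x i j) = b j - b i"
      using Zx(1) lt by metis
    moreover have "\<forall>b. \<exists>g\<in>shorten Z C. \<forall>j<t. \<forall>i<j. g (x i j) = b j - b i"
      using Zx(2) lt by metis
    ultimately show ?thesis unfolding clique_code_def by (intro exI conjI)
  qed
  have "clique_code t C" if code: "linear_code E C" and dense: "card C \<le> CARD('k) ^ r" "\<Lambda> * r < points E C"
    for E and C :: "('a \<Rightarrow> 'k) set" and r
  proof -
    obtain Z P \<chi> a K where ap: "apex_structure (shorten Z C) k R P \<chi> a K"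
      using \<Lambda>[rule_format, OF code dense] by blast
    have "clique_code t' (shorten Z C)"
      by (rule apex_structure_clique_code[OF linear_code_shorten[OF code] ap])
        (simp_all add: t'_def R_def k_def)
    then show ?thesis by (rule mono[OF clique_code_shorten])
  qed
  then show ?thesis by blast
qed

section \<open>Packing columns\<close>

lemma maximal_matching:
  assumes G: "finite G" and sym: "\<And>x y. (x, y) \<in> G \<Longrightarrow> (y, x) \<in> G"
  shows "\<exists>M\<subseteq>G. (\<forall>p\<in>M. \<forall>p'\<in>M. {fst p, snd p} \<inter> {fst p', snd p'} \<noteq> {} \<longrightarrow> p = p') \<and>
    (\<forall>(x, y)\<in>G. x \<in> fst ` M \<union> snd ` M \<or> y \<in> fst ` M \<union> snd ` M)"
proof -
  define P where "P = {M. M \<subseteq> G \<and> (\<forall>p\<in>M. \<forall>p'\<in>M. {fst p, snd p} \<inter> {fst p', snd p'} \<noteq> {} \<longrightarrow> p = p')}"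
  have "finite P" using G by (rule_tac finite_subset[of _ "Pow G"]) (auto simp: P_def)
  moreover have "{} \<in> P" by (simp add: P_def)
  then have "P \<noteq> {}" by blast
  ultimately obtain M where M: "M \<in> P" and mx: "\<forall>M'\<in>P. M \<subseteq> M' \<longrightarrow> M = M'"
    by (blast dest: finite_has_maximal)
  have "x \<in> fst ` M \<union> snd ` M \<or> y \<in> fst ` M \<union> snd ` M" if xy: "(x, y) \<in> G" for x y
  proof (rule ccontr)
    assume no: "\<not> ?thesis"
    then have dis: "{x, y} \<inter> {fst p, snd p} = {}" if "p \<in> M" for p using that by auto
    have "insert (x, y) M \<in> P"
      unfolding P_def
    proof (intro CollectI conjI ballI impI)
      show "insert (x, y) M \<subseteq> G" using M xy by (simp add: P_def)
    next
      fix p p' assume p: "p \<in> insert (x, y) M" and p': "p' \<in> insert (x, y) M"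
        and i: "{fst p, snd p} \<inter> {fst p', snd p'} \<noteq> {}"
      show "p = p'"
      proof (cases "p \<in> M \<and> p' \<in> M")
        case True
        then show ?thesis using M i unfolding P_def by blast
      next
        case False
        then show ?thesis using p p' i dis[of p] dis[of p'] by auto
      qed
    qed
    then have "(x, y) \<in> M" using mx by blast
    then show False using no by force
  qed
  note cover = this
  have "M \<subseteq> G" "\<forall>p\<in>M. \<forall>p'\<in>M. {fst p, snd p} \<inter> {fst p', snd p'} \<noteq> {} \<longrightarrow> p = p'"
    using M by (simp_all add: P_def)
  moreover have "\<forall>(x, y)\<in>G. x \<in> fst ` M \<union> snd ` M \<or> y \<in> fst ` M \<union> snd ` M"
    using cover by (simp add: case_prod_beta)
  ultimately show ?thesis by (intro exI[of _ M] conjI)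
qed

section \<open>Columns in the coordinates of a basis\<close>

locale code_basis =
  fixes E :: "'a set" and C :: "('a \<Rightarrow> 'k::{field,finite}) set" and B :: "'a set" and u :: "'a \<Rightarrow> 'a \<Rightarrow> 'k"
  assumes code: "linear_code E C" and B: "B \<subseteq> E"
    and det: "\<forall>g\<in>C. (\<forall>x\<in>B. g x = 0) \<longrightarrow> g = (\<lambda>_. 0)"
    and u: "\<And>b. b \<in> B \<Longrightarrow> u b \<in> C" and u_dual: "\<And>b x. b \<in> B \<Longrightarrow> x \<in> B \<Longrightarrow> u b x = (if x = b then 1 else 0)"
begin

lemma finB: "finite B"
  using B linear_code_finite_ground[OF code] finite_subset by blast

definition "Y = E - B"

lemma finY: "finite Y"
  using linear_code_finite_ground[OF code] by (simp add: Y_def)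

lemma expand:
  assumes f: "f \<in> C" shows "f x = (\<Sum>b\<in>B. f b * u b x)"
proof -
  define g where "g = (\<lambda>x. f x - (\<Sum>b\<in>B. f b * u b x))"
  have "g \<in> C" unfolding g_def by (intro linear_code_diff[OF code f] linear_code_sum[OF code finB] u)
  moreover have "(\<Sum>b'\<in>B. f b' * u b' b) = f b" if "b \<in> B" for b
  proof -
    have "(\<Sum>b'\<in>B. f b' * u b' b) = (\<Sum>b'\<in>B. if b' = b then f b else 0)"
      using u_dual that by (intro sum.cong) auto
    then show ?thesis using that finB by simp
  qed
  then have "\<forall>b\<in>B. g b = 0" by (simp add: g_def)
  ultimately have "g = (\<lambda>_. 0)" using det by blast
  from fun_cong[OF this, of x] show ?thesis by (simp add: g_def)
qed

text \<open>\<open>u b x\<close> is the entry of column \<open>x\<close> in row \<open>b\<close>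
  when columns are written in the basis \<open>B\<close>. Contracting \<open>B - A\<close> keeps the
  rows in \<open>A\<close>, so traces on \<open>A\<close> are columns of that contraction.\<close>

definition "trace A x = restrict (\<lambda>b. u b x) A"

lemma trace_eq_iff: "trace A x = trace A y \<longleftrightarrow> (\<forall>b\<in>A. u b x = u b y)"
  by (auto simp: trace_def restrict_def fun_eq_iff)

abbreviation "sub A \<equiv> shorten (B - A) C"

lemma u_sub: "A \<subseteq> B \<Longrightarrow> b \<in> A \<Longrightarrow> u b \<in> sub A"
  using u u_dual by (auto simp: shorten_def)

lemma expand_sub:
  assumes A: "A \<subseteq> B" and f: "f \<in> sub A" shows "f x = (\<Sum>b\<in>A. f b * u b x)"
proof -
  have "f x = (\<Sum>b\<in>B. f b * u b x)" by (rule expand) (use f in \<open>simp add: shorten_def\<close>)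
  also have "\<dots> = (\<Sum>b\<in>A. f b * u b x)"
    using A f finB by (intro sum.mono_neutral_right) (auto simp: shorten_def)
  finally show ?thesis .
qed

lemma column_sub_eq_iff:
  assumes A: "A \<subseteq> B"
  shows "column (sub A) x = column (sub A) y \<longleftrightarrow> trace A x = trace A y"
proof
  assume "column (sub A) x = column (sub A) y"
  then show "trace A x = trace A y" using u_sub[OF A] column_eqD unfolding trace_eq_iff by metis
next
  assume "trace A x = trace A y"
  then have e: "u b x = u b y" if "b \<in> A" for b using that by (simp add: trace_eq_iff)
  show "column (sub A) x = column (sub A) y"
    unfolding column_eq_iff
  proof
    fix f assume f: "f \<in> sub A"
    have "f x = (\<Sum>b\<in>A. f b * u b x)" by (rule expand_sub[OF A f])
    also have "\<dots> = (\<Sum>b\<in>A. f b * u b y)" by (rule sum.cong) (simp_all add: e)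
    also have "\<dots> = f y" by (rule expand_sub[OF A f, symmetric])
    finally show "f x = f y" .
  qed
qed

lemma card_column_sub:
  assumes A: "A \<subseteq> B" and K: "finite K"
  shows "card (column (sub A) ` K) = card (trace A ` K)"
  by (rule antisym; rule card_image_le_card_image[OF K]) (simp_all add: column_sub_eq_iff[OF A])

text \<open>The summand 1 pays for the zero column, which \<open>points\<close> leaves out.\<close>

lemma card_trace_le:
  assumes A: "A \<subseteq> B" and sparse: "points E (sub A) \<le> \<Lambda> * card A" and K: "K \<subseteq> Y"
  shows "card (trace A ` K) \<le> \<Lambda> * card A + 1"
proof -
  have fE: "finite E" by (rule linear_code_finite_ground[OF code])
  have "card (trace A ` K) = card (column (sub A) ` K)"
    by (rule card_column_sub[OF A, symmetric]) (use K finY finite_subset in blast)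
  also have "\<dots> \<le> card (insert (\<lambda>_. 0) (column (sub A) ` E - {\<lambda>_. 0}))"
    using K fE by (intro card_mono) (auto simp: Y_def)
  also have "\<dots> \<le> points E (sub A) + 1"
    using fE unfolding points_def by (subst card_insert_if) auto
  finally show ?thesis using sparse by simp
qed

text \<open>Two columns that differ, within \<open>A\<close>, in row \<open>a\<close> alone form an
  edge labelled by the basis element \<open>a\<close>. Too many edges would produce a core with
  label set \<open>D\<close>. Its columns agree on the rows outside \<open>D\<close>, so sparsity
  allows at most \<open>\<Lambda> * card D + 1\<close> different ones, and the rank bound then spans
  \<open>D\<close> by at most half as many elements. This is absurd, as \<open>D\<close> is part of
  a basis.\<close>

lemma one_inclusion:
  assumes A: "A \<subseteq> B" and sparse: "\<And>A'. A' \<subseteq> B \<Longrightarrow> points E (sub A') \<le> \<Lambda> * card A'"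
    and M: "\<And>a p. a \<in> A \<Longrightarrow> p \<in> M a \<Longrightarrow> fst p \<in> Y \<and> snd p \<in> Y \<and>
        trace (A - {a}) (fst p) = trace (A - {a}) (snd p) \<and> u a (fst p) \<noteq> u a (snd p)"
    and matching: "\<And>a p p'. a \<in> A \<Longrightarrow> p \<in> M a \<Longrightarrow> p' \<in> M a \<Longrightarrow>
        {fst p, snd p} \<inter> {fst p', snd p'} \<noteq> {} \<Longrightarrow> p = p'"
  shows "(\<Sum>a\<in>A. card (M a)) \<le> 4 * (\<Lambda> + 1) * (16 + 2 * CARD('k)) * card Y"
proof (rule ccontr)
  let ?q = "CARD('k)"
  define m where "m = \<Lambda> + 1"
  \<comment> \<open>The core has at most \<open>m * card D\<close> different columns. With weight
    \<open>4 * m\<close> the right-hand side of the rank bound is at most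
    \<open>m * (16 + 2 * q) * card D\<close>, and the factor 4 in front makes \<open>R\<close>, like
    \<open>L\<close>, at most a quarter of \<open>D\<close>.\<close>
  define \<alpha> where "\<alpha> = 4 * m * (16 + 2 * ?q)"
  assume "\<not> ?thesis"
  then have big: "\<alpha> * card Y < (\<Sum>a\<in>A. card (M a))" by (simp add: \<alpha>_def m_def)
  have fA: "finite A" using A finB finite_subset by blast
  have "M a \<subseteq> Y \<times> Y" if "a \<in> A" for a using M[OF that] by (auto simp: mem_Times_iff)
  then have fM: "finite (M a)" if "a \<in> A" for a using that finY finite_subset by blast
  define W where "W = (SIGMA a:A. M a)"
  have fW: "finite W" using fA fM by (auto simp: W_def)
  have cW: "card W = (\<Sum>a\<in>A. card (M a))" using fA fM by (simp add: W_def card_SigmaI)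
  define al where "al w = fst (snd w)" for w :: "'a \<times> 'a \<times> 'a"
  define bl where "bl w = snd (snd w)" for w :: "'a \<times> 'a \<times> 'a"
  have Wd: "fst w \<in> A" "al w \<in> Y" "bl w \<in> Y" "trace (A - {fst w}) (al w) = trace (A - {fst w}) (bl w)"
    "u (fst w) (al w) \<noteq> u (fst w) (bl w)" if "w \<in> W" for w
    using that M[of "fst w" "snd w"] by (auto simp: W_def al_def bl_def)
  have "W \<noteq> {}" using big cW by auto
  then have "Y \<noteq> {}" using Wd(2) by blast
  moreover have "\<alpha> * card Y \<le> 1 * card {w \<in> W. al w \<in> Y \<and> bl w \<in> Y}"
  proof -
    have "{w \<in> W. al w \<in> Y \<and> bl w \<in> Y} = W" using Wd(2,3) by blast
    then show ?thesis using big cW by simp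
  qed
  moreover have \<alpha>0: "0 < \<alpha>" by (simp add: \<alpha>_def m_def)
  moreover have "\<exists>c. c \<noteq> 0 \<and> (\<forall>f\<in>sub A. f (bl w) = f (al w) + c * f (fst w))" if w: "w \<in> W" for w
  proof (intro exI conjI ballI)
    let ?a = "fst w"
    show "u ?a (bl w) - u ?a (al w) \<noteq> 0" using Wd(5)[OF w] by simp
    fix f assume f: "f \<in> sub A"
    have e: "u b (al w) = u b (bl w)" if "b \<in> A - {?a}" for b
      using Wd(4)[OF w] that by (simp add: trace_eq_iff)
    have s: "f x = f ?a * u ?a x + (\<Sum>b\<in>A - {?a}. f b * u b x)" for x
      using expand_sub[OF A f, of x] sum.remove[OF fA Wd(1)[OF w], of "\<lambda>b. f b * u b x"] by simp
    have "(\<Sum>b\<in>A - {?a}. f b * u b (bl w)) = (\<Sum>b\<in>A - {?a}. f b * u b (al w))"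
      by (rule sum.cong) (simp_all add: e)
    then show "f (bl w) = f (al w) + (u ?a (bl w) - u ?a (al w)) * f ?a"
      using s[of "bl w"] s[of "al w"] by (simp add: algebra_simps)
  qed
  moreover have "w = w'"
    if w: "w \<in> W" "w' \<in> W" "fst w = fst w'" and meet: "{al w, bl w} \<inter> {al w', bl w'} \<noteq> {}" for w w'
  proof -
    have "snd w = snd w'"
      by (rule matching[of "fst w"]) (use w meet Wd(1) in \<open>auto simp: W_def al_def bl_def\<close>)
    then show ?thesis using w(3) by (simp add: prod_eq_iff)
  qed
  ultimately have "\<exists>K\<subseteq>Y. \<exists>WK\<subseteq>W. K \<noteq> {} \<and> \<alpha> * card K \<le> 1 * card WK \<and>
    (\<forall>x\<in>K. \<alpha> \<le> 1 * card (labels (sub A) (fst ` WK) K x)) \<and>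
    (\<forall>g\<in>sub A. (\<forall>x\<in>K. g x = 0) \<longrightarrow> (\<forall>e\<in>fst ` WK. g e = 0)) \<and>
    (\<forall>g\<in>sub A. (\<forall>e\<in>fst ` WK. g e = 0) \<longrightarrow> (\<forall>x\<in>K. \<forall>y\<in>K. g x = g y))"
    by (intro labelled_core[where al = al and bl = bl] finY fW)
  then obtain K WK where K: "K \<subseteq> Y" "K \<noteq> {}" and WKW: "WK \<subseteq> W" and Kd: "\<alpha> * card K \<le> 1 * card WK"
    and Kdeg: "\<forall>x\<in>K. \<alpha> \<le> 1 * card (labels (sub A) (fst ` WK) K x)"
    and span: "\<forall>g\<in>sub A. (\<forall>x\<in>K. g x = 0) \<longrightarrow> (\<forall>e\<in>fst ` WK. g e = 0)"
    and const: "\<forall>g\<in>sub A. (\<forall>e\<in>fst ` WK. g e = 0) \<longrightarrow> (\<forall>x\<in>K. \<forall>y\<in>K. g x = g y)"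
    by (elim exE conjE) (rule that)
  define D where "D = fst ` WK"
  have fK: "finite K" using K(1) finY finite_subset by blast
  have DA: "D \<subseteq> A" using Wd(1) WKW by (auto simp: D_def)
  then have DB: "D \<subseteq> B" using A by blast
  have fD: "finite D" using DA fA finite_subset by blast
  have "0 < \<alpha> * card K" using \<alpha>0 K(2) fK by (simp add: card_gt_0_iff)
  then have "0 < card WK" using Kd by linarith
  then have D0: "0 < card D" using fD by (auto simp: D_def card_gt_0_iff)
  have deg: "\<alpha> \<le> card (labels (sub A) D K x)" if "x \<in> K" for x
    using bspec[OF Kdeg that] by (simp add: D_def)
  have inj: "inj_on (column (sub A)) D"
  proof (rule inj_onI)
    fix x y assume x: "x \<in> D" and y: "y \<in> D" and eq: "column (sub A) x = column (sub A) y"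
    have "u x x = u x y" by (rule column_eqD[OF eq u_sub[OF A]]) (use x DA in blast)
    moreover have "x \<in> B" "y \<in> B" using x y DB by auto
    ultimately show "x = y" by (simp add: u_dual split: if_splits)
  qed
  from rank_bound[OF fK fD inj deg, of "4 * m"] obtain L R where LR: "L \<subseteq> D" "R \<subseteq> K"
    "\<forall>g\<in>sub A. (\<forall>z\<in>L \<union> R. g z = 0) \<longrightarrow> (\<forall>x\<in>K. g x = 0)"
    "4 * m * card L \<le> card (column (sub A) ` K)"
    "\<alpha> * card R \<le> 4 * (4 * m) * card D + 2 * ?q * card (column (sub A) ` K)"
    by blast
  \<comment> \<open>The word \<open>u b\<close> vanishes on all of \<open>B\<close> except
    \<open>b\<close>, hence on the labels, and such words are constant on the core.\<close>
  have off: "u b x = u b y" if b: "b \<in> A" "b \<notin> D" and x: "x \<in> K" and y: "y \<in> K" for b x y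
  proof -
    have "u b e = 0" if "e \<in> D" for e
    proof -
      have "b \<in> B" "e \<in> B" "e \<noteq> b" using b A DB that by auto
      then show ?thesis by (simp add: u_dual)
    qed
    then have "\<forall>e\<in>D. u b e = 0" by blast
    then show ?thesis using bspec[OF const u_sub[OF A b(1)]] x y unfolding D_def by blast
  qed
  have "card (column (sub A) ` K) = card (trace A ` K)" by (rule card_column_sub[OF A fK])
  also have "\<dots> \<le> card (trace D ` K)"
  proof (rule card_image_le_card_image[OF fK])
    fix x y assume xy: "x \<in> K" "y \<in> K" "trace D x = trace D y"
    have "u b x = u b y" if "b \<in> A" for b
      using xy off[of b x y] that by (cases "b \<in> D") (auto simp: trace_eq_iff)
    then show "trace A x = trace A y" by (simp add: trace_eq_iff)
  qed
  also have "\<dots> \<le> \<Lambda> * card D + 1" by (rule card_trace_le[OF DB sparse[OF DB] K(1)])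
  also have "\<dots> \<le> m * card D" using D0 by (simp add: m_def)
  finally have cK: "card (column (sub A) ` K) \<le> m * card D" .
  have m0: "0 < m" by (simp add: m_def)
  have "m * (4 * card L) = 4 * m * card L" by (simp only: ac_simps)
  then have "m * (4 * card L) \<le> m * card D" using LR(4) cK by linarith
  then have cL: "4 * card L \<le> card D" using m0 by (simp only: mult_le_cancel1 simp_thms)
  have "2 * ?q * card (column (sub A) ` K) \<le> 2 * ?q * (m * card D)" by (rule mult_le_mono2[OF cK])
  moreover have "4 * (4 * m) * card D + 2 * ?q * (m * card D) = m * (16 + 2 * ?q) * card D"
    by (simp add: algebra_simps)
  ultimately have "\<alpha> * card R \<le> m * (16 + 2 * ?q) * card D" using LR(5) by linarith
  moreover have "\<alpha> * card R = m * (16 + 2 * ?q) * (4 * card R)" unfolding \<alpha>_def by (simp only: ac_simps)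
  ultimately have "m * (16 + 2 * ?q) * (4 * card R) \<le> m * (16 + 2 * ?q) * card D" by simp
  moreover have "0 < m * (16 + 2 * ?q)" using m0 by simp
  ultimately have cR: "4 * card R \<le> card D" by (simp only: mult_le_cancel1 simp_thms)
  have CA: "linear_code E (sub A)" by (rule linear_code_shorten[OF code])
  have fLR: "finite (L \<union> R)" using LR(1,2) fD fK finite_subset by blast
  have "card (puncture D (sub A)) \<le> ?q ^ card (L \<union> R)"
    by (rule card_puncture_le[OF CA fLR]) (use LR(3) span in \<open>unfold D_def, blast\<close>)
  moreover have "shattered (puncture D (sub A)) D"
    unfolding shattered_def
  proof
    fix h
    define g where "g = (\<lambda>x. \<Sum>b\<in>D. h b * u b x)"
    have "g \<in> sub A" unfolding g_def
      by (intro linear_code_sum[OF CA fD] u_sub[OF A]) (use DA in blast)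
    then have "(\<lambda>x. if x \<in> D then g x else 0) \<in> puncture D (sub A)" by (auto simp: puncture_def)
    moreover have "g x = h x" if x: "x \<in> D" for x
    proof -
      have "g x = (\<Sum>b\<in>D. if b = x then h x else 0)"
        unfolding g_def
      proof (rule sum.cong)
        fix b assume "b \<in> D"
        then have "b \<in> B" "x \<in> B" using x DB by auto
        then show "h b * u b x = (if b = x then h x else 0)" by (auto simp: u_dual)
      qed simp
      then show ?thesis using x fD by simp
    qed
    ultimately show "\<exists>g\<in>puncture D (sub A). \<forall>x\<in>D. g x = h x" by (rule_tac bexI) auto
  qed
  then have "?q ^ card D \<le> card (puncture D (sub A))"
    by (rule power_le_card_shattered[OF linear_code_puncture[OF CA fD] fD])
  ultimately have "?q ^ card D \<le> ?q ^ card (L \<union> R)" by linarith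
  then have "card D \<le> card (L \<union> R)" using two_le_card_field[where 'k='k] by (simp add: power_le_imp_le_exp)
  also have "\<dots> \<le> card L + card R" by (rule card_Un_le)
  finally show False using cL cR D0 by linarith
qed

section \<open>Pairs of columns separated by one further row\<close>

definition "conflicts A a = {(x, y). x \<in> Y \<and> y \<in> Y \<and> trace A x = trace A y \<and> u a x \<noteq> u a y}"

text \<open>A choice fixed once for each \<open>A\<close> and \<open>a\<close>, so that the same
  matching can be counted from below over the \<open>a\<close> outside \<open>A\<close> and from
  above inside the enlarged set.\<close>

definition matching :: "'a set \<Rightarrow> 'a \<Rightarrow> ('a \<times> 'a) set" where
  "matching A a = (SOME M. M \<subseteq> conflicts A a \<and>
    (\<forall>p\<in>M. \<forall>p'\<in>M. {fst p, snd p} \<inter> {fst p', snd p'} \<noteq> {} \<longrightarrow> p = p') \<and>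
    (\<forall>(x, y)\<in>conflicts A a. x \<in> fst ` M \<union> snd ` M \<or> y \<in> fst ` M \<union> snd ` M))"

lemma matching:
  shows "p \<in> matching A a \<Longrightarrow> fst p \<in> Y \<and> snd p \<in> Y \<and> trace A (fst p) = trace A (snd p) \<and> u a (fst p) \<noteq> u a (snd p)"
    and "p \<in> matching A a \<Longrightarrow> p' \<in> matching A a \<Longrightarrow> {fst p, snd p} \<inter> {fst p', snd p'} \<noteq> {} \<Longrightarrow> p = p'"
    and "(x, y) \<in> conflicts A a \<Longrightarrow>
       x \<in> fst ` matching A a \<union> snd ` matching A a \<or> y \<in> fst ` matching A a \<union> snd ` matching A a"
proof -
  have "finite (conflicts A a)" by (rule finite_subset[of _ "Y \<times> Y"]) (auto simp: finY conflicts_def)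
  then have "\<exists>M\<subseteq>conflicts A a. (\<forall>p\<in>M. \<forall>p'\<in>M. {fst p, snd p} \<inter> {fst p', snd p'} \<noteq> {} \<longrightarrow> p = p') \<and>
    (\<forall>(x, y)\<in>conflicts A a. x \<in> fst ` M \<union> snd ` M \<or> y \<in> fst ` M \<union> snd ` M)"
    by (rule maximal_matching) (auto simp: conflicts_def)
  note M = someI_ex[OF this, folded matching_def]
  show "p \<in> matching A a \<Longrightarrow> fst p \<in> Y \<and> snd p \<in> Y \<and> trace A (fst p) = trace A (snd p) \<and> u a (fst p) \<noteq> u a (snd p)"
    using M by (auto simp: conflicts_def)
  show "p \<in> matching A a \<Longrightarrow> p' \<in> matching A a \<Longrightarrow> {fst p, snd p} \<inter> {fst p', snd p'} \<noteq> {} \<Longrightarrow> p = p'"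
    by (rule M[THEN conjunct2, THEN conjunct1, THEN bspec, THEN bspec, THEN mp])
  show "(x, y) \<in> conflicts A a \<Longrightarrow>
       x \<in> fst ` matching A a \<union> snd ` matching A a \<or> y \<in> fst ` matching A a \<union> snd ` matching A a"
    using M by auto
qed

lemma finite_matching: "finite (matching A a)"
proof (rule finite_subset)
  show "matching A a \<subseteq> Y \<times> Y" using matching(1) by (auto simp: mem_Times_iff)
qed (simp add: finY)

text \<open>Every pair of columns in a class that differ at \<open>a\<close> meets the matching; weighting each column by
  the inverse size of its class, a column accounts for a total weight of at most 1.\<close>

lemma matching_lower_bound:
  defines "cls \<equiv> (\<lambda>A x. {y \<in> Y. trace A y = trace A x})"
  shows "(\<Sum>x\<in>Y. real (card {y \<in> cls A x. u a y \<noteq> u a x}) / real (card (cls A x))) \<le> 4 * real (card (matching A a))"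
proof -
  define w where "w x = 1 / real (card (cls A x))" for x
  define G where "G = (SIGMA x:Y. {y \<in> cls A x. u a y \<noteq> u a x})"
  define V where "V = fst ` matching A a \<union> snd ` matching A a"
  have fcls: "finite (cls A x)" for x using finY by (simp add: cls_def)
  have fV: "finite V" using finite_matching by (simp add: V_def)
  have VY: "V \<subseteq> Y" using matching(1) by (auto simp: V_def)
  have "card V \<le> card (fst ` matching A a) + card (snd ` matching A a)" unfolding V_def by (rule card_Un_le)
  also have "\<dots> \<le> card (matching A a) + card (matching A a)"
    by (intro add_mono card_image_le finite_matching)
  finally have cV: "card V \<le> 2 * card (matching A a)" by simp
  have fG: "finite G" using finY fcls by (auto simp: G_def)
  have row: "(\<Sum>p\<in>{p \<in> G. fst p = v}. w (fst p)) \<le> 1" if v: "v \<in> V" for v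
  proof -
    have "{p \<in> G. fst p = v} = Pair v ` {y \<in> cls A v. u a y \<noteq> u a v}"
      using v VY by (auto simp: G_def)
    then have "card {p \<in> G. fst p = v} \<le> card (cls A v)"
      using fcls by (simp add: card_image inj_on_def) (auto intro: card_mono)
    moreover have "(\<Sum>p\<in>{p \<in> G. fst p = v}. w (fst p)) = real (card {p \<in> G. fst p = v}) * w v"
      by simp
    ultimately show ?thesis by (simp add: w_def divide_le_eq)
  qed
  \<comment> \<open>Both entries of a pair lie in the same class, so they carry the same
    weight.\<close>
  have swap: "(\<Sum>p\<in>{p \<in> G. snd p = v}. w (fst p)) = (\<Sum>p\<in>{p \<in> G. fst p = v}. w (fst p))" for v
  proof (rule sum.reindex_bij_witness[of _ prod.swap prod.swap])
    fix p assume "p \<in> {p \<in> G. snd p = v}"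
    then have "cls A (fst p) = cls A (snd p)" by (auto simp: G_def cls_def)
    then show "w (fst (prod.swap p)) = w (fst p)" by (simp add: w_def)
  qed (auto simp: G_def cls_def)
  have "(\<Sum>x\<in>Y. real (card {y \<in> cls A x. u a y \<noteq> u a x}) / real (card (cls A x))) = (\<Sum>x\<in>Y. \<Sum>y\<in>{y \<in> cls A x. u a y \<noteq> u a x}. w x)"
    by (simp add: w_def)
  also have "\<dots> = (\<Sum>p\<in>G. w (fst p))"
    unfolding G_def using finY fcls by (subst sum.Sigma) (auto simp: case_prod_beta)
  also have "\<dots> \<le> (\<Sum>p\<in>{p \<in> G. fst p \<in> V}. w (fst p)) + (\<Sum>p\<in>{p \<in> G. snd p \<in> V}. w (fst p))"
  proof -
    have "fst p \<in> V \<or> snd p \<in> V" if "p \<in> G" for p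
      unfolding V_def by (rule matching(3)) (use that in \<open>auto simp: G_def cls_def conflicts_def\<close>)
    then have "G = {p \<in> G. fst p \<in> V} \<union> {p \<in> G. snd p \<in> V}" by blast
    moreover have "0 \<le> (\<Sum>p\<in>{p \<in> G. fst p \<in> V} \<inter> {p \<in> G. snd p \<in> V}. w (fst p))"
      by (rule sum_nonneg) (simp add: w_def)
    ultimately show ?thesis
      using sum.union_inter[of "{p \<in> G. fst p \<in> V}" "{p \<in> G. snd p \<in> V}" "\<lambda>p. w (fst p)"] fG by simp
  qed
  also have "(\<Sum>p\<in>{p \<in> G. fst p \<in> V}. w (fst p)) + (\<Sum>p\<in>{p \<in> G. snd p \<in> V}. w (fst p)) =
      (\<Sum>v\<in>V. (\<Sum>p\<in>{p \<in> G. fst p = v}. w (fst p)) + (\<Sum>p\<in>{p \<in> G. snd p = v}. w (fst p)))"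
  proof -
    have "(\<Sum>p\<in>{p \<in> G. \<pi> p \<in> V}. w (fst p)) = (\<Sum>v\<in>V. \<Sum>p\<in>{p \<in> G. \<pi> p = v}. w (fst p))" for \<pi>
    proof -
      have "(\<Sum>p\<in>{p \<in> G. \<pi> p \<in> V}. w (fst p)) = (\<Sum>v\<in>V. \<Sum>p\<in>{p \<in> {p \<in> G. \<pi> p \<in> V}. \<pi> p = v}. w (fst p))"
        by (rule sum.group[symmetric]) (use fG fV in auto)
      also have "\<dots> = (\<Sum>v\<in>V. \<Sum>p\<in>{p \<in> G. \<pi> p = v}. w (fst p))"
        by (intro sum.cong refl) auto
      finally show ?thesis .
    qed
    then show ?thesis by (simp only: sum.distrib)
  qed
  also have "\<dots> \<le> (\<Sum>v\<in>V. 2)"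
  proof (rule sum_mono)
    fix v assume "v \<in> V"
    then have "(\<Sum>p\<in>{p \<in> G. fst p = v}. w (fst p)) \<le> 1" by (rule row)
    then show "(\<Sum>p\<in>{p \<in> G. fst p = v}. w (fst p)) + (\<Sum>p\<in>{p \<in> G. snd p = v}. w (fst p)) \<le> 2"
      unfolding swap by linarith
  qed
  also have "\<dots> = 2 * real (card V)" by simp
  also have "\<dots> \<le> 4 * real (card (matching A a))" using cV by simp
  finally show ?thesis .
qed

text \<open>A column whose class has \<open>n\<close> members differs from each of the
  \<open>n - 1\<close> others in at least \<open>k\<close> rows, all outside \<open>A\<close>. After
  division by \<open>n\<close> and summation over \<open>Y\<close>, the terms \<open>1 / n\<close>
  add up to the number of classes.\<close>

lemma sum_matching_lower_bound:
  assumes A: "A \<subseteq> B"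
    and far: "\<And>x y. x \<in> Y \<Longrightarrow> y \<in> Y \<Longrightarrow> x \<noteq> y \<Longrightarrow> k \<le> card {b \<in> B. u b x \<noteq> u b y}"
  shows "real k * (real (card Y) - real (card (trace A ` Y))) \<le> 4 * (\<Sum>a\<in>B - A. real (card (matching A a)))"
proof -
  define cls where "cls x = {y \<in> Y. trace A y = trace A x}" for x
  have fcls: "finite (cls x)" for x using finY by (simp add: cls_def)
  have pos: "0 < card (cls x)" if "x \<in> Y" for x using that fcls by (auto simp: card_gt_0_iff cls_def)
  have row: "real k * (1 - 1 / real (card (cls x))) \<le>
      (\<Sum>a\<in>B - A. real (card {y \<in> cls x. u a y \<noteq> u a x}) / real (card (cls x)))" if x: "x \<in> Y" for x
  proof -
    have "(\<Sum>y\<in>cls x - {x}. k) \<le> (\<Sum>y\<in>cls x - {x}. card {a \<in> B - A. u a y \<noteq> u a x})"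
    proof (rule sum_mono)
      fix y assume y: "y \<in> cls x - {x}"
      then have "u b y = u b x" if "b \<in> A" for b using that by (simp add: cls_def trace_eq_iff)
      then have "{a \<in> B - A. u a y \<noteq> u a x} = {a \<in> B. u a y \<noteq> u a x}" by auto
      then show "k \<le> card {a \<in> B - A. u a y \<noteq> u a x}" using far[of y x] x y by (simp add: cls_def)
    qed
    also have "\<dots> \<le> (\<Sum>y\<in>cls x. card {a \<in> B - A. u a y \<noteq> u a x})"
      by (rule sum_mono2) (auto simp: fcls)
    also have "\<dots> = (\<Sum>a\<in>B - A. card {y \<in> cls x. u a y \<noteq> u a x})"
      by (rule sum_multicount_gen) (use fcls finB in auto)
    finally have "k * (card (cls x) - 1) \<le> (\<Sum>a\<in>B - A. card {y \<in> cls x. u a y \<noteq> u a x})"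
      using x by (simp add: cls_def[of x] mult.commute)
    then have "real (k * (card (cls x) - 1)) \<le> real (\<Sum>a\<in>B - A. card {y \<in> cls x. u a y \<noteq> u a x})"
      by (simp only: of_nat_le_iff)
    then have "real k * (real (card (cls x)) - 1) \<le> (\<Sum>a\<in>B - A. real (card {y \<in> cls x. u a y \<noteq> u a x}))"
      using pos[OF x] by (simp add: of_nat_diff)
    then have "real k * (real (card (cls x)) - 1) / real (card (cls x)) \<le> (\<Sum>a\<in>B - A. real (card {y \<in> cls x. u a y \<noteq> u a x})) / real (card (cls x))"
      by (rule divide_right_mono) simp
    then show ?thesis using pos[OF x] by (simp add: sum_divide_distrib field_simps)
  qed
  have tr: "(\<Sum>x\<in>Y. 1 / real (card (cls x))) = real (card (trace A ` Y))"
  proof -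
    have "(\<Sum>x\<in>Y. 1 / real (card (cls x))) = (\<Sum>v\<in>trace A ` Y. \<Sum>x\<in>{x \<in> Y. trace A x = v}. 1 / real (card (cls x)))"
      by (rule sum.image_gen[OF finY])
    also have "\<dots> = (\<Sum>v\<in>trace A ` Y. 1)"
    proof (rule sum.cong)
      fix v assume "v \<in> trace A ` Y"
      then obtain z where z: "z \<in> Y" "v = trace A z" by blast
      have "cls x = {x \<in> Y. trace A x = v}" if "x \<in> {x \<in> Y. trace A x = v}" for x
        using that by (auto simp: cls_def)
      then have "(\<Sum>x\<in>{x \<in> Y. trace A x = v}. 1 / real (card (cls x))) = (\<Sum>x\<in>{x \<in> Y. trace A x = v}. 1 / real (card {x \<in> Y. trace A x = v}))"
        by (intro sum.cong) simp_all
      also have "\<dots> = 1" using pos[OF z(1)] z(2) by (simp add: cls_def)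
      finally show "(\<Sum>x\<in>{x \<in> Y. trace A x = v}. 1 / real (card (cls x))) = 1" .
    qed simp
    finally show ?thesis by simp
  qed
  have "real k * (real (card Y) - real (card (trace A ` Y))) = (\<Sum>x\<in>Y. real k * (1 - 1 / real (card (cls x))))"
    using tr by (simp add: sum_distrib_left[symmetric] sum_subtractf)
  also have "\<dots> \<le> (\<Sum>x\<in>Y. \<Sum>a\<in>B - A. real (card {y \<in> cls x. u a y \<noteq> u a x}) / real (card (cls x)))"
    by (rule sum_mono) (rule row)
  also have "\<dots> = (\<Sum>a\<in>B - A. \<Sum>x\<in>Y. real (card {y \<in> cls x. u a y \<noteq> u a x}) / real (card (cls x)))"
    by (rule sum.swap)
  also have "\<dots> \<le> (\<Sum>a\<in>B - A. 4 * real (card (matching A a)))"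
    by (rule sum_mono) (use matching_lower_bound[of A] in \<open>simp add: cls_def\<close>)
  also have "\<dots> = 4 * (\<Sum>a\<in>B - A. real (card (matching A a)))" by (simp only: sum_distrib_left)
  finally show ?thesis .
qed

text \<open>Haussler's packing argument: the pairs \<open>(A, a)\<close> with \<open>a \<in> A\<close>, \<open>card A = T\<close> correspond to the pairs
  \<open>(A - {a}, a)\<close>.\<close>

lemma packing:
  assumes sparse: "\<And>A. A \<subseteq> B \<Longrightarrow> points E (sub A) \<le> \<Lambda> * card A"
    and far: "\<And>x y. x \<in> Y \<Longrightarrow> y \<in> Y \<Longrightarrow> x \<noteq> y \<Longrightarrow> k \<le> card {b \<in> B. u b x \<noteq> u b y}"
    and T: "0 < T" "T \<le> card B" and \<Lambda>: "0 < \<Lambda>"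
  shows "real T * real k * (real (card Y) - real \<Lambda> * real T) \<le>
    16 * (real \<Lambda> + 1) * (16 + 2 * real CARD('k)) * real (card B) * real (card Y)"
proof -
  define r where "r = card B"
  define \<alpha> where "\<alpha> = 4 * (\<Lambda> + 1) * (16 + 2 * CARD('k)) * card Y"
  define S where "S j = {A. A \<subseteq> B \<and> card A = j}" for j
  have fS: "finite (S j)" for j using finB by (simp add: S_def)
  have cS: "card (S j) = r choose j" for j unfolding S_def r_def by (rule n_subsets[OF finB])
  have fin: "finite A" if "A \<subseteq> B" for A using that finB finite_subset by blast
  let ?m = "\<lambda>A a. real (card (matching A a))"
  have upper: "(\<Sum>a\<in>A. ?m (A - {a}) a) \<le> real \<alpha>" if A: "A \<subseteq> B" for A
  proof -
    have "(\<Sum>a\<in>A. card (matching (A - {a}) a)) \<le> \<alpha>"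
      unfolding \<alpha>_def
    proof (rule one_inclusion[OF A])
      fix a p assume "a \<in> A" "p \<in> matching (A - {a}) a"
      then show "fst p \<in> Y \<and> snd p \<in> Y \<and> trace (A - {a}) (fst p) = trace (A - {a}) (snd p) \<and> u a (fst p) \<noteq> u a (snd p)"
        by (intro matching(1))
    next
      fix a p p' assume "a \<in> A" "p \<in> matching (A - {a}) a" "p' \<in> matching (A - {a}) a"
        "{fst p, snd p} \<inter> {fst p', snd p'} \<noteq> {}"
      then show "p = p'" by (intro matching(2))
    qed (rule sparse)
    then show ?thesis by (simp only: of_nat_sum[symmetric] of_nat_le_iff)
  qed
  have "(r choose (T - 1)) * (real k * (real (card Y) - real \<Lambda> * real T)) = (\<Sum>A\<in>S (T - 1). real k * (real (card Y) - real \<Lambda> * real T))"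
    by (simp add: cS)
  also have "\<dots> \<le> (\<Sum>A\<in>S (T - 1). 4 * (\<Sum>a\<in>B - A. ?m A a))"
  proof (rule sum_mono)
    fix A assume "A \<in> S (T - 1)"
    then have A: "A \<subseteq> B" "card A = T - 1" by (auto simp: S_def)
    \<comment> \<open>\<open>A\<close> has \<open>T - 1\<close> elements, so the positive
      \<open>\<Lambda>\<close> absorbs the zero column and the bound becomes
      \<open>\<Lambda> * T\<close>.\<close>
    have "card (trace A ` Y) \<le> \<Lambda> * card A + 1" by (rule card_trace_le[OF A(1) sparse[OF A(1)]]) simp
    also have "\<dots> \<le> \<Lambda> * card A + \<Lambda>" using \<Lambda> by simp
    also have "\<dots> = \<Lambda> * T" using A(2) T(1) by (cases T) simp_all
    finally have "real (card (trace A ` Y)) \<le> real \<Lambda> * real T" by (simp only: of_nat_mult[symmetric] of_nat_le_iff)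
    then have "real k * (real (card Y) - real \<Lambda> * real T) \<le> real k * (real (card Y) - real (card (trace A ` Y)))"
      by (intro mult_left_mono) simp_all
    also have "\<dots> \<le> 4 * (\<Sum>a\<in>B - A. ?m A a)" by (rule sum_matching_lower_bound[OF A(1) far])
    finally show "real k * (real (card Y) - real \<Lambda> * real T) \<le> 4 * (\<Sum>a\<in>B - A. ?m A a)" .
  qed
  also have "\<dots> = 4 * (\<Sum>A\<in>S (T - 1). \<Sum>a\<in>B - A. ?m A a)" by (simp only: sum_distrib_left)
  also have "(\<Sum>A\<in>S (T - 1). \<Sum>a\<in>B - A. ?m A a) = (\<Sum>p\<in>(SIGMA A:S (T - 1). B - A). ?m (fst p) (snd p))"
    using fS finB by (subst sum.Sigma) (auto simp: case_prod_beta)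
  also have "\<dots> = (\<Sum>p\<in>(SIGMA A:S T. A). ?m (fst p - {snd p}) (snd p))"
  proof (rule sum.reindex_bij_witness[of _ "\<lambda>(A, a). (A - {a}, a)" "\<lambda>(A, a). (insert a A, a)"])
    fix p assume "p \<in> (SIGMA A:S (T - 1). B - A)"
    then obtain A a where p: "p = (A, a)" "A \<subseteq> B" "card A = T - 1" "a \<in> B" "a \<notin> A" by (auto simp: S_def)
    show "(\<lambda>(A, a). (A - {a}, a)) ((\<lambda>(A, a). (insert a A, a)) p) = p" using p by simp
    show "(\<lambda>(A, a). (insert a A, a)) p \<in> (SIGMA A:S T. A)"
      using p fin[OF p(2)] T(1) by (simp add: S_def)
    show "?m (fst ((\<lambda>(A, a). (insert a A, a)) p) - {snd ((\<lambda>(A, a). (insert a A, a)) p)}) (snd ((\<lambda>(A, a). (insert a A, a)) p)) = ?m (fst p) (snd p)"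
      using p by simp
  next
    fix p assume "p \<in> (SIGMA A:S T. A)"
    then obtain A a where p: "p = (A, a)" "A \<subseteq> B" "card A = T" "a \<in> A" by (auto simp: S_def)
    show "(\<lambda>(A, a). (insert a A, a)) ((\<lambda>(A, a). (A - {a}, a)) p) = p" using p by (simp add: insert_absorb)
    show "(\<lambda>(A, a). (A - {a}, a)) p \<in> (SIGMA A:S (T - 1). B - A)"
      using p fin[OF p(2)] by (auto simp: S_def)
  qed
  also have "\<dots> = (\<Sum>A\<in>S T. \<Sum>a\<in>A. ?m (A - {a}) a)"
    using fS fin by (subst sum.Sigma) (auto simp: case_prod_beta S_def)
  also have "4 * \<dots> \<le> 4 * (\<Sum>A\<in>S T. real \<alpha>)"
    by (intro mult_left_mono sum_mono upper) (auto simp: S_def)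
  also have "\<dots> = 4 * real (r choose T) * real \<alpha>" by (simp add: cS)
  finally have main: "real (r choose (T - 1)) * (real k * (real (card Y) - real \<Lambda> * real T)) \<le> 4 * real (r choose T) * real \<alpha>" .
  \<comment> \<open>One side is summed over sets of size \<open>T - 1\<close>, the other over sets
    of size \<open>T\<close>; the ratio of their numbers is at most \<open>r / T\<close>, which
    brings in the factor \<open>card B\<close>.\<close>
  have "(r - 1) choose (T - 1) \<le> r choose (T - 1)"
    by (cases r; cases "T - 1") simp_all
  then have "T * (r choose T) \<le> r * (r choose (T - 1))"
    unfolding times_binomial_minus1_eq[OF T(1)] by (rule mult_le_mono2)
  then have "real T * real (r choose T) \<le> real r * real (r choose (T - 1))"
    by (simp only: of_nat_mult[symmetric] of_nat_le_iff)
  then have "4 * real \<alpha> * (real T * real (r choose T)) \<le> 4 * real \<alpha> * (real r * real (r choose (T - 1)))"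
    by (intro mult_left_mono) simp_all
  moreover have "real T * (real (r choose (T - 1)) * (real k * (real (card Y) - real \<Lambda> * real T))) \<le> real T * (4 * real (r choose T) * real \<alpha>)"
    using main by (rule mult_left_mono) simp
  ultimately have "real (r choose (T - 1)) * (real T * real k * (real (card Y) - real \<Lambda> * real T)) \<le> real (r choose (T - 1)) * (4 * real \<alpha> * real r)"
    by (simp add: ac_simps)
  moreover have "0 < real (r choose (T - 1))" using T by (simp add: r_def)
  ultimately have "real T * real k * (real (card Y) - real \<Lambda> * real T) \<le> 4 * real \<alpha> * real r"
    by (simp only: mult_le_cancel_left_pos)
  then show ?thesis by (simp add: \<alpha>_def r_def algebra_simps)
qed

end

section \<open>Matroids of codes\<close>

text \<open>Finite hereditary set systems: properties that pass to duals and deletions by inspection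
  and can be carried along a chain of minors.\<close>

definition wf_indep :: "'a indep_system \<Rightarrow> bool" where
  "wf_indep M \<longleftrightarrow> finite (ground M) \<and> {} \<in> indeps M \<and> (\<forall>X\<in>indeps M. X \<subseteq> ground M) \<and>
     (\<forall>X\<in>indeps M. \<forall>Y\<subseteq>X. Y \<in> indeps M)"

lemma wf_indepD:
  assumes "wf_indep M"
  shows "finite (ground M)" "{} \<in> indeps M" "X \<in> indeps M \<Longrightarrow> X \<subseteq> ground M"
    "X \<in> indeps M \<Longrightarrow> Y \<subseteq> X \<Longrightarrow> Y \<in> indeps M"
  using assms by (auto simp: wf_indep_def)

lemma indep_extends_to_basis:
  assumes wf: "wf_indep M" and X: "X \<in> indeps M"
  shows "\<exists>B. basis M B \<and> X \<subseteq> B"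
proof -
  define P where "P = {B \<in> indeps M. X \<subseteq> B}"
  have "finite P"
    using wf_indepD(1,3)[OF wf] by (rule_tac finite_subset[of _ "Pow (ground M)"]) (auto simp: P_def)
  moreover have "P \<noteq> {}" using X by (auto simp: P_def)
  ultimately obtain B where B: "B \<in> P" and mx: "\<forall>B'\<in>P. B \<subseteq> B' \<longrightarrow> B = B'"
    by (blast dest: finite_has_maximal)
  have "Z = B" if "Z \<in> indeps M" "B \<subseteq> Z" for Z
  proof -
    have "Z \<in> P" using that B by (auto simp: P_def)
    then show ?thesis using mx that(2) by blast
  qed
  then have "basis M B" using B by (auto simp: basis_def P_def)
  then show ?thesis using B by (auto simp: P_def)
qed

lemma ground_dual [simp]: "ground (dual M) = ground M"
  by (simp add: dual_def)

lemma indeps_dual: "X \<in> indeps (dual M) \<longleftrightarrow> X \<subseteq> ground M \<and> (\<exists>B. basis M B \<and> X \<inter> B = {})"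
  by (auto simp: dual_def)

lemma wf_indep_dual:
  assumes wf: "wf_indep M" shows "wf_indep (dual M)"
proof -
  obtain B where "basis M B" using indep_extends_to_basis[OF wf wf_indepD(2)[OF wf]] by blast
  then have "{} \<in> indeps (dual M)" by (auto simp: indeps_dual)
  moreover have "Y \<in> indeps (dual M)" if XY: "X \<in> indeps (dual M)" "Y \<subseteq> X" for X Y
  proof -
    obtain B where "X \<subseteq> ground M" "basis M B" "X \<inter> B = {}" using XY(1) unfolding indeps_dual by blast
    then have "Y \<subseteq> ground M" "Y \<inter> B = {}" using XY(2) by auto
    then show ?thesis using \<open>basis M B\<close> unfolding indeps_dual by blast
  qed
  moreover have "X \<subseteq> ground M" if "X \<in> indeps (dual M)" for X using that by (simp add: indeps_dual)
  ultimately show ?thesis using wf_indepD(1)[OF wf] unfolding wf_indep_def by simp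
qed

text \<open>Bases form an antichain, hence so do their complements; an antichain is the family of
  maximal members of the hereditary system that it generates.\<close>

lemma basis_dual:
  assumes wf: "wf_indep M"
  shows "basis (dual M) B' \<longleftrightarrow> (\<exists>B. basis M B \<and> B' = ground M - B)"
proof
  assume B': "basis (dual M) B'"
  then obtain B where B: "basis M B" "B' \<inter> B = {}" "B' \<subseteq> ground M"
    by (auto simp: basis_def indeps_dual)
  have "ground M - B \<in> indeps (dual M)" using B(1) by (auto simp: indeps_dual)
  moreover have "B' \<subseteq> ground M - B" using B(2,3) by blast
  ultimately have "ground M - B = B'" using B' unfolding basis_def by simp
  then show "\<exists>B. basis M B \<and> B' = ground M - B" using B(1) by blast
next
  assume "\<exists>B. basis M B \<and> B' = ground M - B"
  then obtain B where B: "basis M B" "B' = ground M - B" by blast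
  have Bg: "B \<subseteq> ground M" using B(1) wf_indepD(3)[OF wf] by (simp add: basis_def)
  have "X = B'" if X: "X \<in> indeps (dual M)" "B' \<subseteq> X" for X
  proof -
    obtain B2 where B2: "basis M B2" "X \<inter> B2 = {}" "X \<subseteq> ground M" using X(1) by (auto simp: indeps_dual)
    have "B2 \<subseteq> ground M" using B2(1) wf_indepD(3)[OF wf] by (simp add: basis_def)
    then have "B2 \<subseteq> B" using B2(2) B(2) X(2) by blast
    then have "B = B2" using B(1) B2(1) unfolding basis_def by blast
    then show ?thesis using B2(2,3) B(2) X(2) by blast
  qed
  moreover have "B' \<in> indeps (dual M)" using B by (auto simp: indeps_dual)
  ultimately show "basis (dual M) B'" by (simp add: basis_def)
qed

lemma dual_dual:
  fixes M :: "'a indep_system"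
  assumes wf: "wf_indep M" shows "dual (dual M) = M"
proof -
  have "X \<in> indeps (dual (dual M)) \<longleftrightarrow> X \<in> indeps M" for X
  proof
    assume "X \<in> indeps (dual (dual M))"
    then obtain B where "X \<subseteq> ground M" "basis M B" "X \<inter> (ground M - B) = {}"
      by (auto simp: indeps_dual basis_dual[OF wf])
    then have "B \<in> indeps M" "X \<subseteq> B" by (auto simp: basis_def)
    then show "X \<in> indeps M" by (rule wf_indepD(4)[OF wf])
  next
    assume X: "X \<in> indeps M"
    then obtain B where B: "basis M B" "X \<subseteq> B" using indep_extends_to_basis[OF wf] by blast
    then have "basis (dual M) (ground M - B)" by (auto simp: basis_dual[OF wf])
    moreover have "X \<inter> (ground M - B) = {}" using B(2) by blast
    ultimately show "X \<in> indeps (dual (dual M))"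
      using wf_indepD(3)[OF wf X] unfolding indeps_dual[of X "dual M"] ground_dual by blast
  qed
  then have "indeps (dual (dual M)) = indeps M" by blast
  then show ?thesis by (intro indep_system.equality) simp_all
qed

lemma wf_indep_deletion: "wf_indep M \<Longrightarrow> wf_indep (deletion M D)"
  unfolding wf_indep_def deletion_def by auto

lemma wf_indep_contraction: "wf_indep M \<Longrightarrow> wf_indep (contraction M D)"
  unfolding contraction_def by (intro wf_indep_dual wf_indep_deletion)

text \<open>Contraction is deletion conjugated by duality, so dualising a chain of minors exchanges
  the two kinds of steps. Well-formedness rides along because each exchange uses
  \<open>dual_dual\<close>.\<close>

lemma minor_of_dual:
  assumes "minor_of N (dual M)" and wf: "wf_indep M"
  shows "minor_of (dual N) M \<and> wf_indep N"
  using assms(1)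
proof (induction N "dual M" rule: minor_of.induct)
  case minor_refl
  show ?case using minor_of.minor_refl[of M] wf by (simp add: dual_dual wf_indep_dual)
next
  case (minor_delete N D)
  then have wfN: "wf_indep N" and m: "minor_of (dual N) M" by auto
  have "minor_of (contraction (dual N) D) M"
    by (rule minor_of.minor_contract[OF m]) (use minor_delete.hyps in simp)
  then show ?case
    using wf_indep_deletion[OF wfN] by (simp add: contraction_def dual_dual[OF wfN])
next
  case (minor_contract N D)
  then have wfN: "wf_indep N" and m: "minor_of (dual N) M" by auto
  have "minor_of (deletion (dual N) D) M"
    by (rule minor_of.minor_delete[OF m]) (use minor_contract.hyps in simp)
  then show ?case
    using wf_indep_contraction[OF wfN] wf_indep_deletion[OF wf_indep_dual[OF wfN]]
    by (simp add: contraction_def dual_dual)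
qed

lemma matroid_iso_basis:
  assumes h: "bij_betw h (ground M) (ground N)"
    and ind: "\<forall>X\<subseteq>ground M. X \<in> indeps M \<longleftrightarrow> h ` X \<in> indeps N"
    and wf: "wf_indep M" "wf_indep N" and B: "B \<subseteq> ground M"
  shows "basis M B \<longleftrightarrow> basis N (h ` B)"
proof
  have inj: "inj_on h (ground M)" and im: "h ` ground M = ground N" using h by (auto simp: bij_betw_def)
  show "basis N (h ` B)" if "basis M B"
    unfolding basis_def
  proof (intro conjI ballI impI)
    show "h ` B \<in> indeps N" using that ind B by (auto simp: basis_def)
  next
    fix X assume X: "X \<in> indeps N" "h ` B \<subseteq> X"
    have "X \<subseteq> h ` ground M" using wf_indepD(3)[OF wf(2) X(1)] im by simp
    then obtain X' where X': "X' \<subseteq> ground M" "X = h ` X'" by (auto simp: subset_image_iff)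
    then have "X' \<in> indeps M" using X(1) ind by blast
    moreover have "B \<subseteq> X'"
    proof
      fix b assume b: "b \<in> B"
      then obtain x where "x \<in> X'" "h b = h x" using X(2) X'(2) by blast
      then show "b \<in> X'" using inj_onD[OF inj, of b x] b B X'(1) by blast
    qed
    ultimately show "X = h ` B" using that X'(2) unfolding basis_def by blast
  qed
  show "basis M B" if b: "basis N (h ` B)"
    unfolding basis_def
  proof (intro conjI ballI impI)
    show "B \<in> indeps M" using b ind B by (auto simp: basis_def)
  next
    fix X assume X: "X \<in> indeps M" "B \<subseteq> X"
    have Xg: "X \<subseteq> ground M" by (rule wf_indepD(3)[OF wf(1) X(1)])
    then have "h ` X \<in> indeps N" using X(1) ind by blast
    then have "h ` X = h ` B" using b image_mono[OF X(2), of h] unfolding basis_def by blast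
    then show "X = B" using inj Xg B by (simp add: inj_on_image_eq_iff)
  qed
qed

lemma matroid_iso_dual:
  assumes iso: "matroid_iso M N" and wf: "wf_indep M" "wf_indep N"
  shows "matroid_iso (dual M) (dual N)"
proof -
  obtain h where h: "bij_betw h (ground M) (ground N)"
    and ind: "\<forall>X\<subseteq>ground M. X \<in> indeps M \<longleftrightarrow> h ` X \<in> indeps N"
    using iso by (auto simp: matroid_iso_def)
  have inj: "inj_on h (ground M)" and im: "h ` ground M = ground N" using h by (auto simp: bij_betw_def)
  have "X \<in> indeps (dual M) \<longleftrightarrow> h ` X \<in> indeps (dual N)" if X: "X \<subseteq> ground M" for X
  proof
    assume "X \<in> indeps (dual M)"
    then obtain B where B: "basis M B" "X \<inter> B = {}" by (auto simp: indeps_dual)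
    have Bg: "B \<subseteq> ground M" using B(1) wf_indepD(3)[OF wf(1)] by (simp add: basis_def)
    have "basis N (h ` B)" using matroid_iso_basis[OF h ind wf Bg] B(1) by simp
    moreover have "h ` X \<inter> h ` B = {}" using inj_on_image_Int[OF inj X Bg] B(2) by simp
    moreover have "h ` X \<subseteq> ground N" using X im by blast
    ultimately show "h ` X \<in> indeps (dual N)" unfolding indeps_dual by blast
  next
    assume "h ` X \<in> indeps (dual N)"
    then obtain B where B: "basis N B" "h ` X \<inter> B = {}" by (auto simp: indeps_dual)
    have "B \<subseteq> h ` ground M" using B(1) wf_indepD(3)[OF wf(2)] im by (simp add: basis_def)
    then obtain B' where B': "B' \<subseteq> ground M" "B = h ` B'" by (auto simp: subset_image_iff)
    then have "basis M B'" using matroid_iso_basis[OF h ind wf B'(1)] B(1) by simp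
    moreover have "X \<inter> B' = {}" using B(2) B'(2) by blast
    ultimately show "X \<in> indeps (dual M)" using X by (auto simp: indeps_dual)
  qed
  then show ?thesis unfolding matroid_iso_def using h by auto
qed

lemma has_minor_dual:
  assumes "has_minor (dual M) N" and wf: "wf_indep M" "wf_indep N"
  shows "has_minor M (dual N)"
proof -
  obtain M' where M': "minor_of M' (dual M)" "matroid_iso M' N" using assms(1) by (auto simp: has_minor_def)
  then have "minor_of (dual M') M" "wf_indep M'" using minor_of_dual[OF _ wf(1)] by auto
  moreover from this have "matroid_iso (dual M') (dual N)" using matroid_iso_dual[OF M'(2) _ wf(2)] by blast
  ultimately show ?thesis by (auto simp: has_minor_def)
qed

lemma matroid_iso_sym:
  assumes "matroid_iso M N" shows "matroid_iso N M"
proof -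
  obtain h where h: "bij_betw h (ground M) (ground N)"
    and ind: "\<forall>X\<subseteq>ground M. X \<in> indeps M \<longleftrightarrow> h ` X \<in> indeps N"
    using assms by (auto simp: matroid_iso_def)
  let ?h = "inv_into (ground M) h"
  have im: "h ` ground M = ground N" using h by (simp add: bij_betw_def)
  have "X \<in> indeps N \<longleftrightarrow> ?h ` X \<in> indeps M" if X: "X \<subseteq> ground N" for X
  proof -
    have "?h ` X \<subseteq> ground M" using X im inv_into_into[of _ h "ground M"] by blast
    then have "?h ` X \<in> indeps M \<longleftrightarrow> h ` (?h ` X) \<in> indeps N" using ind by blast
    moreover have "h ` (?h ` X) = X" using X im by (simp add: image_inv_into_cancel)
    ultimately show ?thesis by simp
  qed
  then show ?thesis unfolding matroid_iso_def using bij_betw_inv_into[OF h] by blast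
qed

section \<open>Matroids represented by codes\<close>

definition represents :: "('a \<Rightarrow> 'k::field) set \<Rightarrow> 'a indep_system \<Rightarrow> bool" where
  "represents C M \<longleftrightarrow> linear_code (ground M) C \<and> indeps M = {X. X \<subseteq> ground M \<and> shattered C X}"

lemma represents_wf:
  assumes "represents C M" shows "wf_indep M"
proof -
  have C: "linear_code (ground M) C" and ind: "indeps M = {X. X \<subseteq> ground M \<and> shattered C X}"
    using assms by (simp_all add: represents_def)
  have "{} \<in> indeps M" using linear_code_zero[OF C] by (auto simp: ind shattered_def)
  moreover have "Y \<in> indeps M" if "X \<in> indeps M" "Y \<subseteq> X" for X Y
    using that shattered_subset[of C X Y] by (auto simp: ind)
  moreover have "X \<subseteq> ground M" if "X \<in> indeps M" for X using that by (simp add: ind)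
  ultimately show ?thesis
    using linear_code_finite_ground[OF C] unfolding wf_indep_def by (intro conjI ballI allI impI)
qed

lemma represents_basis_iff:
  assumes rep: "represents C M"
  shows "basis M B \<longleftrightarrow> B \<subseteq> ground M \<and> shattered C B \<and> (\<forall>g\<in>C. (\<forall>x\<in>B. g x = 0) \<longrightarrow> g = (\<lambda>_. 0))"
proof
  have C: "linear_code (ground M) C" and ind: "\<And>X. X \<in> indeps M \<longleftrightarrow> X \<subseteq> ground M \<and> shattered C X"
    using rep by (auto simp: represents_def)
  show "B \<subseteq> ground M \<and> shattered C B \<and> (\<forall>g\<in>C. (\<forall>x\<in>B. g x = 0) \<longrightarrow> g = (\<lambda>_. 0))" if "basis M B"
  proof (intro conjI ballI impI)
    show B: "B \<subseteq> ground M" "shattered C B" using that ind by (auto simp: basis_def)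
    fix g assume g: "g \<in> C" "\<forall>x\<in>B. g x = 0"
    show "g = (\<lambda>_. 0)"
    proof (rule ccontr)
      assume "\<not> ?thesis"
      then obtain e where e: "g e \<noteq> 0" by auto
      then have "e \<in> ground M" using linear_code_support[OF C g(1)] by blast
      moreover have "shattered C (insert e B)" using g e by (intro shattered_insert[OF C B(2), of g]) auto
      ultimately have "insert e B \<in> indeps M" using B(1) ind by simp
      then have "insert e B = B" using that unfolding basis_def by blast
      then show False using g(2) e by blast
    qed
  qed
  show "basis M B" if B: "B \<subseteq> ground M \<and> shattered C B \<and> (\<forall>g\<in>C. (\<forall>x\<in>B. g x = 0) \<longrightarrow> g = (\<lambda>_. 0))"
    unfolding basis_def
  proof (intro conjI ballI impI)
    show "B \<in> indeps M" using B ind by simp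
    fix X assume X: "X \<in> indeps M" "B \<subseteq> X"
    show "X = B"
    proof (rule ccontr)
      assume "X \<noteq> B"
      then obtain e where e: "e \<in> X" "e \<notin> B" using X(2) by blast
      obtain g where g: "g \<in> C" "\<forall>x\<in>X. g x = (if x = e then 1 else 0)"
        using shattered_dual[of C X e] X(1) ind by blast
      have "\<forall>x\<in>B. g x = 0" using g(2) e(2) X(2) by auto
      then have "g = (\<lambda>_. 0)" using B g(1) by blast
      then show False using g(2) e(1) by auto
    qed
  qed
qed

text \<open>\<open>X\<close> avoids a basis precisely when its complement spans, that is, when no
  nonzero word vanishes there.\<close>

lemma represents_indeps_dual:
  assumes rep: "represents C M"
  shows "X \<in> indeps (dual M) \<longleftrightarrow> X \<subseteq> ground M \<and> (\<forall>g\<in>C. (\<forall>x\<in>ground M - X. g x = 0) \<longrightarrow> g = (\<lambda>_. 0))"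
proof
  have C: "linear_code (ground M) C" using rep by (simp add: represents_def)
  show "X \<subseteq> ground M \<and> (\<forall>g\<in>C. (\<forall>x\<in>ground M - X. g x = 0) \<longrightarrow> g = (\<lambda>_. 0))" if X: "X \<in> indeps (dual M)"
  proof -
    obtain B where B: "basis M B" "X \<inter> B = {}" "X \<subseteq> ground M" using X by (auto simp: indeps_dual)
    then have "B \<subseteq> ground M - X" and d: "\<forall>g\<in>C. (\<forall>x\<in>B. g x = 0) \<longrightarrow> g = (\<lambda>_. 0)"
      using represents_basis_iff[OF rep] by auto
    then have "\<forall>g\<in>C. (\<forall>x\<in>ground M - X. g x = 0) \<longrightarrow> (\<forall>x\<in>B. g x = 0)" by blast
    then show ?thesis using d B(3) by blast
  qed
  show "X \<in> indeps (dual M)" if X: "X \<subseteq> ground M \<and> (\<forall>g\<in>C. (\<forall>x\<in>ground M - X. g x = 0) \<longrightarrow> g = (\<lambda>_. 0))"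
  proof -
    have "finite (ground M - X)" using linear_code_finite_ground[OF C] by simp
    then obtain B where B: "B \<subseteq> ground M - X" "shattered C B"
      "\<forall>g\<in>C. (\<forall>x\<in>B. g x = 0) \<longrightarrow> (\<forall>y\<in>ground M - X. g y = 0)"
      using shattered_basis[OF C, of "ground M - X"] by blast
    have "\<forall>g\<in>C. (\<forall>x\<in>B. g x = 0) \<longrightarrow> g = (\<lambda>_. 0)" using B(3) X by blast
    then have "basis M B" using represents_basis_iff[OF rep] B by blast
    then show ?thesis using X B(1) by (auto simp: indeps_dual)
  qed
qed

section \<open>The orthogonal code and the contracted code\<close>

definition dual_code :: "'a set \<Rightarrow> ('a \<Rightarrow> 'k::field) set \<Rightarrow> ('a \<Rightarrow> 'k) set" where
  "dual_code E C = {h. (\<forall>x. x \<notin> E \<longrightarrow> h x = 0) \<and> (\<forall>g\<in>C. (\<Sum>x\<in>E. h x * g x) = 0)}"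

lemma linear_code_dual_code: "finite E \<Longrightarrow> linear_code E (dual_code E C)"
  unfolding linear_code_def dual_code_def
  by (auto simp: distrib_right sum.distrib mult.assoc sum_distrib_left[symmetric])

text \<open>Standard form of a parity check matrix: values on \<open>Y\<close> are free, and the
  negative of the coordinate matrix determines those on \<open>B\<close>.\<close>

lemma (in code_basis) dual_code_extend:
  "\<exists>h\<in>dual_code E C. \<forall>y\<in>Y. h y = k y"
proof
  define h where "h x = (if x \<in> B then - (\<Sum>y\<in>Y. u x y * k y) else if x \<in> E then k x else 0)" for x
  show "\<forall>y\<in>Y. h y = k y" by (simp add: h_def Y_def)
  have "(\<Sum>x\<in>E. h x * g x) = 0" if g: "g \<in> C" for g
  proof -
    have "(\<Sum>x\<in>E. h x * g x) = (\<Sum>x\<in>Y. h x * g x) + (\<Sum>x\<in>B. h x * g x)"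
      unfolding Y_def by (rule sum.subset_diff[OF B linear_code_finite_ground[OF code]])
    also have "(\<Sum>x\<in>Y. h x * g x) = (\<Sum>y\<in>Y. \<Sum>b\<in>B. k y * (g b * u b y))"
    proof (rule sum.cong)
      fix y assume "y \<in> Y"
      then have "h y = k y" by (simp add: h_def Y_def)
      then show "h y * g y = (\<Sum>b\<in>B. k y * (g b * u b y))"
        using expand[OF g, of y] by (simp add: sum_distrib_left)
    qed simp
    also have "\<dots> = (\<Sum>b\<in>B. \<Sum>y\<in>Y. k y * (g b * u b y))" by (rule sum.swap)
    also have "(\<Sum>x\<in>B. h x * g x) = (\<Sum>b\<in>B. - (\<Sum>y\<in>Y. k y * (g b * u b y)))"
      by (intro sum.cong refl) (simp add: h_def sum_distrib_right sum_distrib_left ac_simps)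
    finally show ?thesis by (simp add: sum_negf)
  qed
  then show "h \<in> dual_code E C" using B by (auto simp: dual_code_def h_def)
qed

lemma (in code_basis) dual_code_det:
  assumes h: "h \<in> dual_code E C" "\<forall>y\<in>Y. h y = 0" shows "h = (\<lambda>_. 0)"
proof
  fix x
  have E: "h x = 0" if "x \<notin> E" for x using h(1) that by (simp add: dual_code_def)
  show "h x = 0"
  proof (cases "x \<in> B")
    case True
    have "(\<Sum>b\<in>E. h b * u x b) = 0" using h(1) u[OF True] by (simp add: dual_code_def)
    moreover have "(\<Sum>b\<in>E. h b * u x b) = (\<Sum>b\<in>B. h b * u x b)"
      using B h(2) linear_code_finite_ground[OF code] by (intro sum.mono_neutral_right) (auto simp: Y_def)
    moreover have "(\<Sum>b\<in>B. h b * u x b) = (\<Sum>b\<in>B. if b = x then h x else 0)"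
      by (intro sum.cong refl) (simp add: u_dual[OF True])
    ultimately show ?thesis using True finB by simp
  next
    case False
    then show ?thesis using E[of x] h(2) by (auto simp: Y_def)
  qed
qed

lemma exists_code_basis:
  assumes C: "linear_code E C" and B: "B \<subseteq> E" "shattered C B" "\<forall>g\<in>C. (\<forall>x\<in>B. g x = 0) \<longrightarrow> g = (\<lambda>_. 0)"
  shows "\<exists>u. code_basis E C B u"
proof -
  have "\<forall>b. \<exists>g\<in>C. \<forall>x\<in>B. g x = (if x = b then 1 else 0)" using shattered_dual[OF B(2)] by blast
  then obtain u where "\<And>b. u b \<in> C" "\<And>b x. x \<in> B \<Longrightarrow> u b x = (if x = b then 1 else 0)" by metis
  then have "code_basis E C B u" using C B by unfold_locales auto
  then show ?thesis by blast
qed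

text \<open>Off a basis, dual words take arbitrary values. Conversely, pairing a word supported in
  \<open>X\<close> with a dual word that is 1 at \<open>x0\<close> and 0 on the rest of
  \<open>X\<close> shows that the former vanishes at \<open>x0\<close>.\<close>

lemma represents_dual:
  fixes C :: "('a \<Rightarrow> 'k::{field,finite}) set"
  assumes rep: "represents C M" shows "represents (dual_code (ground M) C) (dual M)"
proof -
  let ?E = "ground M" and ?D = "dual_code (ground M) C"
  have C: "linear_code ?E C" using rep by (simp add: represents_def)
  have fE: "finite ?E" by (rule linear_code_finite_ground[OF C])
  have "X \<in> indeps (dual M) \<longleftrightarrow> X \<subseteq> ?E \<and> shattered ?D X" for X
  proof
    assume X: "X \<in> indeps (dual M)"
    then obtain B where B: "basis M B" "X \<inter> B = {}" "X \<subseteq> ?E" by (auto simp: indeps_dual)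
    then have "\<exists>u. code_basis ?E C B u"
      using represents_basis_iff[OF rep, of B] by (intro exists_code_basis[OF C]) simp_all
    then obtain u where u: "code_basis ?E C B u" by blast
    have "X \<subseteq> ?E - B" using B by blast
    then have "shattered ?D X"
      using code_basis.dual_code_extend[OF u] unfolding shattered_def code_basis.Y_def[OF u] by blast
    then show "X \<subseteq> ?E \<and> shattered ?D X" using B(3) by blast
  next
    assume X: "X \<subseteq> ?E \<and> shattered ?D X"
    have "g = (\<lambda>_. 0)" if g: "g \<in> C" "\<forall>x\<in>?E - X. g x = 0" for g
    proof
      fix x0
      show "g x0 = 0"
      proof (cases "x0 \<in> X")
        case True
        obtain h where h: "h \<in> ?D" "\<forall>x\<in>X. h x = (if x = x0 then 1 else 0)"
          using shattered_dual[of ?D X x0] X by blast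
        have "(\<Sum>x\<in>?E. h x * g x) = (\<Sum>x\<in>?E. if x = x0 then g x0 else 0)"
        proof (rule sum.cong)
          fix x assume "x \<in> ?E"
          then show "h x * g x = (if x = x0 then g x0 else 0)" using h(2) g(2) True by (cases "x \<in> X") auto
        qed simp
        also have "\<dots> = g x0" using True X fE by auto
        finally show ?thesis using h(1) g(1) by (simp add: dual_code_def)
      next
        case False
        then show ?thesis using g linear_code_support[OF C g(1), of x0] by blast
      qed
    qed
    then show "X \<in> indeps (dual M)" using X represents_indeps_dual[OF rep] by blast
  qed
  then have "indeps (dual M) = {X. X \<subseteq> ?E \<and> shattered ?D X}" by blast
  then show ?thesis using linear_code_dual_code[OF fE] by (simp add: represents_def)
qed

text \<open>Two dualisations have to be unfolded: a basis \<open>X\<close> of the deleted dual is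
  maximal with spanning complement, and then \<open>ground M - Z - X\<close> is a basis of the
  shortened code.\<close>

lemma represents_contraction:
  assumes rep: "represents C M" and Z: "Z \<subseteq> ground M"
  shows "represents (shorten Z C) (contraction M Z)"
proof -
  let ?E = "ground M" and ?D = "deletion (dual M) Z"
  have C: "linear_code ?E C" using rep by (simp add: represents_def)
  have fE: "finite ?E" by (rule linear_code_finite_ground[OF C])
  have CZ: "linear_code (?E - Z) (shorten Z C)"
    using C unfolding linear_code_def shorten_def by auto
  have gD: "ground ?D = ?E - Z" by (simp add: deletion_def)
  have iD: "X \<in> indeps ?D \<longleftrightarrow> X \<subseteq> ?E - Z \<and> (\<forall>g\<in>C. (\<forall>x\<in>?E - X. g x = 0) \<longrightarrow> g = (\<lambda>_. 0))" for X
    using represents_indeps_dual[OF rep] by (auto simp: deletion_def)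
  have "X' \<in> indeps (dual ?D) \<longleftrightarrow> X' \<subseteq> ?E - Z \<and> shattered (shorten Z C) X'" for X'
  proof
    assume "X' \<in> indeps (dual ?D)"
    then obtain X where X: "basis ?D X" "X' \<inter> X = {}" "X' \<subseteq> ?E - Z" by (auto simp: indeps_dual gD)
    define W where "W = ?E - X - Z"
    \<comment> \<open>By maximality of \<open>X\<close>, the complement no longer spans once
      \<open>w\<close> is removed from it. The witness is a word that vanishes outside
      \<open>X\<close> except at \<open>w\<close>.\<close>
    have "\<exists>g\<in>shorten Z C. g w = 1 \<and> (\<forall>x\<in>W. x \<noteq> w \<longrightarrow> g x = 0)" if w: "w \<in> W" for w
    proof -
      have XD: "X \<in> indeps ?D" using X(1) by (simp add: basis_def)
      have "insert w X \<notin> indeps ?D"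
      proof
        assume "insert w X \<in> indeps ?D"
        then have "insert w X = X" using X(1) unfolding basis_def by blast
        then show False using w by (auto simp: W_def)
      qed
      moreover have "insert w X \<subseteq> ?E - Z" using w XD iD by (auto simp: W_def)
      ultimately obtain g where g: "g \<in> C" "\<forall>x\<in>?E - insert w X. g x = 0" "g \<noteq> (\<lambda>_. 0)" using iD by blast
      have gw: "g w \<noteq> 0"
      proof
        assume "g w = 0"
        then have "\<forall>x\<in>?E - X. g x = 0" using g(2) by auto
        then show False using XD iD g(1,3) by blast
      qed
      define g' where "g' = (\<lambda>x. inverse (g w) * g x)"
      have "g' \<in> C" unfolding g'_def by (rule linear_code_scale[OF C g(1)])
      moreover have "\<forall>x\<in>?E - insert w X. g' x = 0" using g(2) by (simp add: g'_def)
      moreover have "g' w = 1" using gw by (simp add: g'_def)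
      moreover have "Z \<subseteq> ?E - insert w X" using Z w XD iD by (auto simp: W_def)
      ultimately show ?thesis by (intro bexI[of _ g']) (auto simp: shorten_def W_def)
    qed
    then obtain g where g: "\<And>w. w \<in> W \<Longrightarrow> g w \<in> shorten Z C"
      "\<And>w x. w \<in> W \<Longrightarrow> x \<in> W \<Longrightarrow> g w x = (if x = w then 1 else 0)" by metis
    have fW: "finite W" using fE by (simp add: W_def)
    have "shattered (shorten Z C) W"
      unfolding shattered_def
    proof
      fix h
      have "(\<lambda>x. \<Sum>w\<in>W. h w * g w x) \<in> shorten Z C" by (intro linear_code_sum[OF CZ fW] g(1))
      moreover have "(\<Sum>w\<in>W. h w * g w x) = h x" if "x \<in> W" for x
      proof -
        have "(\<Sum>w\<in>W. h w * g w x) = (\<Sum>w\<in>W. if w = x then h x else 0)"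
          using g(2) that by (intro sum.cong) auto
        then show ?thesis using that fW by simp
      qed
      ultimately show "\<exists>g\<in>shorten Z C. \<forall>x\<in>W. g x = h x" by (rule_tac bexI) simp_all
    qed
    moreover have "X' \<subseteq> W" using X(2,3) by (auto simp: W_def)
    ultimately show "X' \<subseteq> ?E - Z \<and> shattered (shorten Z C) X'" using X(3) shattered_subset by blast
  next
    assume X': "X' \<subseteq> ?E - Z \<and> shattered (shorten Z C) X'"
    have "finite (?E - Z)" using fE by simp
    then obtain B where B: "X' \<subseteq> B" "B \<subseteq> ?E - Z" "shattered (shorten Z C) B"
      "\<forall>g\<in>shorten Z C. (\<forall>x\<in>B. g x = 0) \<longrightarrow> (\<forall>y\<in>?E - Z. g y = 0)"
      using shattered_maximal_extension[OF CZ, of "?E - Z" X'] X' by blast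
    define X where "X = ?E - Z - B"
    have "basis ?D X"
      unfolding basis_def
    proof (intro conjI ballI impI)
      have "g = (\<lambda>_. 0)" if g: "g \<in> C" "\<forall>x\<in>?E - X. g x = 0" for g
      proof -
        have "g \<in> shorten Z C" "\<forall>x\<in>B. g x = 0" using g Z B(2) by (auto simp: shorten_def X_def)
        then have "\<forall>y\<in>?E - Z. g y = 0" using bspec[OF B(4)] by simp
        moreover have "\<forall>y\<in>Z. g y = 0" using \<open>g \<in> shorten Z C\<close> by (simp add: shorten_def)
        ultimately show ?thesis using linear_code_support[OF C g(1)] by blast
      qed
      then show "X \<in> indeps ?D" using iD by (auto simp: X_def)
    next
      fix X2 assume X2: "X2 \<in> indeps ?D" "X \<subseteq> X2"
      have d2: "X2 \<subseteq> ?E - Z" "\<forall>g\<in>C. (\<forall>x\<in>?E - X2. g x = 0) \<longrightarrow> g = (\<lambda>_. 0)" using X2(1) iD by blast+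
      show "X2 = X"
      proof (rule ccontr)
        assume "X2 \<noteq> X"
        then obtain w where w: "w \<in> X2" "w \<notin> X" using X2(2) by blast
        then have wB: "w \<in> B" using d2(1) by (auto simp: X_def)
        obtain g where g: "g \<in> shorten Z C" "\<forall>x\<in>B. g x = (if x = w then 1 else 0)"
          using shattered_dual[OF B(3)] by blast
        have "g x = 0" if x: "x \<in> ?E - X2" for x
        proof (cases "x \<in> Z")
          case True
          then show ?thesis using g(1) by (simp add: shorten_def)
        next
          case False
          then have "x \<in> B" "x \<noteq> w" using x X2(2) w(1) by (auto simp: X_def)
          then show ?thesis using g(2) by simp
        qed
        moreover have "g \<in> C" using g(1) by (simp add: shorten_def)
        ultimately have "g = (\<lambda>_. 0)" using d2(2) by blast
        then show False using g(2) wB by auto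
      qed
    qed
    moreover have "X' \<inter> X = {}" using B(1) by (auto simp: X_def)
    ultimately show "X' \<in> indeps (dual ?D)" using X' by (auto simp: indeps_dual gD)
  qed
  then have "indeps (contraction M Z) = {X. X \<subseteq> ?E - Z \<and> shattered (shorten Z C) X}"
    unfolding contraction_def by blast
  moreover have "ground (contraction M Z) = ?E - Z" by (simp add: contraction_def gD)
  ultimately show ?thesis using CZ by (simp add: represents_def)
qed

section \<open>Cycle matroids of cliques\<close>

text \<open>Independence of the coboundaries over the given field, with every edge oriented from its
  smaller to its larger end.\<close>

definition potential :: "'k::field itself \<Rightarrow> nat set set \<Rightarrow> bool" where
  "potential _ X \<longleftrightarrow> (\<forall>k. \<exists>b :: nat \<Rightarrow> 'k. \<forall>e\<in>X. b (Max e) - b (Min e) = k e)"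

text \<open>Prescribe 1 on one edge of the cycle and 0 on the others: walking along the others shows
  that the ends of the first edge have equal potential.\<close>

lemma potential_acyclic:
  assumes pot: "potential TYPE('k::field) X" and cyc: "is_cycle X vs"
  shows False
proof -
  let ?n = "length vs"
  have n: "3 \<le> ?n" and dist: "distinct vs" and edges: "cycle_edges vs \<subseteq> X"
    using cyc by (auto simp: is_cycle_def)
  let ?e = "{vs ! 0, vs ! 1}"
  obtain b :: "nat \<Rightarrow> 'k" where b: "\<forall>e\<in>X. b (Max e) - b (Min e) = (if e = ?e then 1 else 0)"
    using pot[unfolded potential_def, THEN spec, of "\<lambda>e. if e = ?e then 1 else 0"] by blast
  have same: "b (vs ! i) = b (vs ! (Suc i mod ?n))" if i: "1 \<le> i" "i < ?n" for i
  proof -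
    let ?f = "{vs ! i, vs ! (Suc i mod ?n)}"
    have fX: "?f \<in> X" using edges i(2) by (auto simp: cycle_edges_def)
    have n0: "0 < ?n" "1 < ?n" using n by linarith+
    have lt: "Suc i mod ?n < ?n" by (rule mod_less_divisor[OF n0(1)])
    have "vs ! i \<noteq> vs ! 0" using nth_eq_iff_index_eq[OF dist i(2) n0(1)] i(1) by simp
    \<comment> \<open>Here the length 3 matters: on two vertices the way back would be the first
      edge itself.\<close>
    moreover have "\<not> (i = 1 \<and> Suc i mod ?n = 0)" using n by auto
    then have "\<not> (vs ! i = vs ! 1 \<and> vs ! (Suc i mod ?n) = vs ! 0)"
      using nth_eq_iff_index_eq[OF dist i(2) n0(2)] nth_eq_iff_index_eq[OF dist lt n0(1)] by simp
    ultimately have "?f \<noteq> ?e" by (auto simp: doubleton_eq_iff)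
    moreover have "b (Max ?f) - b (Min ?f) = (if ?f = ?e then 1 else 0)" by (rule bspec[OF b fX])
    ultimately have "b (Max ?f) - b (Min ?f) = 0" by (simp only: if_False)
    then have "b (Max ?f) = b (Min ?f)" by (simp only: right_minus_eq)
    then show ?thesis by (cases "vs ! i \<le> vs ! (Suc i mod ?n)") (auto simp: max_def min_def split: if_splits)
  qed
  have chain: "b (vs ! Suc i) = b (vs ! 1)" if "Suc i < ?n" for i
    using that
  proof (induction i)
    case (Suc i)
    then show ?case using same[of "Suc i"] by simp
  qed simp
  have "b (vs ! (?n - 1)) = b (vs ! 1)" using chain[of "?n - 2"] n by (simp add: Suc_diff_Suc numeral_2_eq_2)
  moreover have "b (vs ! (?n - 1)) = b (vs ! 0)"
  proof -
    have "1 \<le> ?n - 1" "?n - 1 < ?n" using n by auto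
    then have "b (vs ! (?n - 1)) = b (vs ! (Suc (?n - 1) mod ?n))" by (rule same)
    moreover have "Suc (?n - 1) = ?n" using n by simp
    ultimately show ?thesis by simp
  qed
  ultimately have eq: "b (vs ! 0) = b (vs ! 1)" by simp
  have "?e \<in> X"
  proof -
    have "Suc 0 mod ?n = 1" "0 < ?n" using n by auto
    then have "?e \<in> cycle_edges vs" unfolding cycle_edges_def by (intro CollectI exI[of _ 0]) simp
    then show ?thesis using edges by blast
  qed
  then have "b (Max ?e) - b (Min ?e) = 1" using b by auto
  then show False using eq by (cases "vs ! 0 \<le> vs ! 1") (auto simp: max_def min_def split: if_splits)
qed

text \<open>An end vertex of a longest path has a second edge only if that edge closes a cycle.\<close>

lemma acyclic_has_leaf:
  fixes X :: "nat set set"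
  assumes X: "finite X" "X \<noteq> {}" "\<forall>e\<in>X. card e = 2" and acyclic: "\<nexists>vs. is_cycle X vs"
  shows "\<exists>e\<in>X. \<exists>v\<in>e. \<forall>e'\<in>X. v \<in> e' \<longrightarrow> e' = e"
proof (rule ccontr)
  assume no: "\<not> ?thesis"
  define P where "P vs \<longleftrightarrow> distinct vs \<and> 2 \<le> length vs \<and> (\<forall>i. Suc i < length vs \<longrightarrow> {vs ! i, vs ! Suc i} \<in> X)" for vs
  have "finite e" if "e \<in> X" for e using X(3) that by (intro card_ge_0_finite) simp
  then have fin: "finite (\<Union>X)" by (rule finite_Union[OF X(1)])
  have vertices: "set vs \<subseteq> \<Union>X" if "P vs" for vs
  proof
    fix v assume "v \<in> set vs"
    then obtain i where i: "i < length vs" "v = vs ! i" by (auto simp: in_set_conv_nth)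
    show "v \<in> \<Union>X"
    proof (cases "Suc i < length vs")
      case True
      then have "{vs ! i, vs ! Suc i} \<in> X" using that by (simp add: P_def)
      then show ?thesis using i(2) by blast
    next
      case False
      then have "Suc (i - 1) < length vs" "Suc (i - 1) = i" using i(1) that by (auto simp: P_def)
      then have "{vs ! (i - 1), vs ! i} \<in> X" using that unfolding P_def by metis
      then show ?thesis using i(2) by blast
    qed
  qed
  have bound: "length vs < Suc (card (\<Union>X))" if "P vs" for vs
    using card_mono[OF fin vertices[OF that]] that by (simp add: P_def distinct_card)
  obtain e where e: "e \<in> X" using X(2) by blast
  then obtain x y where xy: "e = {x, y}" "x \<noteq> y" using X(3) by (metis card_2_iff)
  have "P [x, y]" using e xy by (auto simp: P_def less_Suc_eq)
  then obtain vs where vs: "P vs" and longest: "\<forall>ws. P ws \<longrightarrow> length ws \<le> length vs"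
    using ex_has_greatest_nat[of P "[x, y]" length "Suc (card (\<Union>X))"] bound by blast
  have len: "2 \<le> length vs" and dist: "distinct vs" using vs by (auto simp: P_def)
  have step: "{vs ! i, vs ! Suc i} \<in> X" if "Suc i < length vs" for i using vs that by (simp add: P_def)
  have e0: "{vs ! 0, vs ! 1} \<in> X" using step[of 0] len by simp
  obtain e' where e': "e' \<in> X" "vs ! 0 \<in> e'" "e' \<noteq> {vs ! 0, vs ! 1}" using no e0 by blast
  then obtain w where w: "e' = {vs ! 0, w}" "w \<noteq> vs ! 0" using X(3) by (metis card_2_iff doubleton_eq_iff insertE singletonD)
  have w1: "w \<noteq> vs ! 1" using e'(3) w(1) by blast
  show False
  proof (cases "w \<in> set vs")
    case False
    have "P (w # vs)"
      unfolding P_def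
    proof (intro conjI allI impI)
      fix i assume "Suc i < length (w # vs)"
      then show "{(w # vs) ! i, (w # vs) ! Suc i} \<in> X"
        using e'(1) w(1) step by (cases i) (auto simp: insert_commute)
    qed (use False dist len in auto)
    then show False using longest by fastforce
  next
    case True
    then obtain j where j: "j < length vs" "w = vs ! j" by (auto simp: in_set_conv_nth)
    have "j \<noteq> 0" using j(2) w(2) by metis
    moreover have "j \<noteq> 1" using j(2) w1 by metis
    ultimately have j2: "2 \<le> j" by simp
    let ?c = "take (Suc j) vs"
    have lc: "length ?c = Suc j" using j(1) by simp
    have "cycle_edges ?c \<subseteq> X"
    proof
      fix f assume "f \<in> cycle_edges ?c"
      then obtain i where i: "i < Suc j" "f = {?c ! i, ?c ! (Suc i mod Suc j)}"
        unfolding cycle_edges_def lc by blast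
      show "f \<in> X"
      proof (cases "i = j")
        case True
        then have "f = e'" using i(2) j(2) w(1) by (auto simp: insert_commute)
        then show ?thesis using e'(1) by simp
      next
        case False
        then have "Suc i < Suc j" using i(1) by simp
        then have "f = {vs ! i, vs ! Suc i}" using i(2) by simp
        then show ?thesis using step[of i] \<open>Suc i < Suc j\<close> j(1) by simp
      qed
    qed
    then have "is_cycle X ?c" using lc j2 dist by (simp add: is_cycle_def)
    then show False using acyclic by blast
  qed
qed

text \<open>Remove the edge at a leaf, solve for the rest, and adjust the potential of the leaf,
  which occurs in no other edge.\<close>

lemma acyclic_potential:
  fixes X :: "nat set set"
  assumes "finite X" "\<forall>e\<in>X. card e = 2" "\<nexists>vs. is_cycle X vs"
  shows "potential TYPE('k::field) X"
  using assms
proof (induction "card X" arbitrary: X)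
  case 0
  then show ?case by (simp add: potential_def)
next
  case (Suc n)
  have "X \<noteq> {}" using Suc.hyps(2) by auto
  then obtain e v where e: "e \<in> X" "v \<in> e" "\<forall>e'\<in>X. v \<in> e' \<longrightarrow> e' = e"
    using acyclic_has_leaf[OF Suc.prems(1) _ Suc.prems(2,3)] by blast
  have ce: "card e = 2" using e(1) Suc.prems(2) by blast
  then obtain w where w: "e = {v, w}" "v \<noteq> w" using e(2) by (metis card_2_iff doubleton_eq_iff insertE singletonD)
  have "potential TYPE('k) (X - {e})"
  proof (rule Suc.hyps(1))
    show "n = card (X - {e})" using Suc.hyps(2) Suc.prems(1) e(1) by simp
    show "\<nexists>vs. is_cycle (X - {e}) vs" using Suc.prems(3) by (auto simp: is_cycle_def)
  qed (use Suc.prems in auto)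
  show ?case
    unfolding potential_def
  proof
    fix k :: "nat set \<Rightarrow> 'k"
    obtain b where b: "\<forall>e'\<in>X - {e}. b (Max e') - b (Min e') = k e'"
      using \<open>potential TYPE('k) (X - {e})\<close>[unfolded potential_def, THEN spec, of k] by blast
    \<comment> \<open>The sign depends on whether the leaf is the smaller or the larger end.\<close>
    define b' where "b' = b(v := (if v < w then b w - k e else b w + k e))"
    have "b' (Max e') - b' (Min e') = k e'" if e': "e' \<in> X" for e'
    proof (cases "e' = e")
      case True
      then show ?thesis using w by (auto simp: b'_def max_def min_def)
    next
      case False
      then have "v \<notin> e'" using e(3) e' by blast
      moreover have "finite e'" "e' \<noteq> {}" using Suc.prems(2) e' by (auto intro: card_ge_0_finite)
      then have "Max e' \<in> e'" "Min e' \<in> e'" by simp_all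
      ultimately have "Max e' \<noteq> v" "Min e' \<noteq> v" by auto
      then show ?thesis using b e' False by (simp add: b'_def)
    qed
    then show "\<exists>b. \<forall>e\<in>X. b (Max e) - b (Min e) = k e" by blast
  qed
qed

lemma clique_edge:
  assumes "e \<in> clique t"
  shows "Min e < Max e" "Max e < t" "e = {Min e, Max e}"
proof -
  obtain x y where xy: "e = {x, y}" "x \<noteq> y" using assms by (auto simp: clique_def card_2_iff)
  then show "Min e < Max e" "e = {Min e, Max e}" by (auto simp: min_def max_def)
  show "Max e < t" using assms xy by (auto simp: clique_def max_def)
qed

lemma indeps_cycle_matroid_clique:
  "X \<in> indeps (cycle_matroid (clique t)) \<longleftrightarrow> X \<subseteq> clique t \<and> potential TYPE('k::field) X"
proof -
  have "finite (clique t)" by (rule finite_subset[of _ "Pow {..<t}"]) (auto simp: clique_def)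
  then have "(\<nexists>vs. is_cycle X vs) \<longleftrightarrow> potential TYPE('k) X" if "X \<subseteq> clique t"
    using acyclic_potential[of X] potential_acyclic[of X] that finite_subset[OF that] by (auto simp: clique_def)
  then show ?thesis by (auto simp: cycle_matroid_def)
qed

lemma wf_indep_cycle_matroid_clique: "wf_indep (cycle_matroid (clique t))"
proof -
  let ?N = "cycle_matroid (clique t)"
  have fin: "finite (clique t)" by (rule finite_subset[of _ "Pow {..<t}"]) (auto simp: clique_def)
  have "\<not> is_cycle {} vs" for vs :: "nat list"
  proof
    assume c: "is_cycle {} vs"
    then have "0 < length vs" by (auto simp: is_cycle_def)
    then have "{vs ! 0, vs ! (Suc 0 mod length vs)} \<in> cycle_edges vs"
      unfolding cycle_edges_def by (intro CollectI exI[of _ 0]) simp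
    then show False using c by (auto simp: is_cycle_def)
  qed
  then have emp: "{} \<in> indeps ?N" by (simp add: cycle_matroid_def)
  have down: "Y \<in> indeps ?N" if XY: "X \<in> indeps ?N" "Y \<subseteq> X" for X Y
  proof -
    have "is_cycle X vs" if "is_cycle Y vs" for vs using that XY(2) by (auto simp: is_cycle_def)
    then have "\<nexists>vs. is_cycle Y vs" using XY(1) by (auto simp: cycle_matroid_def)
    then show ?thesis using XY by (auto simp: cycle_matroid_def)
  qed
  have sub: "X \<subseteq> ground ?N" if "X \<in> indeps ?N" for X
    using that by (simp add: cycle_matroid_def)
  have "finite (ground ?N)" using fin by (simp add: cycle_matroid_def)
  then show ?thesis
    unfolding wf_indep_def using emp
  proof (intro conjI ballI allI impI)
    fix X assume "X \<in> indeps ?N"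
    then show "X \<subseteq> ground ?N" by (rule sub)
  next
    fix X Y assume "X \<in> indeps ?N" "Y \<subseteq> X"
    then show "Y \<in> indeps ?N" by (rule down)
  qed
qed

lemma clique_code_has_minor:
  fixes C :: "('a \<Rightarrow> 'k::{field,finite}) set"
  assumes rep: "represents C M" and cl: "clique_code t C"
  shows "has_minor M (cycle_matroid (clique t))"
proof -
  let ?E = "ground M"
  have C: "linear_code ?E C" using rep by (simp add: represents_def)
  obtain Z x where up: "\<forall>g\<in>shorten Z C. \<exists>b. \<forall>j<t. \<forall>i<j. g (x i j) = b j - b i"
    and down: "\<forall>b. \<exists>g\<in>shorten Z C. \<forall>j<t. \<forall>i<j. g (x i j) = b j - b i"
    using cl unfolding clique_code_def by blast
  \<comment> \<open>Words vanish off the ground set, so cutting \<open>Z\<close> down to it leaves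
    the shortened code unchanged.\<close>
  define Z' where "Z' = Z \<inter> ?E"
  have sh: "shorten Z' C = shorten Z C"
    using linear_code_support[OF C] by (auto simp: shorten_def Z'_def)
  let ?C = "shorten Z' C"
  define N1 where "N1 = contraction M Z'"
  have rep1: "represents ?C N1" unfolding N1_def by (rule represents_contraction[OF rep]) (simp add: Z'_def)
  have C1: "linear_code (ground N1) ?C" using rep1 by (simp add: represents_def)
  define \<xi> where "\<xi> e = x (Min e) (Max e)" for e
  define S where "S = \<xi> ` clique t"
  have val: "\<exists>g\<in>?C. \<forall>e\<in>clique t. g (\<xi> e) = b (Max e) - b (Min e)" for b :: "nat \<Rightarrow> 'k"
  proof -
    obtain g where g: "g \<in> shorten Z C" "\<forall>j<t. \<forall>i<j. g (x i j) = b j - b i" using down by blast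
    have "g (\<xi> e) = b (Max e) - b (Min e)" if "e \<in> clique t" for e
      using g(2) clique_edge[OF that] by (simp add: \<xi>_def)
    then show ?thesis using g(1) sh by blast
  qed
  \<comment> \<open>The potential that is 1 at \<open>v\<close> and 0 elsewhere has a nonzero
    difference exactly on the edges through \<open>v\<close>, so an edge is recovered from its
    element.\<close>
  have inj: "inj_on \<xi> (clique t)"
  proof (rule inj_onI)
    have aux: "e \<subseteq> e'" if e: "e \<in> clique t" "e' \<in> clique t" "\<xi> e = \<xi> e'" for e e'
    proof
      fix v assume v: "v \<in> e"
      obtain g where g: "\<forall>e\<in>clique t. g (\<xi> e) = (if Max e = v then 1 else 0) - (if Min e = v then 1 else (0::'k))"
        using val[of "\<lambda>w. if w = v then 1 else 0"] by blast
      have "v = Min e \<or> v = Max e" using v clique_edge(3)[OF e(1)] by blast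
      then have "g (\<xi> e) \<noteq> 0" using g e(1) clique_edge(1)[OF e(1)] by auto
      then have "g (\<xi> e') \<noteq> 0" using e(3) by simp
      then have "v = Min e' \<or> v = Max e'" using g e(2) by (auto split: if_splits)
      then show "v \<in> e'" using clique_edge(3)[OF e(2)] by blast
    qed
    fix e e' assume "e \<in> clique t" "e' \<in> clique t" "\<xi> e = \<xi> e'"
    then show "e = e'" using aux[of e e'] aux[of e' e] by auto
  qed
  have SE: "S \<subseteq> ground N1"
  proof
    fix s assume "s \<in> S"
    then obtain e where e: "e \<in> clique t" "s = \<xi> e" by (auto simp: S_def)
    obtain g where g: "g \<in> ?C" "\<forall>f\<in>clique t. g (\<xi> f) = (if Max f = Max e then 1 else 0) - (if Min f = Max e then 1 else (0::'k))"
      using val[of "\<lambda>w. if w = Max e then 1 else 0"] by blast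
    have "g s \<noteq> 0" using g(2) e clique_edge(1)[OF e(1)] by auto
    then show "s \<in> ground N1" using linear_code_support[OF C1 g(1)] by blast
  qed
  define N2 where "N2 = deletion N1 (ground N1 - S)"
  have g2: "ground N2 = S" using SE by (auto simp: N2_def deletion_def)
  have i2: "X \<in> indeps N2 \<longleftrightarrow> X \<subseteq> S \<and> shattered ?C X" for X
    using rep1 SE by (auto simp: N2_def deletion_def represents_def)
  have "X \<in> indeps (cycle_matroid (clique t)) \<longleftrightarrow> \<xi> ` X \<in> indeps N2" if X: "X \<subseteq> clique t" for X
  proof -
    have "potential TYPE('k) X \<longleftrightarrow> shattered ?C (\<xi> ` X)"
    proof
      assume pot: "potential TYPE('k) X"
      show "shattered ?C (\<xi> ` X)"
        unfolding shattered_def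
      proof
        fix h
        obtain b :: "nat \<Rightarrow> 'k" where b: "\<forall>e\<in>X. b (Max e) - b (Min e) = h (\<xi> e)"
          using pot[unfolded potential_def, THEN spec, of "\<lambda>e. h (\<xi> e)"] by blast
        obtain g where "g \<in> ?C" "\<forall>e\<in>clique t. g (\<xi> e) = b (Max e) - b (Min e)" using val by blast
        then show "\<exists>g\<in>?C. \<forall>x\<in>\<xi> ` X. g x = h x" using b X by (intro bexI[of _ g]) auto
      qed
    next
      assume shat: "shattered ?C (\<xi> ` X)"
      show "potential TYPE('k) X"
        unfolding potential_def
      proof
        fix k :: "nat set \<Rightarrow> 'k"
        obtain g where g: "g \<in> ?C" "\<forall>x\<in>\<xi> ` X. g x = k (inv_into (clique t) \<xi> x)"
          using shat[unfolded shattered_def, THEN spec, of "\<lambda>x. k (inv_into (clique t) \<xi> x)"] by blast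
        obtain b where b: "\<forall>j<t. \<forall>i<j. g (x i j) = b j - b i" using up g(1) sh by blast
        have "b (Max e) - b (Min e) = k e" if e: "e \<in> X" for e
        proof -
          have eX: "e \<in> clique t" using e X by blast
          have "g (\<xi> e) = b (Max e) - b (Min e)" using b clique_edge[OF eX] by (simp add: \<xi>_def)
          moreover have "g (\<xi> e) = k e" using g(2) e inj eX by (simp add: inv_into_f_f)
          ultimately show ?thesis by simp
        qed
        then show "\<exists>b. \<forall>e\<in>X. b (Max e) - b (Min e) = k e" by blast
      qed
    qed
    then show ?thesis using X i2 indeps_cycle_matroid_clique[of X t, where 'k='k] by (auto simp: S_def)
  qed
  moreover have "bij_betw \<xi> (clique t) (ground N2)" using inj by (simp add: bij_betw_def g2 S_def)
  ultimately have "matroid_iso (cycle_matroid (clique t)) N2"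
    unfolding matroid_iso_def by (intro exI[of _ \<xi>]) (simp add: cycle_matroid_def)
  then have "matroid_iso N2 (cycle_matroid (clique t))" by (rule matroid_iso_sym)
  moreover have "minor_of N2 M"
    unfolding N2_def N1_def
    by (intro minor_of.minor_delete minor_of.minor_contract minor_of.minor_refl) (auto simp: Z'_def)
  ultimately show ?thesis by (auto simp: has_minor_def)
qed

section \<open>Representable matroids of large girth\<close>

text \<open>A maximal subset of \<open>X\<close> on which the vectors can be prescribed by a functional spans the others.\<close>

lemma lin_indpt_iff_functionals:
  fixes v :: "'b \<Rightarrow> 'k::field vec"
  assumes X: "finite X" and v: "\<And>x. x \<in> X \<Longrightarrow> v x \<in> carrier_vec n"
  shows "inj_on v X \<and> \<not> module.lin_dep class_ring (module_vec TYPE('k) n) (v ` X) \<longleftrightarrow>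
    (\<forall>k. \<exists>w\<in>carrier_vec n. \<forall>x\<in>X. w \<bullet> v x = k x)" (is "?L \<longleftrightarrow> ?R")
proof
  interpret V: vec_space "TYPE('k)" n .
  assume R: ?R
  have inj: "inj_on v X"
  proof (rule inj_onI)
    fix x y assume x: "x \<in> X" and y: "y \<in> X" and eq: "v x = v y"
    obtain w where w: "\<forall>z\<in>X. w \<bullet> v z = (if z = x then 1 else 0)"
      using R[THEN spec, of "\<lambda>z. if z = x then 1 else 0"] by blast
    have "w \<bullet> v y = 1" using bspec[OF w x] eq by simp
    then show "x = y" using bspec[OF w y] by (simp split: if_splits)
  qed
  have "\<not> V.lin_dep (v ` X)"
  proof
    assume "V.lin_dep (v ` X)"
    then obtain A a u where A: "finite A" "A \<subseteq> v ` X" "V.lincomb a A = 0\<^sub>v n" "u \<in> A" "a u \<noteq> 0"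
      unfolding V.lin_dep_def by (auto simp: module_vec_simps class_ring_simps)
    have Ac: "A \<subseteq> carrier_vec n" using A(2) v by blast
    \<comment> \<open>Applied to the vanishing combination, this functional picks out the
      coefficient of \<open>u\<close>.\<close>
    obtain w where w: "w \<in> carrier_vec n" "\<forall>z\<in>X. w \<bullet> v z = (if v z = u then 1 else 0)"
      using R[THEN spec, of "\<lambda>z. if v z = u then 1 else 0"] by blast
    have wA: "w \<bullet> z = (if z = u then 1 else 0)" if "z \<in> A" for z using w(2) A(2) that by blast
    have "w \<bullet> V.lincomb a A = (\<Sum>z\<in>A. a z * (w \<bullet> z))"
    proof -
      have "w \<bullet> V.lincomb a A = (\<Sum>i<n. w $ i * (\<Sum>z\<in>A. a z * z $ i))"
        using V.lincomb_index[OF _ Ac] V.lincomb_closed[OF Ac] w(1)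
        unfolding scalar_prod_def by (intro sum.cong) (auto simp: V.lincomb_dim[OF A(1) Ac] atLeast0LessThan)
      also have "\<dots> = (\<Sum>i<n. \<Sum>z\<in>A. a z * (w $ i * z $ i))" by (simp add: sum_distrib_left ac_simps)
      also have "\<dots> = (\<Sum>z\<in>A. \<Sum>i<n. a z * (w $ i * z $ i))" by (rule sum.swap)
      also have "\<dots> = (\<Sum>z\<in>A. a z * (w \<bullet> z))"
        using Ac by (intro sum.cong refl) (auto simp: scalar_prod_def sum_distrib_left atLeast0LessThan)
      finally show ?thesis .
    qed
    also have "\<dots> = (\<Sum>z\<in>A. if z = u then a u else 0)"
      by (rule sum.cong) (simp_all add: wA)
    also have "\<dots> = a u" using A(1,4) by simp
    finally show False using A(3,5) w(1) by simp
  qed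
  then show ?L using inj by simp
next
  interpret V: vec_space "TYPE('k)" n .
  assume L: ?L
  define sh where "sh Y \<longleftrightarrow> (\<forall>k. \<exists>w\<in>carrier_vec n. \<forall>x\<in>Y. w \<bullet> v x = k x)" for Y
  define P where "P = {Y. Y \<subseteq> X \<and> sh Y}"
  have "finite P" using X by (rule_tac finite_subset[of _ "Pow X"]) (auto simp: P_def)
  moreover have "{} \<in> P" by (auto simp: P_def sh_def intro: zero_carrier_vec)
  then have "P \<noteq> {}" by blast
  ultimately obtain Y where Y: "Y \<in> P" and mx: "\<forall>Y'\<in>P. Y \<subseteq> Y' \<longrightarrow> Y = Y'"
    by (blast dest: finite_has_maximal)
  have YX: "Y \<subseteq> X" and shY: "sh Y" using Y by (auto simp: P_def)
  have fY: "finite Y" using YX X finite_subset by blast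
  have "Y = X"
  proof (rule ccontr)
    assume "Y \<noteq> X"
    then obtain e where e: "e \<in> X" "e \<notin> Y" using YX by blast
    have ve: "v e \<in> carrier_vec n" by (rule v[OF e(1)])
    \<comment> \<open>Otherwise a multiple of \<open>w\<close> could be added to adjust the value at
      \<open>e\<close> without changing those on \<open>Y\<close>, against maximality.\<close>
    have perp: "w \<bullet> v e = 0" if w: "w \<in> carrier_vec n" "\<forall>x\<in>Y. w \<bullet> v x = 0" for w
    proof (rule ccontr)
      assume nz: "w \<bullet> v e \<noteq> 0"
      have "sh (insert e Y)"
        unfolding sh_def
      proof
        fix k
        obtain w0 where w0: "w0 \<in> carrier_vec n" "\<forall>x\<in>Y. w0 \<bullet> v x = k x" using shY unfolding sh_def by blast
        define w1 where "w1 = w0 + ((k e - w0 \<bullet> v e) / (w \<bullet> v e)) \<cdot>\<^sub>v w"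
        have val: "w1 \<bullet> v x = w0 \<bullet> v x + ((k e - w0 \<bullet> v e) / (w \<bullet> v e)) * (w \<bullet> v x)" if "x \<in> X" for x
          unfolding w1_def using w0(1) w(1) v[OF that]
          by (simp add: add_scalar_prod_distrib[of _ n])
        have "w1 \<bullet> v x = k x" if "x \<in> insert e Y" for x
          using that val[of x] e(1) YX w0(2) w(2) nz by auto
        moreover have "w1 \<in> carrier_vec n" using w0(1) w(1) by (simp add: w1_def)
        ultimately show "\<exists>w\<in>carrier_vec n. \<forall>x\<in>insert e Y. w \<bullet> v x = k x" by blast
      qed
      then have "insert e Y \<in> P" using e(1) YX by (simp add: P_def)
      then have "e \<in> Y" using mx by blast
      then show False using e(2) by simp
    qed
    have "\<forall>y. \<exists>w\<in>carrier_vec n. \<forall>x\<in>Y. w \<bullet> v x = (if x = y then 1 else 0)"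
    proof
      fix y
      show "\<exists>w\<in>carrier_vec n. \<forall>x\<in>Y. w \<bullet> v x = (if x = y then 1 else 0)"
        using shY[unfolded sh_def, THEN spec, of "\<lambda>x. if x = y then 1 else 0"] .
    qed
    then obtain d where d: "\<And>y. d y \<in> carrier_vec n" "\<And>y x. x \<in> Y \<Longrightarrow> d y \<bullet> v x = (if x = y then 1 else 0)"
      by metis
    define a where "a u = (if u = v e then - 1 else d (the_inv_into Y v u) \<bullet> v e)" for u
    have injX: "inj_on v X" using L by simp
    then have injY: "inj_on v Y" using YX inj_on_subset by blast
    have veY: "v e \<notin> v ` Y" using injX e YX by (auto simp: inj_on_def)
    have a: "a (v y) = d y \<bullet> v e" if "y \<in> Y" for y
    proof -
      have "v y \<noteq> v e" using that veY by (metis image_eqI)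
      then show ?thesis using the_inv_into_f_f[OF injY that] by (simp add: a_def)
    qed
    let ?A = "insert (v e) (v ` Y)"
    have Ac: "?A \<subseteq> carrier_vec n" using ve v YX by blast
    have "V.lincomb a ?A = 0\<^sub>v n"
    proof (rule eq_vecI)
      show "dim_vec (V.lincomb a ?A) = dim_vec (0\<^sub>v n)" using V.lincomb_closed[OF Ac] by simp
      fix i assume "i < dim_vec (0\<^sub>v n :: 'k vec)"
      then have i: "i < n" by simp
      let ?u = "unit_vec n i :: 'k vec"
      have ui: "?u \<bullet> x = x $ i" if "x \<in> carrier_vec n" for x using that i by simp
      \<comment> \<open>The functional reading coordinate \<open>i\<close>, minus its interpolation
        on \<open>Y\<close>. It vanishes on \<open>Y\<close>, so by \<open>perp\<close> also at
        \<open>v e\<close>, which is coordinate \<open>i\<close> of the dependence.\<close>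
      define w where "w j = ?u $ j - (\<Sum>y\<in>Y. v y $ i * d y $ j)" for j
      have wv: "vec n w \<bullet> x = x $ i - (\<Sum>y\<in>Y. v y $ i * (d y \<bullet> x))" if x: "x \<in> carrier_vec n" for x
      proof -
        have "vec n w \<bullet> x = (\<Sum>j<n. ?u $ j * x $ j - (\<Sum>y\<in>Y. v y $ i * (d y $ j * x $ j)))"
          using x unfolding scalar_prod_def w_def atLeast0LessThan
          by (intro sum.cong) (auto simp: left_diff_distrib sum_distrib_right mult.assoc)
        also have "\<dots> = (\<Sum>j<n. ?u $ j * x $ j) - (\<Sum>y\<in>Y. \<Sum>j<n. v y $ i * (d y $ j * x $ j))"
          by (subst sum.swap) (simp add: sum_subtractf)
        also have "(\<Sum>j<n. ?u $ j * x $ j) = x $ i"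
          using ui[OF x] x by (simp add: scalar_prod_def atLeast0LessThan)
        also have "(\<Sum>y\<in>Y. \<Sum>j<n. v y $ i * (d y $ j * x $ j)) = (\<Sum>y\<in>Y. v y $ i * (d y \<bullet> x))"
          using x d(1) by (intro sum.cong refl) (auto simp: scalar_prod_def sum_distrib_left atLeast0LessThan)
        finally show ?thesis .
      qed
      have "vec n w \<bullet> v x = 0" if x: "x \<in> Y" for x
      proof -
        have "(\<Sum>y\<in>Y. v y $ i * (d y \<bullet> v x)) = (\<Sum>y\<in>Y. if y = x then v x $ i else 0)"
          using d(2)[OF x] by (intro sum.cong) auto
        then show ?thesis using wv[of "v x"] v x YX fY by auto
      qed
      then have "vec n w \<bullet> v e = 0" by (intro perp) auto
      then have "v e $ i = (\<Sum>y\<in>Y. v y $ i * (d y \<bullet> v e))" using wv[OF ve] by simp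
      moreover have "V.lincomb a ?A $ i = (\<Sum>u\<in>?A. a u * u $ i)" by (rule V.lincomb_index[OF i Ac])
      moreover have "(\<Sum>u\<in>?A. a u * u $ i) = a (v e) * v e $ i + (\<Sum>u\<in>v ` Y. a u * u $ i)"
        using veY fY by simp
      moreover have "(\<Sum>u\<in>v ` Y. a u * u $ i) = (\<Sum>y\<in>Y. v y $ i * (d y \<bullet> v e))"
        using a by (subst sum.reindex[OF injY]) (auto intro: sum.cong)
      ultimately show "V.lincomb a ?A $ i = 0\<^sub>v n $ i" using i by (simp add: a_def)
    qed
    moreover have "a (v e) \<noteq> 0" by (simp add: a_def)
    moreover have "finite ?A" "?A \<subseteq> v ` X" using fY YX e(1) by auto
    ultimately have "V.lin_dep (v ` X)"
      unfolding V.lin_dep_def by (intro exI[of _ ?A] exI[of _ a] exI[of _ "v e"]) (auto simp: module_vec_simps class_ring_simps)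
    then show False using L by simp
  qed
  then show ?R using shY by (simp add: sh_def)
qed

section \<open>Codes of matrices, and the final estimate\<close>

lemma representable_obtain_code:
  assumes "representable TYPE('k::{field,finite}) M" and wf: "finite (ground M)" "\<And>X. X \<in> indeps M \<Longrightarrow> X \<subseteq> ground M"
  shows "\<exists>C :: ('a \<Rightarrow> 'k) set. represents C M"
proof -
  obtain A :: "'k mat" and h where h: "bij_betw h (ground M) (ground (column_matroid A))"
    and ind: "\<forall>X\<subseteq>ground M. X \<in> indeps M \<longleftrightarrow> h ` X \<in> indeps (column_matroid A)"
    using assms(1) by (auto simp: representable_def matroid_iso_def)
  let ?E = "ground M" and ?n = "dim_row A"
  define v where "v x = col A (h x)" for x
  have vc: "v x \<in> carrier_vec ?n" for x by (simp add: v_def)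
  define f where "f w x = (if x \<in> ?E then w \<bullet> v x else 0)" for w x
  \<comment> \<open>The row space of \<open>A\<close>, carried over to the ground set.\<close>
  define C where "C = f ` carrier_vec ?n"
  have "linear_code ?E C"
    unfolding linear_code_def
  proof (intro conjI ballI allI impI)
    have "f (0\<^sub>v ?n) = (\<lambda>_. 0)" using vc by (auto simp: f_def fun_eq_iff)
    then show "(\<lambda>_. 0) \<in> C" unfolding C_def by (metis imageI zero_carrier_vec)
  next
    fix g g' c assume "g \<in> C" "g' \<in> C"
    then obtain w w' where w: "w \<in> carrier_vec ?n" "g = f w" "w' \<in> carrier_vec ?n" "g' = f w'" by (auto simp: C_def)
    have "f (w + c \<cdot>\<^sub>v w') x = g x + c * g' x" for x
      using w vc[of x] by (simp add: f_def add_scalar_prod_distrib[of _ ?n])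
    then have "(\<lambda>x. g x + c * g' x) = f (w + c \<cdot>\<^sub>v w')" by (simp add: fun_eq_iff)
    then show "(\<lambda>x. g x + c * g' x) \<in> C" using w(1,3) unfolding C_def by simp
  qed (use wf in \<open>auto simp: C_def f_def\<close>)
  moreover have "X \<in> indeps M \<longleftrightarrow> X \<subseteq> ?E \<and> shattered C X" for X
  proof (cases "X \<subseteq> ?E")
    case True
    have injh: "inj_on h X" using h True by (auto simp: bij_betw_def intro: inj_on_subset)
    have hX: "h ` X \<subseteq> {..<dim_col A}" using h True by (auto simp: bij_betw_def column_matroid_def)
    have "X \<in> indeps M \<longleftrightarrow> inj_on (col A) (h ` X) \<and> \<not> module.lin_dep class_ring (module_vec TYPE('k) ?n) (col A ` h ` X)"
      using ind True hX by (auto simp: column_matroid_def)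
    also have "inj_on (col A) (h ` X) \<longleftrightarrow> inj_on v X"
      using comp_inj_on_iff[OF injh, of "col A"] by (simp add: v_def[abs_def] comp_def)
    also have "col A ` h ` X = v ` X" by (simp add: v_def image_image)
    also have "inj_on v X \<and> \<not> module.lin_dep class_ring (module_vec TYPE('k) ?n) (v ` X) \<longleftrightarrow>
        (\<forall>k. \<exists>w\<in>carrier_vec ?n. \<forall>x\<in>X. w \<bullet> v x = k x)"
      by (rule lin_indpt_iff_functionals) (use True wf(1) finite_subset vc in auto)
    also have "\<dots> \<longleftrightarrow> shattered C X"
    proof -
      have "(\<exists>g\<in>C. \<forall>x\<in>X. g x = k x) \<longleftrightarrow> (\<exists>w\<in>carrier_vec ?n. \<forall>x\<in>X. w \<bullet> v x = k x)" for k
        using True by (auto simp: C_def f_def subset_iff)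
      then show ?thesis by (simp add: shattered_def)
    qed
    finally show ?thesis using True by simp
  next
    case False
    then show ?thesis using wf(2) by blast
  qed
  ultimately have "represents C M" by (auto simp: represents_def)
  then show ?thesis by blast
qed

text \<open>Singletons and pairs are independent in the dual, so the columns of the orthogonal code
  are nonzero and pairwise different.\<close>

lemma cosimple_points_dual_code:
  fixes C :: "('a \<Rightarrow> 'k::{field,finite}) set"
  assumes rep: "represents C M" and cos: "cosimple_matroid M"
  shows "points (ground M) (dual_code (ground M) C) = card (ground M)"
proof -
  let ?E = "ground M" and ?D = "dual_code (ground M) C"
  have repD: "represents ?D (dual M)" by (rule represents_dual[OF rep])
  have ind: "X \<in> indeps (dual M) \<longleftrightarrow> X \<subseteq> ?E \<and> shattered ?D X" for X
    using repD by (simp add: represents_def)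
  have D: "linear_code ?E ?D" using repD by (simp add: represents_def)
  have empty: "{} \<in> indeps (dual M)" using linear_code_zero[OF D] by (auto simp: ind shattered_def)
  have single: "{e} \<in> indeps (dual M)" if e: "e \<in> ?E" for e
  proof (rule ccontr)
    assume "{e} \<notin> indeps (dual M)"
    moreover have "X \<in> indeps (dual M)" if "X \<subset> {e}" for X
    proof -
      have "X = {}" using that by auto
      then show ?thesis using empty by simp
    qed
    ultimately have "circuit (dual M) {e}" using e by (simp add: circuit_def)
    then show False using cos by (simp add: cosimple_matroid_def simple_matroid_def loop_def)
  qed
  have pair: "{e, f} \<in> indeps (dual M)" if e: "e \<in> ?E" "f \<in> ?E" "e \<noteq> f" for e f
  proof (rule ccontr)
    assume "{e, f} \<notin> indeps (dual M)"
    moreover have "X \<in> indeps (dual M)" if "X \<subset> {e, f}" for X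
    proof -
      have "X = {} \<or> X = {e} \<or> X = {f}" using that by auto
      then show ?thesis using empty single e by auto
    qed
    ultimately have "circuit (dual M) {e, f}" using e by (simp add: circuit_def)
    then have "parallel_pair (dual M) e f" using e(3) by (simp add: parallel_pair_def)
    then show False using cos by (auto simp: cosimple_matroid_def simple_matroid_def)
  qed
  have "column ?D e \<noteq> (\<lambda>_. 0)" if e: "e \<in> ?E" for e
  proof
    assume "column ?D e = (\<lambda>_. 0)"
    then have z: "\<forall>g\<in>?D. g e = 0" by (simp add: column_zero_iff)
    obtain g where "g \<in> ?D" "\<forall>x\<in>{e}. g x = (if x = e then 1 else 0)"
      using shattered_dual[of ?D "{e}" e] single[OF e] ind by blast
    then show False using z by auto
  qed
  then have "(\<lambda>_. 0) \<notin> column ?D ` ?E" by (metis imageE)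
  moreover have "inj_on (column ?D) ?E"
  proof (rule inj_onI, rule ccontr)
    fix e f assume e: "e \<in> ?E" "f \<in> ?E" "column ?D e = column ?D f" "e \<noteq> f"
    obtain g where g: "g \<in> ?D" "\<forall>x\<in>{e, f}. g x = (if x = e then 1 else 0)"
      using shattered_dual[of ?D "{e, f}" e] pair[OF e(1,2,4)] ind by blast
    have "g e = g f" by (rule column_eqD[OF e(3) g(1)])
    then show False using g(2) e(4) by simp
  qed
  ultimately show ?thesis by (simp add: points_def card_image)
qed

lemma girth_le_card_dependent:
  assumes M: "matroid M" and X: "X \<subseteq> ground M" "X \<notin> indeps M" and f: "enat f \<le> girth M"
  shows "f \<le> card X"
proof -
  have fX: "finite X" using matroid.finite_ground[OF M] X(1) finite_subset by blast
  obtain Y where Y: "Y \<subseteq> X" "Y \<notin> indeps M" and least: "\<And>Z. Z \<subseteq> X \<Longrightarrow> Z \<notin> indeps M \<Longrightarrow> card Y \<le> card Z"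
    using ex_has_least_nat[of "\<lambda>Y. Y \<subseteq> X \<and> Y \<notin> indeps M" X card] X(2) by blast
  have fY: "finite Y" using Y(1) fX finite_subset by blast
  have "Z \<in> indeps M" if "Z \<subset> Y" for Z
  proof (rule ccontr)
    assume "Z \<notin> indeps M"
    then have "card Y \<le> card Z" using that Y(1) by (intro least) auto
    then show False using psubset_card_mono[OF fY that] by simp
  qed
  then have "circuit M Y" using Y X(1) by (auto simp: circuit_def)
  then have "girth M \<le> enat (card Y)" unfolding girth_def by (intro Inf_lower) blast
  then have "enat f \<le> enat (card Y)" using f by (rule order_trans[rotated])
  then have "f \<le> card Y" by simp
  also have "\<dots> \<le> card X" by (rule card_mono[OF fX Y(1)])
  finally show ?thesis .
qed

theorem theorem1:
  fixes t :: nat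
  shows "\<exists>f :: nat. \<forall>M :: 'a indep_system.
    matroid M \<and> ground M \<noteq> {} \<and>
    cosimple_matroid M \<and> representable TYPE('k :: {field, finite}) M \<and> enat f \<le> girth M \<longrightarrow>
      has_minor M (cycle_matroid (clique t)) \<or> has_minor M (dual (cycle_matroid (clique t)))"
proof -
  let ?q = "CARD('k)"
  obtain \<Lambda>0 where \<Lambda>0: "\<forall>E (C :: ('a \<Rightarrow> 'k) set) r.
     linear_code E C \<longrightarrow> card C \<le> ?q ^ r \<longrightarrow> \<Lambda>0 * r < points E C \<longrightarrow> clique_code t C"
    using dense_clique_code[where 'a='a and 'k='k, of t] by blast
  define \<Lambda> where "\<Lambda> = \<Lambda>0 + 1"
  have \<Lambda>: "clique_code t C" if "linear_code E C" "card C \<le> ?q ^ r" "\<Lambda> * r < points E C"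
    for E and C :: "('a \<Rightarrow> 'k) set" and r
  proof -
    have "\<Lambda>0 * r < points E C" using that(3) by (simp add: \<Lambda>_def)
    then show ?thesis using \<Lambda>0 that(1,2) by blast
  qed
  define c where "c = 16 * (\<Lambda> + 1) * (16 + 2 * ?q)"
  \<comment> \<open>\<open>c\<close> is the constant of the packing inequality, which forces
    \<open>k \<le> 8 * c * \<Lambda>\<^sup>2\<close> in the end. The summand
    \<open>2 * \<Lambda>\<^sup>2\<close> makes \<open>T\<close> positive, and
    \<open>\<Lambda>\<close> provides a second element of \<open>Y\<close>.\<close>
  define k where "k = 8 * c * \<Lambda>\<^sup>2 + 2 * \<Lambda>\<^sup>2 + \<Lambda> + 1"
  have "has_minor M (cycle_matroid (clique t)) \<or> has_minor M (dual (cycle_matroid (clique t)))"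
    if M: "matroid M" and ne: "ground M \<noteq> {}" and cos: "cosimple_matroid M"
      and repr: "representable TYPE('k) M" and girth: "enat (k + 2) \<le> girth M" for M :: "'a indep_system"
  proof (rule ccontr)
    assume no: "\<not> ?thesis"
    let ?E = "ground M"
    obtain C :: "('a \<Rightarrow> 'k) set" where rep: "represents C M"
      using representable_obtain_code[OF repr matroid.finite_ground[OF M] matroid.indep_subset_ground[OF M]] by blast
    have C: "linear_code ?E C" and ind: "\<And>X. X \<in> indeps M \<longleftrightarrow> X \<subseteq> ?E \<and> shattered C X"
      using rep by (simp_all add: represents_def)
    have fE: "finite ?E" by (rule linear_code_finite_ground[OF C])
    obtain B where B: "B \<subseteq> ?E" "shattered C B" "\<forall>g\<in>C. (\<forall>x\<in>B. g x = 0) \<longrightarrow> (\<forall>y\<in>?E. g y = 0)"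
      using shattered_basis[OF C fE] by blast
    have det: "\<forall>g\<in>C. (\<forall>x\<in>B. g x = 0) \<longrightarrow> g = (\<lambda>_. 0)"
    proof (intro ballI impI ext)
      fix g x assume g: "g \<in> C" "\<forall>x\<in>B. g x = 0"
      then have "\<forall>y\<in>?E. g y = 0" using bspec[OF B(3)] by simp
      then show "g x = 0" using linear_code_support[OF C g(1)] by blast
    qed
    obtain u where u: "code_basis ?E C B u" using exists_code_basis[OF C B(1,2) det] by blast
    interpret code_basis ?E C B u by (rule u)
    have sparse: "points ?E (sub A) \<le> \<Lambda> * card A" if A: "A \<subseteq> B" for A
    proof (rule ccontr)
      assume dense: "\<not> ?thesis"
      have CA: "linear_code ?E (sub A)" by (rule linear_code_shorten[OF C])
      have "card (sub A) \<le> ?q ^ card A"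
      proof (rule card_le_power_determining[OF CA])
        show "finite A" using A finB finite_subset by blast
        show "\<forall>g\<in>sub A. (\<forall>x\<in>A. g x = 0) \<longrightarrow> g = (\<lambda>_. 0)"
        proof (intro ballI impI)
          fix g assume g: "g \<in> sub A" "\<forall>x\<in>A. g x = 0"
          then have "g \<in> C" "\<forall>x\<in>B. g x = 0" by (auto simp: shorten_def)
          then show "g = (\<lambda>_. 0)" using bspec[OF det] by simp
        qed
      qed
      then have "clique_code t (sub A)" using \<Lambda>[OF CA] dense by (simp add: not_le)
      then have "clique_code t C" by (rule clique_code_shorten)
      then show False using clique_code_has_minor[OF rep] no by blast
    qed
    \<comment> \<open>The orthogonal code has at most \<open>q ^ card Y\<close> words, and by
      cosimplicity every element of \<open>?E\<close> is a point of it.\<close>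
    have cE: "card ?E \<le> \<Lambda> * card Y"
    proof (rule ccontr)
      assume dense: "\<not> ?thesis"
      have CD: "linear_code ?E (dual_code ?E C)" by (rule linear_code_dual_code[OF fE])
      have "card (dual_code ?E C) \<le> ?q ^ card Y"
        by (rule card_le_power_determining[OF CD finY]) (use dual_code_det in blast)
      then have "clique_code t (dual_code ?E C)"
        using \<Lambda>[OF CD] dense cosimple_points_dual_code[OF rep cos] by (simp add: not_le)
      then have "has_minor (dual M) (cycle_matroid (clique t))"
        by (rule clique_code_has_minor[OF represents_dual[OF rep]])
      then show False
        using has_minor_dual[OF _ represents_wf[OF rep] wf_indep_cycle_matroid_clique] no by blast
    qed
    have dep: "k + 2 \<le> card X" if "X \<subseteq> ?E" "\<not> shattered C X" for X
      by (rule girth_le_card_dependent[OF M that(1) _ girth]) (use that ind in blast)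
    \<comment> \<open>Two columns together with the basis elements of the rows in which they differ
      are dependent; the columns themselves account for the 2 in \<open>k + 2\<close>.\<close>
    have far: "k \<le> card {b \<in> B. u b x \<noteq> u b y}" if x: "x \<in> Y" and y: "y \<in> Y" and xy: "x \<noteq> y" for x y
    proof -
      let ?S = "{b \<in> B. u b x \<noteq> u b y}"
      have S: "?S \<subseteq> ?E" "finite ?S" using B(1) finB by auto
      have "\<not> shattered C (insert x (insert y ?S))"
      proof
        assume "shattered C (insert x (insert y ?S))"
        from shattered_dual[OF this, of x] obtain g where
          g: "g \<in> C" "\<forall>z\<in>insert x (insert y ?S). g z = (if z = x then 1 else 0)" by blast
        have xB: "x \<notin> B" using x by (simp add: Y_def)
        have "g b * u b x = g b * u b y" if b: "b \<in> B" for b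
        proof (cases "u b x = u b y")
          case False
          then have "g b = 0" using g(2) b xB by auto
          then show ?thesis by simp
        qed simp
        then have "(\<Sum>b\<in>B. g b * u b x) = (\<Sum>b\<in>B. g b * u b y)" by (intro sum.cong) simp_all
        then have "g x = g y" using expand[OF g(1), of x] expand[OF g(1), of y] by simp
        then show False using g(2) xy by auto
      qed
      moreover have "insert x (insert y ?S) \<subseteq> ?E" using S(1) x y by (simp add: Y_def)
      ultimately have "k + 2 \<le> card (insert x (insert y ?S))" by (intro dep)
      also have "\<dots> \<le> card ?S + 2"
        using card_insert_le_m1[of "card ?S + 2" "insert y ?S" x] card_insert_le_m1[of "card ?S + 1" ?S y] by simp
      finally show ?thesis by simp
    qed
    have cY: "0 < card Y" using cE ne fE by (cases "card Y") auto
    then obtain y where y: "y \<in> Y" by (metis card.empty ex_in_conv less_irrefl)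
    \<comment> \<open>A dependent set makes the ground set large, hence by \<open>cE\<close> also
      \<open>Y\<close>. Two elements of \<open>Y\<close> then bound \<open>card B\<close> from below
      through \<open>far\<close>.\<close>
    have "\<not> shattered C (insert y B)"
    proof
      assume "shattered C (insert y B)"
      from shattered_dual[OF this, of y] obtain g where
        g: "g \<in> C" "\<forall>z\<in>insert y B. g z = (if z = y then 1 else 0)" by blast
      have "\<forall>b\<in>B. g b = 0" using g(2) y by (auto simp: Y_def)
      then have "g = (\<lambda>_. 0)" using bspec[OF det g(1)] by simp
      then show False using g(2) by auto
    qed
    then have "k + 2 \<le> card (insert y B)" using y B(1) by (intro dep) (auto simp: Y_def)
    also have "\<dots> \<le> card ?E" using y B(1) fE by (intro card_mono) (auto simp: Y_def)
    finally have kY: "k + 2 \<le> \<Lambda> * card Y" using cE by simp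
    have "1 < card Y"
    proof (rule ccontr)
      assume "\<not> 1 < card Y"
      then have "\<Lambda> * card Y \<le> \<Lambda> * 1" by (intro mult_le_mono2) simp
      then have "k + 2 \<le> \<Lambda>" using kY by linarith
      moreover have "\<Lambda> \<le> k" by (simp add: k_def)
      ultimately show False by linarith
    qed
    then obtain y' where y': "y' \<in> Y" "y' \<noteq> y"
      by (metis card_1_singletonE card_le_Suc0_iff_eq finY not_less One_nat_def y)
    define r where "r = card B"
    have kr: "k \<le> r"
      using far[OF y'(1) y y'(2)] card_mono[OF finB, of "{b \<in> B. u b y' \<noteq> u b y}"] by (simp add: r_def)
    have rY: "r \<le> \<Lambda> * card Y" using card_mono[OF fE B(1)] cE by (simp add: r_def)
    have \<Lambda>1: "0 < \<Lambda>" by (simp add: \<Lambda>_def)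
    \<comment> \<open>Small enough that \<open>\<Lambda> * T\<close> is at most half of
      \<open>card Y\<close>, since \<open>r \<le> \<Lambda> * card Y\<close>, and large enough that
      \<open>r < 4 * \<Lambda>\<^sup>2 * T\<close>; this removes \<open>r\<close> from the packing
      inequality.\<close>
    define T where "T = r div (2 * \<Lambda>\<^sup>2)"
    have L2: "0 < 2 * \<Lambda>\<^sup>2" using \<Lambda>1 by simp
    have "2 * \<Lambda>\<^sup>2 \<le> r" using kr by (simp add: k_def)
    then have T0: "0 < T" using L2 by (simp add: T_def div_greater_zero_iff)
    have Tr: "T * (2 * \<Lambda>\<^sup>2) \<le> r" by (simp add: T_def)
    have "T * 1 \<le> T * (2 * \<Lambda>\<^sup>2)" using L2 by (intro mult_le_mono2) simp
    then have "T \<le> r" using Tr by linarith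
    then have TB: "T \<le> card B" by (simp add: r_def)
    have "r < T * (2 * \<Lambda>\<^sup>2) + 2 * \<Lambda>\<^sup>2" unfolding T_def using L2 by (metis div_mult_mod_eq mod_less_divisor nat_add_left_cancel_less)
    moreover have "1 * (2 * \<Lambda>\<^sup>2) \<le> T * (2 * \<Lambda>\<^sup>2)" using T0 by (intro mult_le_mono1) simp
    moreover have "4 * \<Lambda>\<^sup>2 * T = 2 * (T * (2 * \<Lambda>\<^sup>2))" by simp
    ultimately have rT: "r < 4 * \<Lambda>\<^sup>2 * T" by linarith
    have "\<Lambda> * (2 * (\<Lambda> * T)) = T * (2 * \<Lambda>\<^sup>2)" by (simp add: power2_eq_square)
    then have "\<Lambda> * (2 * (\<Lambda> * T)) \<le> \<Lambda> * card Y" using Tr rY by linarith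
    then have "2 * (\<Lambda> * T) \<le> card Y" using \<Lambda>1 by simp
    then have half: "real (card Y) / 2 \<le> real (card Y) - real \<Lambda> * real T"
      by (simp add: of_nat_mult[symmetric] del: of_nat_mult)
    have "real T * real k * (real (card Y) / 2) \<le> real T * real k * (real (card Y) - real \<Lambda> * real T)"
      by (rule mult_left_mono[OF half]) simp
    also have "\<dots> \<le> 16 * (real \<Lambda> + 1) * (16 + 2 * real ?q) * real (card B) * real (card Y)"
      by (rule packing[OF sparse far T0 TB \<Lambda>1])
    also have "\<dots> = (2 * real c * real r) * (real (card Y) / 2)" by (simp add: c_def r_def)
    finally have "real T * real k \<le> 2 * real c * real r" using cY by (simp add: mult_le_cancel_right)
    then have "real (T * k) \<le> real (2 * c * r)" by simp
    then have "T * k \<le> 2 * c * r" by (simp only: of_nat_le_iff)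
    also have "\<dots> \<le> 2 * c * (4 * \<Lambda>\<^sup>2 * T)" using rT by (intro mult_le_mono2) simp
    finally have "T * k \<le> T * (8 * c * \<Lambda>\<^sup>2)" by (simp add: ac_simps)
    then have "k \<le> 8 * c * \<Lambda>\<^sup>2" using T0 by simp
    then show False by (simp add: k_def)
  qed
  then show ?thesis by (intro exI[of _ "k + 2"]) blast
qed

end
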